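(* Let $l_1,l_2>0$ and let $q=\{q_j\}_{j=1,2}$ with $q_j\in L^2[0,l_j]$ real-valued, $j=1,2$. Let $\lambda_0(q)\le\lambda_1(q)\le\cdots$ denote the eigenvalues, counted with multiplicity, of the boundary value problem $L(q)$ on the lasso graph, and let $\lambda_0(0)\le\lambda_1(0)\le\cdots$ be those of the same problem $L(0)$ with zero potential $q_1=q_2=0$. If $\lambda_n(q)=\lambda_n(0)$ for all $n=0,1,2,\ldots$, then $q_j(x_j)=0$ for almost every $x_j\in[0,l_j]$, $j=1,2$.
   Context: The lasso graph $G$ consists of a boundary edge $e_1$ of length $l_1>0$ and a loop $e_2$ of length $l_2>0$ (arbitrary lengths). Edge $e_j$ is parameterized by $x_j\in[0,l_j]$; $x_1=0$ is the boundary vertex, $x_1=l_1$ is the internal vertex, and both $x_2=0$ and $x_2=l_2$ correspond to the internal vertex. A function on $G$ is a pair $y=\{y_j\}_{j=1,2}$ with $y_j$ defined on $[0,l_j]$. For a potential $q=\{q_j\}_{j=1,2}$ with $q_j\in L^2[0,l_j]$ real-valued, the boundary value problem $L(q)$ is $$-y_j''(x_j)+q_j(x_j)y_j(x_j)=\lambda y_j(x_j),\quad x_j\in[0,l_j],\quad j=1,2,$$ where $y_j,y_j'$ are absolutely continuous on $[0,l_j]$, with the matching conditions $$y_1(l_1)=y_2(l_2)=y_2(0),\qquad y_1'(l_1)+y_2'(l_2)-y_2'(0)=0,$$ and the Neumann condition $y_1'(0)=0$. It corresponds to a self-adjoint operator in $L^2(0,l_1)\oplus L^2(0,l_2)$ whose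 spectrum is a discrete real sequence, bounded from below and tending to $+\infty$, arranged in ascending order counting multiplicities as $\lambda_0(q)\le\lambda_1(q)\le\cdots\to+\infty$. *)

theory Defs
  imports "HOL-Analysis.Analysis" "HOL-Library.Function_Algebras"
begin

text \<open>
  A function on the lasso graph is a pair of functions on the edges \<open>[0, l1]\<close> (boundary edge) and
  \<open>[0, l2]\<close> (loop). Functions on an edge are represented by functions on \<open>real\<close>; for potentials only
  the values on the edge matter, while eigenfunctions are required to vanish off the edge, so that
  each function on the graph has a unique representative and dimensions are counted correctly.
\<close>

type_synonym lasso_fun = "(real \<Rightarrow> complex) \<times> (real \<Rightarrow> complex)"

definition lasso_scale :: "complex \<Rightarrow> lasso_fun \<Rightarrow> lasso_fun" where
  "lasso_scale c y = ((\<lambda>x. c * fst y x), (\<lambda>x. c * snd y x))"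

global_interpretation lasso: vector_space lasso_scale
  by unfold_locales
     (auto simp: lasso_scale_def prod_eq_iff fun_eq_iff algebra_simps)

definition real_L2 :: "real \<Rightarrow> (real \<Rightarrow> real) \<Rightarrow> bool" where
  "real_L2 l q \<longleftrightarrow> q \<in> borel_measurable (lebesgue_on {0..l}) \<and>
     integrable (lebesgue_on {0..l}) (\<lambda>x. (q x)\<^sup>2)"

text \<open>
  Absolute continuity of a function; the library's \<open>absolutely_continuous\<close> is about measures.
  A pair \<open>(a, b) \<in> I\<close> stands for the interval \<open>[a, b]\<close>; the intervals must not overlap.
\<close>

definition absolutely_continuous_on :: "real set \<Rightarrow> (real \<Rightarrow> 'a::real_normed_vector) \<Rightarrow> bool" where
  "absolutely_continuous_on S f \<longleftrightarrow>
     (\<forall>e>0. \<exists>d>0. \<forall>I.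
        finite I \<and> (\<forall>(a, b)\<in>I. a \<le> b \<and> {a..b} \<subseteq> S) \<and>
        pairwise (\<lambda>(a, b) (a', b'). {a<..<b} \<inter> {a'<..<b'} = {}) I \<and>
        (\<Sum>(a, b)\<in>I. b - a) < d
        \<longrightarrow> (\<Sum>(a, b)\<in>I. norm (f b - f a)) < e)"

text \<open>The derivative is one-sided at the endpoints of the edge.\<close>

definition edge_deriv :: "real \<Rightarrow> (real \<Rightarrow> complex) \<Rightarrow> real \<Rightarrow> complex" where
  "edge_deriv l y x = vector_derivative y (at x within {0..l})"

definition edge_solution :: "real \<Rightarrow> (real \<Rightarrow> real) \<Rightarrow> complex \<Rightarrow> (real \<Rightarrow> complex) \<Rightarrow> bool" where
  "edge_solution l q z y \<longleftrightarrow>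
     y differentiable_on {0..l} \<and>
     absolutely_continuous_on {0..l} y \<and>
     absolutely_continuous_on {0..l} (edge_deriv l y) \<and>
     (AE x in lebesgue_on {0..l}. \<exists>y2.
        (edge_deriv l y has_vector_derivative y2) (at x within {0..l}) \<and>
        - y2 + complex_of_real (q x) * y x = z * y x)"

text \<open>All solutions of the boundary value problem \<open>L(q)\<close> with spectral parameter \<open>z\<close>.\<close>

definition lasso_eigenspace ::
  "real \<Rightarrow> real \<Rightarrow> (real \<Rightarrow> real) \<Rightarrow> (real \<Rightarrow> real) \<Rightarrow> complex \<Rightarrow> lasso_fun set" where
  "lasso_eigenspace l1 l2 q1 q2 z = {(y1, y2).
     (\<forall>x. x \<notin> {0..l1} \<longrightarrow> y1 x = 0) \<and> (\<forall>x. x \<notin> {0..l2} \<longrightarrow> y2 x = 0) \<and>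
     edge_solution l1 q1 z y1 \<and> edge_solution l2 q2 z y2 \<and>
     y1 l1 = y2 l2 \<and> y2 l2 = y2 0 \<and>
     edge_deriv l1 y1 l1 + edge_deriv l2 y2 l2 - edge_deriv l2 y2 0 = 0 \<and>
     edge_deriv l1 y1 0 = 0}"

text \<open>
  \<open>lam\<close> lists the spectrum of \<open>L(q)\<close> in ascending order counting multiplicities: every complex number
  \<open>z\<close> occurs in the sequence exactly as often as its multiplicity (the dimension of its eigenspace,
  the problem being self-adjoint), which is \<open>0\<close> if \<open>z\<close> is not an eigenvalue. All fibres of \<open>lam\<close> are
  finite because the sequence tends to infinity.
\<close>

definition lasso_eigenvalues ::
  "real \<Rightarrow> real \<Rightarrow> (real \<Rightarrow> real) \<Rightarrow> (real \<Rightarrow> real) \<Rightarrow> (nat \<Rightarrow> real) \<Rightarrow> bool" where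
  "lasso_eigenvalues l1 l2 q1 q2 lam \<longleftrightarrow>
     mono lam \<and> filterlim lam at_top sequentially \<and>
     (\<forall>z. card {n. complex_of_real (lam n) = z} = lasso.dim (lasso_eigenspace l1 l2 q1 q2 z))"

end

theory Submission
  imports Defs "HOL-Complex_Analysis.Complex_Analysis" "HOL-Real_Asymp.Real_Asymp"
begin

text \<open>
This is an Ambarzumian theorem: the spectrum of the zero potential determines the potential. The
proof has two halves. The first extracts from the spectrum that the potential has mean zero over the
whole graph and that the problem has no eigenvalue below \<open>0\<close>; the second shows that the constant
function is then forced to be an eigenfunction.

For the first half, write \<open>C\<close>, \<open>S\<close> for the solutions on an edge with initial data \<open>(1, 0)\<close> and
\<open>(0, 1)\<close>. An eigenfunction is determined by its value at the boundary vertex and its derivative at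
the start of the loop, and the matching conditions become a \<open>2 \<times> 2\<close> linear system whose entries are
entire functions of the spectral parameter. Up to sign its determinant is the characteristic function
\<open>\<Delta> = C\<^sub>1 (C\<^sub>2 + S\<^sub>2' - 2) + C\<^sub>1' S\<^sub>2\<close>, evaluated at the ends of the edges (\<open>char_fun\<close>). It vanishes at
every eigenvalue, and to second order at a double one, because then all four entries vanish. For the
zero potential and \<open>z = \<rho>\<^sup>2\<close>, the characteristic function is \<open>- 2 s T\<close>, where
\<open>s = sin (\<rho> l2 / 2)\<close> belongs to the antisymmetric functions on the loop and
\<open>T = 2 cos (\<rho> l1) sin (\<rho> l2 / 2) + sin (\<rho> l1) cos (\<rho> l2 / 2)\<close> to the symmetric ones; both have
only simple zeros. Hence equality of the spectra makes \<open>\<Delta>(\<rho>\<^sup>2)\<close> divisible by \<open>s T\<close>. The entire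
quotient is bounded: away from the real axis because, for large \<open>\<rho>\<close>, \<open>|\<Delta>(\<rho>\<^sup>2)|\<close> is at most
and \<open>|s T|\<close> is at least a constant times \<open>exp (|Im \<rho>| (l1 + l2))\<close>, and in a strip around the real axis by a normal families
argument that uses translates of \<open>s T\<close>. By Liouville it is a constant
(\<open>isospectral_char_fun\<close>). Comparing both sides at \<open>\<rho> = \<i> \<kappa>\<close>, as \<open>\<kappa> \<rightarrow> \<infinity>\<close>, to leading order gives the
constant \<open>- 2\<close>, and to order \<open>1 / \<kappa>\<close> it gives \<open>\<integral> q1 + \<integral> q2 = 0\<close> (\<open>isospectral_mean_zero\<close>). The same
identity shows that \<open>\<Delta>\<close> is positive on the negative half-line and vanishes at \<open>0\<close>.

For the second half, \<open>C\<^sub>1\<close> and \<open>S\<^sub>2\<close> are positive for very negative spectral parameters. Moving the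
parameter up, positivity can only be lost at the end of an edge, and the positivity of \<open>\<Delta>\<close> excludes
that up to and including \<open>0\<close> (\<open>positive_up_to_zero\<close>). So at \<open>0\<close> there is an eigenfunction \<open>y\<close> that is
positive on the whole graph. Its logarithmic derivative \<open>w = y' / y\<close> satisfies \<open>w' = q - w\<^sup>2\<close>, and the
matching conditions cancel the boundary terms, so \<open>\<integral> q = \<integral> w\<^sup>2\<close>. The mean is zero, hence \<open>w = 0\<close>,
and therefore \<open>q = 0\<close> almost everywhere (\<open>potential_zero\<close>).

Potentials are merely integrable, so all differential equations are used in integrated form: a
function and its derivative are related by \<open>primitive_on\<close>, in terms of the gauge integral. Henstock's
lemma provides the product rule for such pairs, and a gauge argument shows that an absolutely
continuous function is the primitive of its almost everywhere derivative.
\<close>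

section \<open>Absolutely continuous functions and their derivatives\<close>

definition nonoverlapping_in :: "real set \<Rightarrow> (real \<times> real) set \<Rightarrow> bool" where
  "nonoverlapping_in S I \<longleftrightarrow> finite I \<and> (\<forall>(a, b)\<in>I. a \<le> b \<and> {a..b} \<subseteq> S) \<and>
     pairwise (\<lambda>(a, b) (a', b'). {a<..<b} \<inter> {a'<..<b'} = {}) I"

text \<open>Bundling the side conditions on a family of intervals keeps the later
\<open>\<epsilon>\<close>-\<open>\<delta>\<close> arguments readable.\<close>

lemma absolutely_continuous_on_iff:
  "absolutely_continuous_on S f \<longleftrightarrow> (\<forall>e>0. \<exists>d>0. \<forall>I. nonoverlapping_in S I \<and> (\<Sum>(a, b)\<in>I. b - a) < d
     \<longrightarrow> (\<Sum>(a, b)\<in>I. norm (f b - f a)) < e)"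
  by (simp only: absolutely_continuous_on_def nonoverlapping_in_def conj_assoc)

lemma nonoverlapping_in_subset: "nonoverlapping_in T I \<Longrightarrow> T \<subseteq> S \<Longrightarrow> nonoverlapping_in S I"
  unfolding nonoverlapping_in_def by fast

lemma absolutely_continuous_on_subset:
  assumes "absolutely_continuous_on S f" "T \<subseteq> S"
  shows "absolutely_continuous_on T f"
  using assms(1) nonoverlapping_in_subset[OF _ assms(2)] unfolding absolutely_continuous_on_iff by meson

lemma absolutely_continuous_on_cong:
  assumes "absolutely_continuous_on S f" "\<And>x. x \<in> S \<Longrightarrow> g x = f x"
  shows "absolutely_continuous_on S g"
proof -
  have "(\<Sum>(a, b)\<in>I. norm (g b - g a)) = (\<Sum>(a, b)\<in>I. norm (f b - f a))" if I: "nonoverlapping_in S I" for I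
  proof (rule sum.cong[OF refl], clarify)
    fix a b assume "(a, b) \<in> I"
    then have "a \<le> b" "{a..b} \<subseteq> S" using I by (auto simp: nonoverlapping_in_def)
    then have "a \<in> S" "b \<in> S" by auto
    then show "norm (g b - g a) = norm (f b - f a)" by (simp add: assms(2))
  qed
  then show ?thesis using assms(1) unfolding absolutely_continuous_on_iff by (metis (no_types, lifting))
qed

lemma absolutely_continuous_on_lipschitz:
  fixes f :: "real \<Rightarrow> 'a::real_normed_vector"
  assumes "\<And>u v. u \<in> {0..l} \<Longrightarrow> v \<in> {0..l} \<Longrightarrow> norm (f v - f u) \<le> L * \<bar>v - u\<bar>"
  shows "absolutely_continuous_on {0..l} f"
  unfolding absolutely_continuous_on_iff
proof (intro allI impI)
  fix e :: real assume "e > 0"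
  define M where "M = \<bar>L\<bar> + 1"
  have M: "M > 0" "L \<le> M" by (auto simp: M_def)
  have "(\<Sum>(a, b)\<in>I. norm (f b - f a)) < e" if I: "nonoverlapping_in {0..l} I" "(\<Sum>(a, b)\<in>I. b - a) < e / M" for I
  proof -
    have "(\<Sum>(a, b)\<in>I. norm (f b - f a)) \<le> (\<Sum>(a, b)\<in>I. M * (b - a))"
    proof (rule sum_mono, clarify)
      fix a b assume "(a, b) \<in> I"
      then have ab: "a \<le> b" "{a..b} \<subseteq> {0..l}" using I by (auto simp: nonoverlapping_in_def)
      then have "norm (f b - f a) \<le> L * \<bar>b - a\<bar>" by (intro assms) auto
      also have "\<dots> \<le> M * (b - a)" using ab M by (simp add: mult_right_mono)
      finally show "norm (f b - f a) \<le> M * (b - a)" .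
    qed
    also have "\<dots> = M * (\<Sum>(a, b)\<in>I. b - a)" by (simp add: sum_distrib_left split_def)
    also have "\<dots> < e" using I M by (simp add: field_simps)
    finally show ?thesis .
  qed
  then show "\<exists>d>0. \<forall>I. nonoverlapping_in {0..l} I \<and> (\<Sum>(a, b)\<in>I. b - a) < d \<longrightarrow> (\<Sum>(a, b)\<in>I. norm (f b - f a)) < e"
    using \<open>e > 0\<close> M by (intro exI[of _ "e / M"]) auto
qed

text \<open>A sufficient criterion for the fundamental theorem that never mentions the
derivative of \<open>F\<close>: on fine divisions the increments of \<open>F\<close> are well approximated by \<open>f\<close>, with errors
that are small even when summed in norm. The increments telescope. Both the fundamental theorem for
absolutely continuous functions and the product rule below are instances.\<close>

lemma has_integral_variational:
  fixes f F :: "real \<Rightarrow> 'a::banach"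
  assumes "a \<le> b"
    and var: "\<And>e. e > 0 \<Longrightarrow> \<exists>\<gamma>. gauge \<gamma> \<and> (\<forall>p. p tagged_division_of {a..b} \<longrightarrow> \<gamma> fine p \<longrightarrow>
       (\<Sum>(x,K)\<in>p. norm (measure lborel K *\<^sub>R f x - (F (Sup K) - F (Inf K)))) \<le> e)"
  shows "(f has_integral (F b - F a)) {a..b}"
  unfolding has_integral_real
proof (intro allI impI)
  fix e :: real assume "e > 0"
  then obtain \<gamma> where g: "gauge \<gamma>" and le: "\<And>p. p tagged_division_of {a..b} \<Longrightarrow> \<gamma> fine p \<Longrightarrow>
       (\<Sum>(x,K)\<in>p. norm (measure lborel K *\<^sub>R f x - (F (Sup K) - F (Inf K)))) \<le> e/2"
    using var[of "e/2"] by auto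
  have *: "norm ((\<Sum>(x,K)\<in>p. measure lborel K *\<^sub>R f x) - (F b - F a)) < e"
    if p: "p tagged_division_of {a..b}" "\<gamma> fine p" for p
  proof -
    have eq: "F b - F a = (\<Sum>(x,K)\<in>p. F (Sup K) - F (Inf K))"
      using additive_tagged_division_1[OF \<open>a \<le> b\<close> p(1), of F] by simp
    have "norm ((\<Sum>(x,K)\<in>p. measure lborel K *\<^sub>R f x) - (F b - F a))
        = norm (\<Sum>(x,K)\<in>p. measure lborel K *\<^sub>R f x - (F (Sup K) - F (Inf K)))"
      unfolding eq by (simp add: sum_subtractf split_def)
    also have "\<dots> \<le> (\<Sum>(x,K)\<in>p. norm (measure lborel K *\<^sub>R f x - (F (Sup K) - F (Inf K))))"
      by (rule order_trans[OF norm_sum]) (simp add: split_def)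
    also have "\<dots> < e" using le[OF p] \<open>e > 0\<close> by simp
    finally show ?thesis .
  qed
  show "\<exists>\<gamma>. gauge \<gamma> \<and> (\<forall>\<D>. \<D> tagged_division_of {a..b} \<and> \<gamma> fine \<D> \<longrightarrow>
        norm ((\<Sum>(x,K)\<in>\<D>. measure lborel K *\<^sub>R f x) - (F b - F a)) < e)" 
    using g * by (intro exI[of _ \<gamma>] conjI allI impI) auto
qed

lemma tagged_division_interval:
  fixes a b :: real
  assumes "p tagged_division_of {a..b}" "(x, K) \<in> p"
  shows "K = {Inf K..Sup K}" "Inf K \<le> x" "x \<le> Sup K" "a \<le> Inf K" "Sup K \<le> b" "measure lborel K = Sup K - Inf K"
        "Inf K \<in> K" "Sup K \<in> K" "x \<in> K"
proof -
  obtain u v where K: "K = cbox u v" using tagged_division_ofD(4)[OF assms] by blast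
  have x: "x \<in> K" "K \<subseteq> {a..b}" using tagged_division_ofD(2,3)[OF assms] by auto
  then have uv: "u \<le> v" "K = {u..v}" using K by auto
  then have "Inf K = u" "Sup K = v" by auto
  then show "K = {Inf K..Sup K}" "Inf K \<le> x" "x \<le> Sup K" "a \<le> Inf K" "Sup K \<le> b" "measure lborel K = Sup K - Inf K"
    "Inf K \<in> K" "Sup K \<in> K" "x \<in> K"
    using uv x by auto
qed

lemma sum_content_le_measure:
  fixes U :: "real set"
  assumes p: "p tagged_partial_division_of {a..b}" and U: "U \<in> lmeasurable" "\<And>x K. (x, K) \<in> p \<Longrightarrow> K \<subseteq> U"
  shows "(\<Sum>(x,K)\<in>p. measure lborel K) \<le> measure lebesgue U"
proof -
  have "p tagged_division_of \<Union>(snd ` p)"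
    using tagged_partial_division_of_Union_self[OF p] .
  then have d: "snd ` p division_of \<Union>(snd ` p)"
    by (rule division_of_tagged_division)
  have "(\<Sum>(x,K)\<in>p. measure lborel K) = (\<Sum>K\<in>snd ` p. measure lborel K)"
    by (rule sum.over_tagged_division_lemma[OF \<open>p tagged_division_of \<Union>(snd ` p)\<close>])
       (simp add: content_eq_0_interior)
  also have "\<dots> = (\<Sum>K\<in>snd ` p. measure lebesgue K)"
    using division_ofD(4)[OF d] by (intro sum.cong refl) (metis borel_closed closed_cbox measure_completion sets_lborel)
  also have "\<dots> = measure lebesgue (\<Union>(snd ` p))"
    by (rule content_division[OF d])
  also have "\<dots> \<le> measure lebesgue U"
  proof (rule measure_mono_fmeasurable)
    show "\<Union>(snd ` p) \<subseteq> U" using U(2) by fastforce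
    show "\<Union>(snd ` p) \<in> sets lebesgue" using lmeasurable_division[OF d] by (rule fmeasurableD)
  qed fact
  finally show ?thesis .
qed

text \<open>Off the null set \<open>N\<close> the derivative controls the increments, as in the
classical proof. The intervals tagged in \<open>N\<close> are kept inside an open set \<open>U\<close> of small measure by the
gauge; there absolute continuity makes the sum of the increments small, while the integrand is
redefined to be \<open>0\<close>.\<close>

theorem absolutely_continuous_has_integral:
  fixes F f :: "real \<Rightarrow> 'a::banach"
  assumes "a \<le> b" and ac: "absolutely_continuous_on {a..b} F"
    and N: "negligible N" "\<And>x. x \<in> {a..b} - N \<Longrightarrow> (F has_vector_derivative f x) (at x within {a..b})"
  shows "(f has_integral (F b - F a)) {a..b}"
proof -
  define g where "g x = (if x \<in> N then 0 else f x)" for x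
  have "(g has_integral (F b - F a)) {a..b}"
  proof (rule has_integral_variational[OF \<open>a \<le> b\<close>])
    fix e :: real assume "e > 0"
    define e1 where "e1 = e / (2 * (b - a + 1))"
    have "e1 > 0" using \<open>e > 0\<close> \<open>a \<le> b\<close> by (simp add: e1_def)
    obtain d where "d > 0" and d: "\<And>I. nonoverlapping_in {a..b} I \<Longrightarrow> (\<Sum>(a, b)\<in>I. b - a) < d \<Longrightarrow>
        (\<Sum>(a, b)\<in>I. norm (F b - F a)) < e/2"
      using ac[unfolded absolutely_continuous_on_iff, rule_format, of "e/2"] \<open>e > 0\<close> by auto
    have "N \<in> sets lebesgue" using N(1) negligible_iff_null_sets by blast
    then obtain U where U: "open U" "N \<subseteq> U" "U - N \<in> lmeasurable" "emeasure lebesgue (U - N) < ennreal (d/2)"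
      using sets_lebesgue_outer_open[of N "d/2"] \<open>d > 0\<close> by auto
    have Ul: "U \<in> lmeasurable"
    proof -
      have "U = (U - N) \<union> N" using U by auto
      moreover have "N \<in> lmeasurable" using N(1) by (rule negligible_imp_measurable)
      ultimately show ?thesis using U(3) fmeasurable.Un by metis
    qed
    have mU: "measure lebesgue U < d"
    proof -
      have "measure lebesgue U = measure lebesgue (U - N)"
        using N(1) Ul by (simp add: measure_Diff_null_set negligible_iff_null_sets fmeasurableD)
      also have "\<dots> < d"
      proof -
        have "ennreal (measure lebesgue (U - N)) < ennreal (d/2)"
          using U(3,4) by (simp add: emeasure_eq_measure2)
        then show ?thesis using \<open>d > 0\<close> by (simp add: ennreal_less_iff)
      qed
      finally show ?thesis .
    qed
    have "\<exists>\<delta>>0. (x \<in> {a..b} - N \<longrightarrow> (\<forall>y\<in>{a..b}. norm (y-x) < \<delta> \<longrightarrow>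
             norm (F y - F x - (y-x) *\<^sub>R f x) \<le> e1 * norm (y-x))) \<and> (x \<in> N \<longrightarrow> ball x \<delta> \<subseteq> U)" for x
    proof (cases "x \<in> N")
      case True
      then show ?thesis using U(1,2) by (metis DiffD2 open_contains_ball subset_iff)
    next
      case False
      show ?thesis
      proof (cases "x \<in> {a..b}")
        case True
        then show ?thesis using N(2)[of x] False \<open>e1 > 0\<close>
          unfolding has_vector_derivative_def has_derivative_within_alt by auto
      next
        case c: False
        then show ?thesis using False by (intro exI[of _ 1]) auto
      qed
    qed
    then obtain \<delta> where \<delta>: "\<And>x. \<delta> x > 0"
      "\<And>x y. x \<in> {a..b} - N \<Longrightarrow> y \<in> {a..b} \<Longrightarrow> norm (y-x) < \<delta> x \<Longrightarrow> norm (F y - F x - (y-x) *\<^sub>R f x) \<le> e1 * norm (y-x)"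
      "\<And>x. x \<in> N \<Longrightarrow> ball x (\<delta> x) \<subseteq> U"
      by metis
    have "(\<Sum>(x,K)\<in>p. norm (measure lborel K *\<^sub>R g x - (F (Sup K) - F (Inf K)))) \<le> e"
      if p: "p tagged_division_of {a..b}" "(\<lambda>x. ball x (\<delta> x)) fine p" for p
    proof -
      have fin: "finite p" using p(1) by (rule tagged_division_of_finite)
      define p1 where "p1 = {z\<in>p. fst z \<in> N}"
      define p2 where "p2 = {z\<in>p. fst z \<notin> N}"
      note iv = tagged_division_interval[OF p(1)]
      have fineD: "K \<subseteq> ball x (\<delta> x)" if "(x,K) \<in> p" for x K using p(2) that by (auto simp: fine_def)
      have split: "(\<Sum>(x,K)\<in>p. norm (measure lborel K *\<^sub>R g x - (F (Sup K) - F (Inf K)))) =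
         (\<Sum>(x,K)\<in>p1. norm (measure lborel K *\<^sub>R g x - (F (Sup K) - F (Inf K)))) +
         (\<Sum>(x,K)\<in>p2. norm (measure lborel K *\<^sub>R g x - (F (Sup K) - F (Inf K))))"
      proof -
        have p12: "p = p1 \<union> p2" "p1 \<inter> p2 = {}" "finite p1" "finite p2"
          using fin by (auto simp: p1_def p2_def)
        show ?thesis unfolding p12(1) by (rule sum.union_disjoint[OF p12(3,4,2)])
      qed
      have "(\<Sum>(x,K)\<in>p1. norm (measure lborel K *\<^sub>R g x - (F (Sup K) - F (Inf K)))) = (\<Sum>(x,K)\<in>p1. norm (F (Sup K) - F (Inf K)))"
        by (rule sum.cong) (auto simp: p1_def g_def norm_minus_commute)
      also have "\<dots> < e/2"
      proof -
        define h where "h = (\<lambda>(x::real,K::real set). (Inf K, Sup K))"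
        have int: "interior K \<inter> interior K' = {}" if "(x,K) \<in> p" "(x',K') \<in> p" "(x,K) \<noteq> (x',K')" for x K x' K'
          using tagged_division_ofD(5)[OF p(1) that] .
        have intK: "interior K = {Inf K<..<Sup K}" if "(x,K) \<in> p" for x K
          using interior_atLeastAtMost_real iv(1)[OF that] by metis
        \<comment> \<open>Distinct tags with the same interval are possible only if the interval is a point, and then the tag is that point.\<close>
        have inj: "inj_on h p1"
        proof (rule inj_onI)
          fix u v assume uv: "u \<in> p1" "v \<in> p1" "h u = h v"
          obtain x K x' K' where uv': "u = (x,K)" "v = (x',K')" by (metis surj_pair)
          have in_p: "(x,K) \<in> p" "(x',K') \<in> p" using uv uv' by (auto simp: p1_def)
          have "K = K'" using iv(1)[OF in_p(1)] iv(1)[OF in_p(2)] uv uv' by (auto simp: h_def)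
          moreover have "x = x'"
          proof (rule ccontr)
            assume "x \<noteq> x'"
            then have "interior K = {}" using int[OF in_p] \<open>K = K'\<close> by auto
            then have "\<not> Inf K < Sup K" using intK[OF in_p(1)] by auto
            then show False using iv(2,3)[OF in_p(1)] iv(2,3)[OF in_p(2)] \<open>K = K'\<close> \<open>x \<noteq> x'\<close> by auto
          qed
          ultimately show "u = v" using uv' by simp
        qed
        have s1: "(\<Sum>(x,K)\<in>p1. norm (F (Sup K) - F (Inf K))) = (\<Sum>(a, b)\<in>h ` p1. norm (F b - F a))"
          by (subst sum.reindex[OF inj]) (auto intro!: sum.cong simp: h_def)
        have s2: "(\<Sum>(a, b)\<in>h ` p1. b - a) = (\<Sum>(x,K)\<in>p1. measure lborel K)"
          by (subst sum.reindex[OF inj]) (auto intro!: sum.cong simp: h_def p1_def iv(6))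
        have "(\<Sum>(x,K)\<in>p1. measure lborel K) \<le> measure lebesgue U"
        proof (rule sum_content_le_measure)
          show "p1 tagged_partial_division_of {a..b}"
            using p(1) by (auto simp: p1_def tagged_division_of_def intro: tagged_partial_division_subset)
          show "K \<subseteq> U" if "(x,K) \<in> p1" for x K
            using that fineD[of x K] \<delta>(3)[of x] by (auto simp: p1_def)
        qed fact
        then have s3: "(\<Sum>(a, b)\<in>h ` p1. b - a) < d" using s2 mU by simp
        show ?thesis unfolding s1
        proof (rule d[OF _ s3], unfold nonoverlapping_in_def, intro conjI)
          show "finite (h ` p1)" using fin by (simp add: p1_def)
          show "\<forall>(a', b')\<in>h ` p1. a' \<le> b' \<and> {a'..b'} \<subseteq> {a..b}"
          proof
            fix w assume "w \<in> h ` p1"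
            then obtain x K where xK: "(x,K) \<in> p" "w = (Inf K, Sup K)" by (auto simp: h_def p1_def)
            then show "case w of (a', b') \<Rightarrow> a' \<le> b' \<and> {a'..b'} \<subseteq> {a..b}" using iv(2-5)[OF xK(1)] by auto
          qed
          show "pairwise (\<lambda>(a, b) (a', b'). {a<..<b} \<inter> {a'<..<b'} = {}) (h ` p1)"
            unfolding pairwise_def
          proof (intro ballI impI)
            fix u v assume uv: "u \<in> h ` p1" "v \<in> h ` p1" "u \<noteq> v"
            then obtain x K x' K' where uv': "(x,K) \<in> p" "(x',K') \<in> p" "u = h (x,K)" "v = h (x',K')"
              by (auto simp: p1_def)
            then have "interior K \<inter> interior K' = {}" using int[OF uv'(1,2)] uv(3) by blast
            then show "(case u of (a, b) \<Rightarrow> \<lambda>(a', b'). {a<..<b} \<inter> {a'<..<b'} = {}) v"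
              using intK[OF uv'(1)] intK[OF uv'(2)] uv'(3,4) by (simp add: h_def)
          qed
        qed
      qed
      finally have 1: "(\<Sum>(x,K)\<in>p1. norm (measure lborel K *\<^sub>R g x - (F (Sup K) - F (Inf K)))) < e/2" .
      have "(\<Sum>(x,K)\<in>p2. norm (measure lborel K *\<^sub>R g x - (F (Sup K) - F (Inf K)))) \<le> (\<Sum>(x,K)\<in>p2. e1 * measure lborel K)"
      proof (rule sum_mono, safe)
        fix x K assume "(x,K) \<in> p2"
        then have xK: "(x,K) \<in> p" "x \<notin> N" by (auto simp: p2_def)
        note ivx = iv[OF xK(1)]
        have "x \<in> {a..b}" using ivx by auto
        have *: "norm (F y - F x - (y-x) *\<^sub>R f x) \<le> e1 * norm (y-x)" if "y \<in> K" for y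
        proof (rule \<delta>(2))
          show "x \<in> {a..b} - N" using xK \<open>x \<in> {a..b}\<close> by blast
          show "y \<in> {a..b}" using that tagged_division_ofD(3)[OF p(1) xK(1)] by blast
          have "y \<in> ball x (\<delta> x)" using fineD[OF xK(1)] that by blast
          then show "norm (y - x) < \<delta> x" by (simp add: dist_real_def abs_minus_commute)
        qed
        have "norm (measure lborel K *\<^sub>R g x - (F (Sup K) - F (Inf K)))
            = norm ((F (Inf K) - F x - (Inf K - x) *\<^sub>R f x) - (F (Sup K) - F x - (Sup K - x) *\<^sub>R f x))"
          using xK by (simp add: g_def ivx(6) algebra_simps)
        also have "\<dots> \<le> e1 * norm (Inf K - x) + e1 * norm (Sup K - x)"
          by (rule order_trans[OF norm_triangle_ineq4 add_mono[OF *[OF ivx(7)] *[OF ivx(8)]]])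
        also have "\<dots> = e1 * measure lborel K"
          using ivx(2,3) unfolding ivx(6) by (simp add: algebra_simps)
        finally show "norm (measure lborel K *\<^sub>R g x - (F (Sup K) - F (Inf K))) \<le> e1 * measure lborel K" .
      qed
      also have "\<dots> \<le> (\<Sum>(x,K)\<in>p. e1 * measure lborel K)"
        using fin \<open>e1 > 0\<close> by (intro sum_mono2) (auto simp: p2_def)
      also have "\<dots> = e1 * (b - a)"
        using additive_content_tagged_division[of p a b] p(1) \<open>a \<le> b\<close>
        by (simp add: sum_distrib_left[symmetric] split_def)
      also have "\<dots> \<le> e/2" using \<open>e > 0\<close> \<open>a \<le> b\<close> by (simp add: e1_def field_simps)
      finally show ?thesis using 1 split by linarith
    qed
    moreover have "gauge (\<lambda>x. ball x (\<delta> x))" using \<delta>(1) gauge_ball_dependent by blast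
    ultimately show "\<exists>\<gamma>. gauge \<gamma> \<and> (\<forall>p. p tagged_division_of {a..b} \<longrightarrow> \<gamma> fine p \<longrightarrow>
       (\<Sum>(x,K)\<in>p. norm (measure lborel K *\<^sub>R g x - (F (Sup K) - F (Inf K)))) \<le> e)" by blast
  qed
  then show ?thesis
    by (rule has_integral_spike[OF N(1), rotated]) (auto simp: g_def)
qed

section \<open>Indefinite integrals\<close>

text \<open>With \<open>c\<close> the length of an interval \<open>[u, v]\<close> tagged at \<open>x\<close>, the
increment of \<open>F G\<close> differs from \<open>c (f(x) G(x) + F(x) g(x))\<close> by the errors of \<open>F\<close> and \<open>G\<close>, which are
summable by Henstock's lemma, and by \<open>c f(x) (G(v) - G(x))\<close> and \<open>c g(x) (F(u) - F(x))\<close>. Since \<open>F\<close>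
and \<open>G\<close> are continuous, a gauge that depends on \<open>f(x)\<close> and \<open>g(x)\<close> makes the latter at most \<open>c \<epsilon>\<close>.\<close>

lemma integration_by_parts_antiderivatives:
  fixes F G f g :: "real \<Rightarrow> 'a::{real_normed_algebra, euclidean_space}"
  assumes ab: "a \<le> b"
    and F: "\<And>u v. a \<le> u \<Longrightarrow> u \<le> v \<Longrightarrow> v \<le> b \<Longrightarrow> (f has_integral (F v - F u)) {u..v}"
    and G: "\<And>u v. a \<le> u \<Longrightarrow> u \<le> v \<Longrightarrow> v \<le> b \<Longrightarrow> (g has_integral (G v - G u)) {u..v}"
    and cF: "continuous_on {a..b} F" and cG: "continuous_on {a..b} G"
  shows "((\<lambda>t. f t * G t + F t * g t) has_integral (F b * G b - F a * G a)) {a..b}"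
proof (rule has_integral_variational[OF ab, where F = "\<lambda>t. F t * G t"])
  fix e :: real assume "e > 0"
  have "bounded (F ` {a..b})" "bounded (G ` {a..b})"
    using cF cG by (auto intro!: compact_imp_bounded compact_continuous_image)
  then obtain B1 B2 where "\<forall>x\<in>{a..b}. norm (F x) \<le> B1" "\<forall>x\<in>{a..b}. norm (G x) \<le> B2"
    unfolding bounded_iff by auto
  then have "1 \<le> max 1 (max B1 B2)" "\<And>x. x \<in> {a..b} \<Longrightarrow> norm (F x) \<le> max 1 (max B1 B2)"
     "\<And>x. x \<in> {a..b} \<Longrightarrow> norm (G x) \<le> max 1 (max B1 B2)"
    by (auto simp: le_max_iff_disj)
  then obtain B where B: "B \<ge> 1" "\<And>x. x \<in> {a..b} \<Longrightarrow> norm (F x) \<le> B" "\<And>x. x \<in> {a..b} \<Longrightarrow> norm (G x) \<le> B"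
    by (rule that)
  define e1 where "e1 = e / (4 * B)"
  define e2 where "e2 = e / (4 * (b - a + 1))"
  have e12: "e1 > 0" "e2 > 0" using \<open>e > 0\<close> ab B(1) by (auto simp: e1_def e2_def)
  have fi: "f integrable_on cbox a b" "g integrable_on cbox a b"
    using has_integral_integrable[OF F[of a b]] has_integral_integrable[OF G[of a b]] ab by simp_all
  obtain \<gamma>1 where g1: "gauge \<gamma>1" and h1: "\<And>p. \<lbrakk>p tagged_partial_division_of (cbox a b); \<gamma>1 fine p\<rbrakk> \<Longrightarrow>
             sum (\<lambda>(x,k). norm(measure lborel k *\<^sub>R f x - integral k f)) p < e1"
    by (rule Henstock_lemma[OF fi(1) e12(1)]) (erule that)
  obtain \<gamma>2 where g2: "gauge \<gamma>2" and h2: "\<And>p. \<lbrakk>p tagged_partial_division_of (cbox a b); \<gamma>2 fine p\<rbrakk> \<Longrightarrow>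
             sum (\<lambda>(x,k). norm(measure lborel k *\<^sub>R g x - integral k g)) p < e1"
    by (rule Henstock_lemma[OF fi(2) e12(1)]) (erule that)
  have "\<exists>\<delta>>0. t \<in> {a..b} \<longrightarrow> (\<forall>y\<in>{a..b}. dist y t < \<delta> \<longrightarrow>
      norm (F y - F t) \<le> e2 / (1 + norm (g t)) \<and> norm (G y - G t) \<le> e2 / (1 + norm (f t)))" for t
  proof (cases "t \<in> {a..b}")
    case True
    have p: "e2 / (1 + norm (g t)) > 0" "e2 / (1 + norm (f t)) > 0"
      using e12 by (auto intro!: divide_pos_pos add_pos_nonneg)
    obtain d1 where d1: "d1 > 0" "\<forall>y\<in>{a..b}. dist y t < d1 \<longrightarrow> dist (F y) (F t) < e2 / (1 + norm (g t))"
      using cF[unfolded continuous_on_iff] True p(1) by metis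
    obtain d2 where d2: "d2 > 0" "\<forall>y\<in>{a..b}. dist y t < d2 \<longrightarrow> dist (G y) (G t) < e2 / (1 + norm (f t))"
      using cG[unfolded continuous_on_iff] True p(2) by metis
    show ?thesis
      by (rule exI[of _ "min d1 d2"]) (use d1 d2 in \<open>auto simp: dist_norm intro: less_imp_le\<close>)
  qed (auto intro: exI[of _ 1])
  then obtain \<delta> where \<delta>: "\<And>t. \<delta> t > 0"
    "\<And>t y. t \<in> {a..b} \<Longrightarrow> y \<in> {a..b} \<Longrightarrow> dist y t < \<delta> t \<Longrightarrow> norm (F y - F t) \<le> e2 / (1 + norm (g t))"
    "\<And>t y. t \<in> {a..b} \<Longrightarrow> y \<in> {a..b} \<Longrightarrow> dist y t < \<delta> t \<Longrightarrow> norm (G y - G t) \<le> e2 / (1 + norm (f t))"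
    by metis
  define \<gamma> where "\<gamma> t = \<gamma>1 t \<inter> \<gamma>2 t \<inter> ball t (\<delta> t)" for t
  have "gauge \<gamma>" unfolding \<gamma>_def
    by (intro gauge_Int g1 g2 gauge_ball_dependent[rule_format]) (use \<delta>(1) in auto)
  moreover have "(\<Sum>(x,K)\<in>p. norm (measure lborel K *\<^sub>R (f x * G x + F x * g x) - (F (Sup K) * G (Sup K) - F (Inf K) * G (Inf K)))) \<le> e"
    if p: "p tagged_division_of {a..b}" "\<gamma> fine p" for p
  proof -
    have fin: "\<gamma>1 fine p" "\<gamma>2 fine p" "(\<lambda>t. ball t (\<delta> t)) fine p" using p(2) by (auto simp: \<gamma>_def fine_def)
    have pp: "p tagged_partial_division_of cbox a b" using p(1) by (simp add: tagged_division_of_def)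
    note iv = tagged_division_interval[OF p(1)]
    have tb: "norm (measure lborel K *\<^sub>R (f x * G x + F x * g x) - (F (Sup K) * G (Sup K) - F (Inf K) * G (Inf K)))
        \<le> 2 * e2 * measure lborel K + B * norm (measure lborel K *\<^sub>R f x - integral K f)
          + B * norm (measure lborel K *\<^sub>R g x - integral K g)" if xK: "(x,K) \<in> p" for x K
    proof -
      define u v c where "u = Inf K" "v = Sup K" "c = measure lborel K"
      note i = iv[OF xK, folded u_v_c_def]
      have c: "c \<ge> 0" using i by simp
      have xm: "x \<in> {a..b}" "u \<in> {a..b}" "v \<in> {a..b}" using i by auto
      have IF: "integral K f = F v - F u" "integral K g = G v - G u"
        using F[of u v] G[of u v] i by (metis integral_unique order_trans)+
      have "K \<subseteq> ball x (\<delta> x)" using fin(3) xK by (auto simp: fine_def)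
      then have d: "dist u x < \<delta> x" "dist v x < \<delta> x" using i(7,8) by (auto simp: dist_commute)
      have eq: "c *\<^sub>R (f x * G x + F x * g x) - (F v * G v - F u * G u) =
         - ((c *\<^sub>R f x) * (G v - G x)) - (F u - F x) * (c *\<^sub>R g x)
         + (c *\<^sub>R f x - (F v - F u)) * G v + F u * (c *\<^sub>R g x - (G v - G u))"
        by (simp add: algebra_simps)
      have n1: "norm ((c *\<^sub>R f x) * (G v - G x)) \<le> c * e2"
      proof -
        have "norm ((c *\<^sub>R f x) * (G v - G x)) \<le> norm (c *\<^sub>R f x) * norm (G v - G x)" by (rule norm_mult_ineq)
        also have "\<dots> \<le> (c * norm (f x)) * (e2 / (1 + norm (f x)))"
          using \<delta>(3)[OF xm(1,3) d(2)] c by (intro mult_mono) auto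
        also have "\<dots> = (c * e2) * (norm (f x) / (1 + norm (f x)))" by simp
        also have "\<dots> \<le> (c * e2) * 1" using c e12
          by (intro mult_left_mono) (auto simp: divide_le_eq_1 add_pos_nonneg)
        finally show ?thesis by simp
      qed
      have n2: "norm ((F u - F x) * (c *\<^sub>R g x)) \<le> c * e2"
      proof -
        have "norm ((F u - F x) * (c *\<^sub>R g x)) \<le> norm (F u - F x) * norm (c *\<^sub>R g x)" by (rule norm_mult_ineq)
        also have "\<dots> \<le> (e2 / (1 + norm (g x))) * (c * norm (g x))"
          using \<delta>(2)[OF xm(1,2) d(1)] c e12 by (intro mult_mono) (auto intro!: divide_nonneg_nonneg)
        also have "\<dots> = (c * e2) * (norm (g x) / (1 + norm (g x)))" by simp
        also have "\<dots> \<le> (c * e2) * 1" using c e12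
          by (intro mult_left_mono) (auto simp: divide_le_eq_1 add_pos_nonneg)
        finally show ?thesis by simp
      qed
      have n3: "norm ((c *\<^sub>R f x - (F v - F u)) * G v) \<le> B * norm (c *\<^sub>R f x - (F v - F u))"
        by (rule order_trans[OF norm_mult_ineq]) (use B(3)[OF xm(3)] in \<open>simp add: mult.commute mult_right_mono\<close>)
      have n4: "norm (F u * (c *\<^sub>R g x - (G v - G u))) \<le> B * norm (c *\<^sub>R g x - (G v - G u))"
        by (rule order_trans[OF norm_mult_ineq]) (use B(2)[OF xm(2)] in \<open>simp add: mult_right_mono\<close>)
      have tri: "norm (- A - C + D + E) \<le> norm A + norm C + norm D + norm E" for A C D E :: 'a
      proof -
        have "norm (- A - C + D + E) \<le> norm (- A - C + D) + norm E" by (rule norm_triangle_ineq)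
        moreover have "norm (- A - C + D) \<le> norm (- A - C) + norm D" by (rule norm_triangle_ineq)
        moreover have "norm (- A - C) \<le> norm (- A) + norm C" by (rule norm_triangle_ineq4)
        ultimately show ?thesis by simp
      qed
      show ?thesis unfolding IF u_v_c_def[symmetric]
        unfolding eq by (rule order_trans[OF tri]) (use add_mono[OF add_mono[OF add_mono[OF n1 n2] n3] n4] in \<open>simp add: algebra_simps\<close>)
    qed
    have "(\<Sum>(x,K)\<in>p. norm (measure lborel K *\<^sub>R (f x * G x + F x * g x) - (F (Sup K) * G (Sup K) - F (Inf K) * G (Inf K))))
       \<le> (\<Sum>(x,K)\<in>p. 2 * e2 * measure lborel K + B * norm (measure lborel K *\<^sub>R f x - integral K f)
          + B * norm (measure lborel K *\<^sub>R g x - integral K g))"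
      using tb by (intro sum_mono) auto
    also have "\<dots> = 2 * e2 * (\<Sum>(x,K)\<in>p. measure lborel K) + B * (\<Sum>(x,K)\<in>p. norm (measure lborel K *\<^sub>R f x - integral K f))
       + B * (\<Sum>(x,K)\<in>p. norm (measure lborel K *\<^sub>R g x - integral K g))"
      by (simp add: sum.distrib sum_distrib_left split_def)
    also have "\<dots> \<le> 2 * e2 * (b - a) + B * e1 + B * e1"
    proof -
      have "(\<Sum>(x,K)\<in>p. measure lborel K) = b - a"
        using additive_content_tagged_division[of p a b] p(1) ab by simp
      then show ?thesis using h1[OF pp fin(1)] h2[OF pp fin(2)] B(1) e12
        by (intro add_mono mult_left_mono) auto
    qed
    also have "\<dots> \<le> e"
    proof -
      have "B * e1 = e / 4" using B(1) by (simp add: e1_def)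
      moreover have "2 * (e / (4 * D)) * x = (e / 2) * (x / D)" for D x :: real by simp
      then have "2 * e2 * (b - a) = (e / 2) * ((b - a) / (b - a + 1))" unfolding e2_def .
      moreover have "\<dots> \<le> (e / 2) * 1" using \<open>e > 0\<close> ab by (intro mult_left_mono) (auto simp: divide_le_eq_1)
      ultimately show ?thesis by linarith
    qed
    finally show ?thesis .
  qed
  ultimately show "\<exists>\<gamma>. gauge \<gamma> \<and> (\<forall>p. p tagged_division_of {a..b} \<longrightarrow> \<gamma> fine p \<longrightarrow>
     (\<Sum>(x,K)\<in>p. norm (measure lborel K *\<^sub>R (f x * G x + F x * g x) - (F (Sup K) * G (Sup K) - F (Inf K) * G (Inf K)))) \<le> e)"
    by (intro exI[of _ \<gamma>] conjI allI impI) auto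
qed

text \<open>The relation \<open>F' = f\<close> in integrated form; it is insensitive to changes of \<open>f\<close> on null sets.\<close>

definition primitive_on :: "real \<Rightarrow> (real \<Rightarrow> 'a::banach) \<Rightarrow> (real \<Rightarrow> 'a) \<Rightarrow> bool" where
  "primitive_on l F f \<longleftrightarrow> (\<forall>x\<in>{0..l}. (f has_integral (F x - F 0)) {0..x})"

lemma primitive_onD: "primitive_on l F f \<Longrightarrow> x \<in> {0..l} \<Longrightarrow> (f has_integral (F x - F 0)) {0..x}"
  by (simp add: primitive_on_def)

lemma primitive_on_eq: "primitive_on l F f \<Longrightarrow> x \<in> {0..l} \<Longrightarrow> F x = F 0 + integral {0..x} f"
  by (drule (1) primitive_onD) (simp add: integral_unique)

lemma primitive_on_integrable: "primitive_on l F f \<Longrightarrow> x \<in> {0..l} \<Longrightarrow> f integrable_on {0..x}"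
  by (drule (1) primitive_onD) blast

lemma primitive_on_subinterval:
  assumes "primitive_on l F f" "0 \<le> u" "u \<le> v" "v \<le> l"
  shows "(f has_integral (F v - F u)) {u..v}"
proof -
  have i: "f integrable_on {0..v}" using primitive_on_integrable[OF assms(1), of v] assms by auto
  have "f integrable_on {u..v}"
    by (rule integrable_on_subinterval[OF i]) (use assms in auto)
  moreover have "integral {u..v} f = F v - F u"
    using Henstock_Kurzweil_Integration.integral_combine[where a = 0 and c = u and b = v and f = f] i assms
      integral_unique[OF primitive_onD[OF assms(1), of u]] integral_unique[OF primitive_onD[OF assms(1), of v]]
    by (auto simp: algebra_simps)
  ultimately show ?thesis by (metis integrable_integral)
qed

lemma primitive_on_mono: "primitive_on l F f \<Longrightarrow> m \<le> l \<Longrightarrow> primitive_on m F f"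
  by (auto simp: primitive_on_def)

lemma primitive_on_integral: "f integrable_on {0..l} \<Longrightarrow> primitive_on l (\<lambda>x. c + integral {0..x} f) f"
  unfolding primitive_on_def
  by (auto intro!: integrable_integral intro: integrable_on_subinterval)

lemma primitive_on_deriv:
  assumes "\<And>x. x \<in> {0..l} \<Longrightarrow> (F has_vector_derivative f x) (at x within {0..l})"
  shows "primitive_on l F f"
  unfolding primitive_on_def
proof
  fix x assume "x \<in> {0..l}"
  then show "(f has_integral F x - F 0) {0..x}"
    by (intro fundamental_theorem_of_calculus has_vector_derivative_within_subset[OF assms]) auto
qed

lemma primitive_on_continuous:
  assumes "primitive_on l F f"
  shows "continuous_on {0..l} F"
proof (cases "l \<ge> 0")
  case True
  have "continuous_on {0..l} (\<lambda>x. F 0 + integral {0..x} f)"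
    using primitive_on_integrable[OF assms, of l] True
    by (intro continuous_on_add continuous_on_const indefinite_integral_continuous_1) auto
  then show ?thesis
    by (rule continuous_on_eq) (rule primitive_on_eq[OF assms, symmetric])
qed auto

lemma primitive_on_has_vector_derivative:
  assumes "primitive_on l F f" "continuous_on {0..l} f" "x \<in> {0..l}"
  shows "(F has_vector_derivative f x) (at x within {0..l})"
proof -
  have "((\<lambda>u. F 0 + integral {0..u} f) has_vector_derivative 0 + f x) (at x within {0..l})"
    by (intro has_vector_derivative_add has_vector_derivative_const integral_has_vector_derivative assms)
  then show ?thesis
    by (intro has_vector_derivative_transform[OF assms(3) primitive_on_eq[OF assms(1)]]) simp_all
qed

lemma primitive_on_cong:
  assumes "primitive_on l F f" "\<And>x. x \<in> {0..l} \<Longrightarrow> F x = G x" "\<And>x. x \<in> {0..l} \<Longrightarrow> f x = g x"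
  shows "primitive_on l G g"
  unfolding primitive_on_def
proof
  fix x assume x: "x \<in> {0..l}"
  have "(g has_integral F x - F 0) {0..x}"
    by (rule has_integral_eq[OF _ primitive_onD[OF assms(1) x]]) (use assms x in auto)
  then show "(g has_integral G x - G 0) {0..x}" using assms(2) x by simp
qed

lemma primitive_on_add:
  assumes "primitive_on l F f" "primitive_on l G g"
  shows "primitive_on l (\<lambda>x. F x + G x) (\<lambda>x. f x + g x)"
  unfolding primitive_on_def
proof
  fix x assume "x \<in> {0..l}"
  then have "((\<lambda>x. f x + g x) has_integral (F x - F 0) + (G x - G 0)) {0..x}"
    by (intro has_integral_add primitive_onD[OF assms(1)] primitive_onD[OF assms(2)])
  then show "((\<lambda>x. f x + g x) has_integral (F x + G x - (F 0 + G 0))) {0..x}" by (simp add: algebra_simps)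
qed

lemma primitive_on_cmult:
  fixes F :: "real \<Rightarrow> 'a::{banach, real_normed_algebra}"
  assumes "primitive_on l F f"
  shows "primitive_on l (\<lambda>x. c * F x) (\<lambda>x. c * f x)"
  unfolding primitive_on_def
proof
  fix x assume "x \<in> {0..l}"
  then have "((\<lambda>x. c * f x) has_integral c * (F x - F 0)) {0..x}"
    by (intro has_integral_mult_right primitive_onD[OF assms])
  then show "((\<lambda>x. c * f x) has_integral (c * F x - c * F 0)) {0..x}" by (simp add: algebra_simps)
qed

lemma primitive_on_diff:
  assumes "primitive_on l F f" "primitive_on l G g"
  shows "primitive_on l (\<lambda>x. F x - G x) (\<lambda>x. f x - g x)"
  unfolding primitive_on_def
proof
  fix x assume "x \<in> {0..l}"
  then have "((\<lambda>x. f x - g x) has_integral (F x - F 0) - (G x - G 0)) {0..x}"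
    by (intro has_integral_diff primitive_onD[OF assms(1)] primitive_onD[OF assms(2)])
  then show "((\<lambda>x. f x - g x) has_integral (F x - G x - (F 0 - G 0))) {0..x}" by (simp add: algebra_simps)
qed

lemma primitive_on_mult:
  fixes F G f g :: "real \<Rightarrow> 'a::{real_normed_algebra, euclidean_space}"
  assumes F: "primitive_on l F f" and G: "primitive_on l G g"
  shows "primitive_on l (\<lambda>x. F x * G x) (\<lambda>x. f x * G x + F x * g x)"
  unfolding primitive_on_def
proof
  fix x assume x: "x \<in> {0..l}"
  show "((\<lambda>x. f x * G x + F x * g x) has_integral (F x * G x - F 0 * G 0)) {0..x}"
  proof (rule integration_by_parts_antiderivatives)
    show "continuous_on {0..x} F" "continuous_on {0..x} G"
      using x primitive_on_continuous[OF F] primitive_on_continuous[OF G] by (auto intro: continuous_on_subset)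
  qed (use x primitive_on_subinterval[OF F] primitive_on_subinterval[OF G] in auto)
qed

lemma absolutely_integrable_continuous_mult:
  fixes f g :: "real \<Rightarrow> 'a::{real_normed_algebra, euclidean_space}"
  assumes "continuous_on {a..b} g" "f absolutely_integrable_on {a..b}"
  shows "(\<lambda>x. f x * g x) absolutely_integrable_on {a..b}" "(\<lambda>x. g x * f x) absolutely_integrable_on {a..b}"
proof -
  have m: "g \<in> borel_measurable (lebesgue_on {a..b})"
    by (rule continuous_imp_measurable_on_sets_lebesgue[OF assms(1)]) auto
  have b: "bounded (g ` {a..b})"
    using assms(1) by (intro compact_imp_bounded compact_continuous_image) auto
  have bil: "bilinear (\<lambda>x y :: 'a. y * x)" "bilinear (\<lambda>x y :: 'a. x * y)"
    by (auto simp: bilinear_def linear_iff algebra_simps)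
  show "(\<lambda>x. f x * g x) absolutely_integrable_on {a..b}"
    by (rule absolutely_integrable_bounded_measurable_product[OF bil(1) m _ b assms(2)]) auto
  show "(\<lambda>x. g x * f x) absolutely_integrable_on {a..b}"
    by (rule absolutely_integrable_bounded_measurable_product[OF bil(2) m _ b assms(2)]) auto
qed

lemma absolutely_integrable_of_real:
  fixes f :: "real \<Rightarrow> real"
  assumes "f absolutely_integrable_on S"
  shows "(\<lambda>x. complex_of_real (f x)) absolutely_integrable_on S"
  using absolutely_integrable_linear[OF assms bounded_linear_of_real] by (simp add: o_def)

section \<open>Solutions on an edge and their dependence on the spectral parameter\<close>

locale edge =
  fixes l :: real and q :: "real \<Rightarrow> real"
  assumes l_pos: "l > 0" and q_int: "q absolutely_integrable_on {0..l}"
begin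

text \<open>The equation \<open>- y'' + q y = z y\<close> as a first-order system, with \<open>v\<close> in the role of \<open>y'\<close>.\<close>

definition is_solution :: "complex \<Rightarrow> (real \<Rightarrow> complex) \<Rightarrow> (real \<Rightarrow> complex) \<Rightarrow> bool" where
  "is_solution z y v \<longleftrightarrow> primitive_on l y v \<and> primitive_on l v (\<lambda>t. (complex_of_real (q t) - z) * y t)"

lemma potential_mult_integrable:
  assumes "continuous_on {0..l} y"
  shows "(\<lambda>t. (complex_of_real (q t) - z) * y t) absolutely_integrable_on {0..l}"
proof -
  have "(\<lambda>t. complex_of_real (q t) - z) absolutely_integrable_on {0..l}"
    by (intro set_integral_diff(1) absolutely_integrable_of_real q_int) auto
  then show ?thesis by (rule absolutely_integrable_continuous_mult[OF assms])
qed

text \<open>A common majorant of the coefficients \<open>1\<close> and \<open>q - z\<close> of the system for all \<open>|z| \<le> R\<close>.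
Its primitive \<open>P\<close> measures growth: the \<open>n\<close>-th Picard iterate is bounded by a multiple of
\<open>P\<^sup>n / n!\<close>.\<close>

definition pot_bound :: "real \<Rightarrow> real \<Rightarrow> real" where
  "pot_bound R t = 1 + \<bar>q t\<bar> + R"

definition pot_prim :: "real \<Rightarrow> real \<Rightarrow> real" where
  "pot_prim R x = integral {0..x} (pot_bound R)"

lemma pot_bound_integrable: "pot_bound R integrable_on {0..l}"
proof -
  have "(\<lambda>t. \<bar>q t\<bar>) integrable_on {0..l}"
    using absolutely_integrable_on_def[THEN iffD1, THEN conjunct2, OF q_int] by simp
  then show ?thesis
    unfolding pot_bound_def[abs_def] by (intro integrable_add integrable_const_ivl)
qed

lemma primitive_pot_prim: "primitive_on l (pot_prim R) (pot_bound R)"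
  using primitive_on_integral[OF pot_bound_integrable, of 0 R] by (simp add: pot_prim_def[abs_def])

lemma pot_prim_0 [simp]: "pot_prim R 0 = 0"
  by (simp add: pot_prim_def)

lemma pot_prim_nonneg: "R \<ge> 0 \<Longrightarrow> x \<in> {0..l} \<Longrightarrow> pot_prim R x \<ge> 0"
  unfolding pot_prim_def
  by (rule integral_nonneg[OF primitive_on_integrable[OF primitive_pot_prim]]) (auto simp: pot_bound_def)

lemma pot_prim_mono:
  assumes "R \<ge> 0" "x \<in> {0..l}"
  shows "pot_prim R x \<le> pot_prim R l"
  using assms unfolding pot_prim_def
  by (intro integral_subset_le primitive_on_integrable[OF primitive_pot_prim]) (auto simp: pot_bound_def)

lemma primitive_pot_prim_power:
  "primitive_on l (\<lambda>x. pot_prim R x ^ Suc n / fact (Suc n)) (\<lambda>x. pot_bound R x * (pot_prim R x ^ n / fact n))"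
proof (induction n)
  case 0
  then show ?case using primitive_pot_prim by simp
next
  case (Suc n)
  have *: "primitive_on l (\<lambda>x. inverse (real (Suc (Suc n))) * (pot_prim R x * (pot_prim R x ^ Suc n / fact (Suc n))))
     (\<lambda>x. inverse (real (Suc (Suc n))) * (pot_bound R x * (pot_prim R x ^ Suc n / fact (Suc n)) + pot_prim R x * (pot_bound R x * (pot_prim R x ^ n / fact n))))"
    by (intro primitive_on_cmult primitive_on_mult primitive_pot_prim Suc.IH)
  show ?case
  proof (rule primitive_on_cong[OF *])
    fix x
    show "inverse (real (Suc (Suc n))) * (pot_prim R x * (pot_prim R x ^ Suc n / fact (Suc n))) = pot_prim R x ^ Suc (Suc n) / fact (Suc (Suc n))"
      by (simp add: field_simps del: of_nat_Suc)
    have "pot_prim R x * (pot_bound R x * (pot_prim R x ^ n / fact n)) = real (Suc n) * (pot_bound R x * (pot_prim R x ^ Suc n / fact (Suc n)))"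
      by (simp add: field_simps del: of_nat_Suc)
    moreover have "A + B = real (Suc (Suc n)) * A" if "B = real (Suc n) * A" for A B
      by (simp add: that algebra_simps)
    ultimately have "pot_bound R x * (pot_prim R x ^ Suc n / fact (Suc n)) + pot_prim R x * (pot_bound R x * (pot_prim R x ^ n / fact n))
       = real (Suc (Suc n)) * (pot_bound R x * (pot_prim R x ^ Suc n / fact (Suc n)))"
      by blast
    then show "inverse (real (Suc (Suc n))) * (pot_bound R x * (pot_prim R x ^ Suc n / fact (Suc n)) + pot_prim R x * (pot_bound R x * (pot_prim R x ^ n / fact n)))
       = pot_bound R x * (pot_prim R x ^ Suc n / fact (Suc n))"
      by (simp del: of_nat_Suc fact_Suc)
  qed
qed

lemma norm_potential_le: "norm z \<le> R \<Longrightarrow> norm (complex_of_real (q t) - z) \<le> pot_bound R t"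
  using norm_triangle_ineq4[of "complex_of_real (q t)" z] by (simp add: pot_bound_def)

lemma picard_step:
  assumes y: "continuous_on {0..l} y" and z: "norm z \<le> R"
    and le: "\<And>t. t \<in> {0..l} \<Longrightarrow> norm (y t) \<le> K * (pot_prim R t ^ n / fact n)" and x: "x \<in> {0..l}" and "K \<ge> 0"
  shows "norm (integral {0..x} y) \<le> K * (pot_prim R x ^ Suc n / fact (Suc n))"
    and "norm (integral {0..x} (\<lambda>t. (complex_of_real (q t) - z) * y t)) \<le> K * (pot_prim R x ^ Suc n / fact (Suc n))"
proof -
  have R: "R \<ge> 0" using z norm_ge_zero[of z] by linarith
  have I: "((\<lambda>t. K * (pot_bound R t * (pot_prim R t ^ n / fact n))) has_integral K * (pot_prim R x ^ Suc n / fact (Suc n))) {0..x}"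
    using has_integral_mult_right[OF primitive_onD[OF primitive_pot_prim_power x], of K R n] by simp
  have sub: "{0..x} \<subseteq> {0..l}" using x by auto
  have yi: "y integrable_on {0..x}" by (intro integrable_continuous_real continuous_on_subset[OF y sub])
  have qi: "(\<lambda>t. (complex_of_real (q t) - z) * y t) integrable_on {0..x}"
    using integrable_on_subinterval[OF absolutely_integrable_on_def[THEN iffD1, THEN conjunct1, OF potential_mult_integrable[OF y]] sub] .
  have b: "norm (c * y t) \<le> K * (pot_bound R t * (pot_prim R t ^ n / fact n))" if "t \<in> {0..x}" "norm c \<le> pot_bound R t" for t c
  proof -
    have t: "t \<in> {0..l}" using that sub by auto
    have "norm (c * y t) \<le> pot_bound R t * (K * (pot_prim R t ^ n / fact n))"
      unfolding norm_mult using that le[OF t] R by (intro mult_mono) (auto simp: pot_bound_def)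
    then show ?thesis by (simp add: mult.left_commute)
  qed
  have "norm (integral {0..x} y) \<le> integral {0..x} (\<lambda>t. K * (pot_bound R t * (pot_prim R t ^ n / fact n)))"
    using b[where c = 1] R by (intro integral_norm_bound_integral[OF yi has_integral_integrable[OF I]]) (auto simp: pot_bound_def)
  then show "norm (integral {0..x} y) \<le> K * (pot_prim R x ^ Suc n / fact (Suc n))"
    using integral_unique[OF I] by simp
  have "norm (integral {0..x} (\<lambda>t. (complex_of_real (q t) - z) * y t)) \<le> integral {0..x} (\<lambda>t. K * (pot_bound R t * (pot_prim R t ^ n / fact n)))"
    by (intro integral_norm_bound_integral[OF qi has_integral_integrable[OF I]] b norm_potential_le[OF z])
  then show "norm (integral {0..x} (\<lambda>t. (complex_of_real (q t) - z) * y t)) \<le> K * (pot_prim R x ^ Suc n / fact (Suc n))"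
    using integral_unique[OF I] by simp
qed

text \<open>Iterating the integral equations improves a constant bound \<open>K\<close> on the solution to
\<open>K P\<^sup>n / n!\<close> for every \<open>n\<close>.\<close>

lemma solution_unique:
  assumes s: "is_solution z y v" and 0: "y 0 = 0" "v 0 = 0" and x: "x \<in> {0..l}"
  shows "y x = 0" "v x = 0"
proof -
  have py: "primitive_on l y v" and pv: "primitive_on l v (\<lambda>t. (complex_of_real (q t) - z) * y t)"
    using s by (auto simp: is_solution_def)
  have cy: "continuous_on {0..l} y" and cv: "continuous_on {0..l} v"
    using primitive_on_continuous py pv by auto
  have "bounded (y ` {0..l})" "bounded (v ` {0..l})"
    using cy cv by (auto intro!: compact_imp_bounded compact_continuous_image)
  then obtain K1 K2 where K: "\<forall>x\<in>{0..l}. norm (y x) \<le> K1" "\<forall>x\<in>{0..l}. norm (v x) \<le> K2"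
    unfolding bounded_iff by auto
  define K where "K = max 0 (max K1 K2)"
  have K0: "K \<ge> 0" by (simp add: K_def)
  define R where "R = norm z"
  have main: "\<forall>x\<in>{0..l}. norm (y x) \<le> K * (pot_prim R x ^ n / fact n) \<and> norm (v x) \<le> K * (pot_prim R x ^ n / fact n)" for n
  proof (induction n)
    case 0
    then show ?case using K by (auto simp: K_def le_max_iff_disj)
  next
    case (Suc n)
    show ?case
    proof
      fix x assume x: "x \<in> {0..l}"
      have "y x = integral {0..x} v" "v x = integral {0..x} (\<lambda>t. (complex_of_real (q t) - z) * y t)"
        using primitive_on_eq[OF py x] primitive_on_eq[OF pv x] 0 by simp_all
      then show "norm (y x) \<le> K * (pot_prim R x ^ Suc n / fact (Suc n)) \<and> norm (v x) \<le> K * (pot_prim R x ^ Suc n / fact (Suc n))"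
        using picard_step(1)[OF cv _ _ x K0, of z R n] picard_step(2)[OF cy _ _ x K0, of z R n] Suc.IH
        by (auto simp: R_def)
    qed
  qed
  have lim: "(\<lambda>n. K * (pot_prim R x ^ n / fact n)) \<longlonglongrightarrow> K * 0"
    by (intro tendsto_mult tendsto_const) (use summable_LIMSEQ_zero[OF summable_exp[of "pot_prim R x"]] in \<open>simp add: field_simps\<close>)
  have "norm (y x) \<le> K * 0" "norm (v x) \<le> K * 0"
    by (rule LIMSEQ_le_const[OF lim]; use main x in blast)+
  then show "y x = 0" "v x = 0" by auto
qed

fun picard :: "complex \<Rightarrow> complex \<Rightarrow> complex \<Rightarrow> nat \<Rightarrow> (real \<Rightarrow> complex) \<times> (real \<Rightarrow> complex)" where
  "picard a b z 0 = ((\<lambda>x. a), (\<lambda>x. b))"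
| "picard a b z (Suc n) = ((\<lambda>x. integral {0..x} (snd (picard a b z n))),
     (\<lambda>x. integral {0..x} (\<lambda>t. (complex_of_real (q t) - z) * fst (picard a b z n) t)))"

lemma picard_continuous: "continuous_on {0..l} (fst (picard a b z n)) \<and> continuous_on {0..l} (snd (picard a b z n))"
proof (induction n)
  case (Suc n)
  then show ?case
    by (auto intro!: indefinite_integral_continuous_1 integrable_continuous_real
        absolutely_integrable_on_def[THEN iffD1, THEN conjunct1, OF potential_mult_integrable])
qed auto

lemma picard_bound:
  assumes "norm z \<le> R"
  shows "\<forall>x\<in>{0..l}. norm (fst (picard a b z n) x) \<le> (norm a + norm b) * (pot_prim R x ^ n / fact n) \<and>
      norm (snd (picard a b z n) x) \<le> (norm a + norm b) * (pot_prim R x ^ n / fact n)"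
proof (induction n)
  case (Suc n)
  show ?case
    using picard_step(1)[OF _ assms, of "snd (picard a b z n)" "norm a + norm b" n]
     picard_step(2)[OF _ assms, of "fst (picard a b z n)" "norm a + norm b" n] picard_continuous[of a b z n] Suc.IH
    by (auto simp del: fact_Suc power_Suc)
qed auto

lemma picard_bound':
  assumes "norm z \<le> R" "x \<in> {0..l}"
  shows "norm (fst (picard a b z n) x) \<le> (norm a + norm b) * (pot_prim R l ^ n / fact n)"
      "norm (snd (picard a b z n) x) \<le> (norm a + norm b) * (pot_prim R l ^ n / fact n)"
proof -
  have R: "R \<ge> 0" using assms norm_ge_zero[of z] by linarith
  have "(norm a + norm b) * (pot_prim R x ^ n / fact n) \<le> (norm a + norm b) * (pot_prim R l ^ n / fact n)"
    using pot_prim_mono[OF R assms(2)] pot_prim_nonneg[OF R assms(2)]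
    by (intro mult_left_mono divide_right_mono power_mono) auto
  then show "norm (fst (picard a b z n) x) \<le> (norm a + norm b) * (pot_prim R l ^ n / fact n)"
      "norm (snd (picard a b z n) x) \<le> (norm a + norm b) * (pot_prim R l ^ n / fact n)"
    using picard_bound[OF assms(1), of a b n] assms(2) by (meson order_trans)+
qed

lemma picard_majorant_summable: "summable (\<lambda>n. (norm a + norm b) * (pot_prim R l ^ n / fact n))"
proof (rule summable_mult)
  show "summable (\<lambda>n. pot_prim R l ^ n / fact n)"
    using summable_exp[of "pot_prim R l"] by (simp add: divide_inverse mult.commute)
qed

definition sol :: "complex \<Rightarrow> complex \<Rightarrow> complex \<Rightarrow> real \<Rightarrow> complex" where
  "sol a b z x = (\<Sum>n. fst (picard a b z n) x)"

definition dsol :: "complex \<Rightarrow> complex \<Rightarrow> complex \<Rightarrow> real \<Rightarrow> complex" where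
  "dsol a b z x = (\<Sum>n. snd (picard a b z n) x)"

lemma sol_uniform_limit:
  "uniform_limit ({0..l} \<times> cball 0 R) (\<lambda>n (x, z). \<Sum>i<n. fst (picard a b z i) x) (\<lambda>(x, z). sol a b z x) sequentially"
  "uniform_limit ({0..l} \<times> cball 0 R) (\<lambda>n (x, z). \<Sum>i<n. snd (picard a b z i) x) (\<lambda>(x, z). dsol a b z x) sequentially"
proof -
  have "uniform_limit ({0..l} \<times> cball 0 R) (\<lambda>n p. \<Sum>i<n. fst (picard a b (snd p) i) (fst p)) (\<lambda>p. \<Sum>i. fst (picard a b (snd p) i) (fst p)) sequentially"
    by (rule Weierstrass_m_test[OF _ picard_majorant_summable[of a b R]]) (use picard_bound' in auto)
  then show "uniform_limit ({0..l} \<times> cball 0 R) (\<lambda>n (x, z). \<Sum>i<n. fst (picard a b z i) x) (\<lambda>(x, z). sol a b z x) sequentially"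
    by (simp add: sol_def split_def)
  have "uniform_limit ({0..l} \<times> cball 0 R) (\<lambda>n p. \<Sum>i<n. snd (picard a b (snd p) i) (fst p)) (\<lambda>p. \<Sum>i. snd (picard a b (snd p) i) (fst p)) sequentially"
    by (rule Weierstrass_m_test[OF _ picard_majorant_summable[of a b R]]) (use picard_bound' in auto)
  then show "uniform_limit ({0..l} \<times> cball 0 R) (\<lambda>n (x, z). \<Sum>i<n. snd (picard a b z i) x) (\<lambda>(x, z). dsol a b z x) sequentially"
    by (simp add: dsol_def split_def)
qed

text \<open>Each Picard iterate is a polynomial in the spectral parameter. The coefficients are
continuous functions on the edge, so that continuity and holomorphy of the iterates are immediate and
pass to the locally uniform limit.\<close>

definition poly_in_z :: "(complex \<Rightarrow> real \<Rightarrow> complex) \<Rightarrow> bool" where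
  "poly_in_z f \<longleftrightarrow> (\<exists>c n. (\<forall>k. continuous_on {0..l} (c k)) \<and> (\<forall>z. \<forall>x\<in>{0..l}. f z x = (\<Sum>k\<le>n. c k x * z ^ k)))"

lemma poly_in_z_integral:
  assumes "poly_in_z f"
  shows "poly_in_z (\<lambda>z x. integral {0..x} (f z))"
    and "poly_in_z (\<lambda>z x. integral {0..x} (\<lambda>t. (complex_of_real (q t) - z) * f z t))"
proof -
  obtain c n where c: "\<And>k. continuous_on {0..l} (c k)" and f: "\<And>z x. x \<in> {0..l} \<Longrightarrow> f z x = (\<Sum>k\<le>n. c k x * z ^ k)"
    using assms unfolding poly_in_z_def by blast
  have ci: "c k integrable_on {0..x}" if "x \<in> {0..l}" for k x
    using that by (intro integrable_continuous_real continuous_on_subset[OF c]) auto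
  have "(\<lambda>t. complex_of_real (q t) * c k t) absolutely_integrable_on {0..l}" for k
    using potential_mult_integrable[OF c, of 0 k] by simp
  then have qi0: "(\<lambda>t. complex_of_real (q t) * c k t) integrable_on {0..l}" for k
    using absolutely_integrable_on_def by blast
  then have qi: "(\<lambda>t. complex_of_real (q t) * c k t) integrable_on {0..x}" if "x \<in> {0..l}" for k x
    using that by (intro integrable_on_subinterval[OF qi0]) auto
  have I1: "integral {0..x} (f z) = (\<Sum>k\<le>n. integral {0..x} (c k) * z ^ k)" if x: "x \<in> {0..l}" for z x
  proof -
    have "integral {0..x} (f z) = integral {0..x} (\<lambda>t. \<Sum>k\<le>n. c k t * z ^ k)"
      by (rule integral_cong) (use f x in auto)
    also have "\<dots> = (\<Sum>k\<le>n. integral {0..x} (\<lambda>t. c k t * z ^ k))"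
      by (rule integral_sum) (use ci[OF x] in \<open>auto intro: integrable_on_mult_left\<close>)
    finally show ?thesis by simp
  qed
  show "poly_in_z (\<lambda>z x. integral {0..x} (f z))"
    unfolding poly_in_z_def
    by (rule exI[of _ "\<lambda>k x. integral {0..x} (c k)"], rule exI[of _ n])
       (use I1 ci[of l] l_pos in \<open>auto intro!: indefinite_integral_continuous_1\<close>)
  define d where "d k x = (if k \<le> n then integral {0..x} (\<lambda>t. complex_of_real (q t) * c k t) else 0)
      - (if k = 0 then 0 else integral {0..x} (c (k - 1)))" for k x
  have dc: "continuous_on {0..l} (d k)" for k
    unfolding d_def using qi0 ci[of l] l_pos
    by (cases "k \<le> n"; cases "k = 0") (auto intro!: continuous_intros indefinite_integral_continuous_1)
  have "integral {0..x} (\<lambda>t. (complex_of_real (q t) - z) * f z t) = (\<Sum>k\<le>Suc n. d k x * z ^ k)" if x: "x \<in> {0..l}" for z x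
  proof -
    have "integral {0..x} (\<lambda>t. (complex_of_real (q t) - z) * f z t)
       = integral {0..x} (\<lambda>t. (\<Sum>k\<le>n. complex_of_real (q t) * c k t * z ^ k) - z * f z t)"
      by (rule integral_cong) (use f x in \<open>auto simp: left_diff_distrib sum_distrib_left mult.assoc sum_subtractf\<close>)
    also have "\<dots> = integral {0..x} (\<lambda>t. \<Sum>k\<le>n. complex_of_real (q t) * c k t * z ^ k) - integral {0..x} (\<lambda>t. z * f z t)"
    proof (rule integral_diff)
      show "(\<lambda>t. \<Sum>k\<le>n. complex_of_real (q t) * c k t * z ^ k) integrable_on {0..x}"
        by (intro integrable_sum finite_atMost integrable_on_mult_left qi[OF x])
      have "(\<lambda>t. z * (\<Sum>k\<le>n. c k t * z ^ k)) integrable_on {0..x}"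
        by (intro integrable_sum finite_atMost integrable_on_mult_left integrable_on_mult_right ci[OF x])
      then show "(\<lambda>t. z * f z t) integrable_on {0..x}"
        by (rule integrable_eq) (use f x in auto)
    qed
    also have "integral {0..x} (\<lambda>t. \<Sum>k\<le>n. complex_of_real (q t) * c k t * z ^ k) = (\<Sum>k\<le>n. integral {0..x} (\<lambda>t. complex_of_real (q t) * c k t) * z ^ k)"
      by (subst integral_sum) (use qi[OF x] in \<open>auto intro: integrable_on_mult_left\<close>)
    also have "integral {0..x} (\<lambda>t. z * f z t) = (\<Sum>k\<le>n. integral {0..x} (c k) * z ^ Suc k)"
      by (simp add: I1[OF x] sum_distrib_left algebra_simps)
    also have "(\<Sum>k\<le>n. integral {0..x} (\<lambda>t. complex_of_real (q t) * c k t) * z ^ k)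
        = (\<Sum>k\<le>Suc n. (if k \<le> n then integral {0..x} (\<lambda>t. complex_of_real (q t) * c k t) else 0) * z ^ k)"
      by (simp add: sum.atMost_Suc)
    also have "(\<Sum>k\<le>n. integral {0..x} (c k) * z ^ Suc k) = (\<Sum>k\<le>Suc n. (if k = 0 then 0 else integral {0..x} (c (k - 1))) * z ^ k)"
      by (subst sum.atMost_Suc_shift) simp
    finally show ?thesis by (simp add: d_def sum_subtractf[symmetric] left_diff_distrib del: sum.atMost_Suc)
  qed
  with dc show "poly_in_z (\<lambda>z x. integral {0..x} (\<lambda>t. (complex_of_real (q t) - z) * f z t))"
    unfolding poly_in_z_def by blast
qed

lemma poly_in_z_picard: "poly_in_z (\<lambda>z. fst (picard a b z n)) \<and> poly_in_z (\<lambda>z. snd (picard a b z n))"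
proof (induction n)
  case 0
  have "poly_in_z (\<lambda>z x. a)" for a
    unfolding poly_in_z_def by (rule exI[of _ "\<lambda>k x. a"], rule exI[of _ 0]) auto
  then show ?case by simp
next
  case (Suc n)
  then show ?case using poly_in_z_integral by simp
qed

lemma poly_in_z_continuous:
  assumes "poly_in_z f"
  shows "continuous_on ({0..l} \<times> A) (\<lambda>(x, z). f z x)"
proof -
  obtain c n where c: "\<And>k. continuous_on {0..l} (c k)" and f: "\<And>z x. x \<in> {0..l} \<Longrightarrow> f z x = (\<Sum>k\<le>n. c k x * z ^ k)"
    using assms unfolding poly_in_z_def by blast
  have "continuous_on ({0..l} \<times> A) (\<lambda>p. c k (fst p))" for k
    by (rule continuous_on_compose2[OF c continuous_on_fst]) auto
  then have "continuous_on ({0..l} \<times> A) (\<lambda>p. \<Sum>k\<le>n. c k (fst p) * snd p ^ k)"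
    by (intro continuous_intros)
  then show ?thesis by (rule continuous_on_eq) (use f in auto)
qed

lemma poly_in_z_holomorphic:
  assumes "poly_in_z f" "x \<in> {0..l}"
  shows "(\<lambda>z. f z x) holomorphic_on A"
proof -
  obtain c n where f: "\<And>z x. x \<in> {0..l} \<Longrightarrow> f z x = (\<Sum>k\<le>n. c k x * z ^ k)"
    using assms unfolding poly_in_z_def by blast
  show ?thesis unfolding f[OF assms(2)] by (intro holomorphic_intros)
qed

lemma sol_continuous:
  "continuous_on ({0..l} \<times> cball 0 R) (\<lambda>(x, z). sol a b z x)"
  "continuous_on ({0..l} \<times> cball 0 R) (\<lambda>(x, z). dsol a b z x)"
proof -
  have "continuous_on ({0..l} \<times> cball 0 R) (\<lambda>(x, z). \<Sum>i<n. fst (picard a b z i) x)"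
       "continuous_on ({0..l} \<times> cball 0 R) (\<lambda>(x, z). \<Sum>i<n. snd (picard a b z i) x)" for n
    using poly_in_z_continuous[OF poly_in_z_picard[THEN conjunct1], of "cball 0 R"]
      poly_in_z_continuous[OF poly_in_z_picard[THEN conjunct2], of "cball 0 R"]
    unfolding split_def by (intro continuous_on_sum; blast)+
  then show "continuous_on ({0..l} \<times> cball 0 R) (\<lambda>(x, z). sol a b z x)"
    "continuous_on ({0..l} \<times> cball 0 R) (\<lambda>(x, z). dsol a b z x)"
    by (auto intro!: uniform_limit_theorem[OF _ sol_uniform_limit(1)] uniform_limit_theorem[OF _ sol_uniform_limit(2)])
qed

lemma sol_holomorphic:
  assumes x: "x \<in> {0..l}"
  shows "(\<lambda>z. sol a b z x) holomorphic_on UNIV" "(\<lambda>z. dsol a b z x) holomorphic_on UNIV"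
proof -
  have P: "\<exists>d>0. cball z d \<subseteq> UNIV \<and> uniform_limit (cball z d) (\<lambda>n z. \<Sum>i<n. fst (picard a b z i) x) (\<lambda>z. sol a b z x) sequentially"
     "\<exists>d>0. cball z d \<subseteq> UNIV \<and> uniform_limit (cball z d) (\<lambda>n z. \<Sum>i<n. snd (picard a b z i) x) (\<lambda>z. dsol a b z x) sequentially" for z
  proof -
    have s: "Pair x ` cball z 1 \<subseteq> {0..l} \<times> cball 0 (norm z + 1)"
    proof clarsimp
      fix w :: complex assume "dist z w \<le> 1"
      then show "0 \<le> x \<and> x \<le> l \<and> cmod w \<le> cmod z + 1"
        using x norm_triangle_sub[of w z] by (auto simp: dist_norm norm_minus_commute)
    qed
    show "\<exists>d>0. cball z d \<subseteq> UNIV \<and> uniform_limit (cball z d) (\<lambda>n z. \<Sum>i<n. fst (picard a b z i) x) (\<lambda>z. sol a b z x) sequentially"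
      using uniform_limit_compose'[OF sol_uniform_limit(1)[where R = "norm z + 1" and a = a and b = b], of "Pair x" "cball z 1"] s
      by (intro exI[of _ 1]) (auto simp: o_def)
    show "\<exists>d>0. cball z d \<subseteq> UNIV \<and> uniform_limit (cball z d) (\<lambda>n z. \<Sum>i<n. snd (picard a b z i) x) (\<lambda>z. dsol a b z x) sequentially"
      using uniform_limit_compose'[OF sol_uniform_limit(2)[where R = "norm z + 1" and a = a and b = b], of "Pair x" "cball z 1"] s
      by (intro exI[of _ 1]) (auto simp: o_def)
  qed
  have h: "(\<lambda>z. \<Sum>i<n. fst (picard a b z i) x) holomorphic_on UNIV" "(\<lambda>z. \<Sum>i<n. snd (picard a b z i) x) holomorphic_on UNIV" for n
    by (intro holomorphic_on_sum poly_in_z_holomorphic[OF _ x] poly_in_z_picard[THEN conjunct1] poly_in_z_picard[THEN conjunct2])+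
  show "(\<lambda>z. sol a b z x) holomorphic_on UNIV"
    by (rule holomorphic_uniform_sequence[OF open_UNIV h(1) P(1)])
  show "(\<lambda>z. dsol a b z x) holomorphic_on UNIV"
    by (rule holomorphic_uniform_sequence[OF open_UNIV h(2) P(2)])
qed

lemma picard_summable:
  assumes "x \<in> {0..l}"
  shows "summable (\<lambda>n. fst (picard a b z n) x)" "summable (\<lambda>n. snd (picard a b z n) x)"
  using picard_bound'[OF order_refl assms, of a b z]
  by (auto intro!: summable_comparison_test'[OF picard_majorant_summable[of a b "norm z"], of 0])

lemma sol_0 [simp]: "sol a b z 0 = a" "dsol a b z 0 = b"
proof -
  have e: "fst (picard a b z n) 0 = (if n = 0 then a else 0)" "snd (picard a b z n) 0 = (if n = 0 then b else 0)" for n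
    by (cases n; simp)+
  show "sol a b z 0 = a" "dsol a b z 0 = b"
    unfolding sol_def dsol_def e using suminf_finite[of "{0}" "\<lambda>n. if n = 0 then a else 0"]
      suminf_finite[of "{0}" "\<lambda>n. if n = 0 then b else 0"] by auto
qed

lemma sol_is_solution: "is_solution z (sol a b z) (dsol a b z)"
proof -
  define M where "M = (\<Sum>n. (norm a + norm b) * (pot_prim (norm z) l ^ n / fact n))"
  have part: "norm (\<Sum>i<n. fst (picard a b z i) x) \<le> M" "norm (\<Sum>i<n. snd (picard a b z i) x) \<le> M" if "x \<in> {0..l}" for n x
  proof -
    have nn: "0 \<le> (norm a + norm b) * (pot_prim (norm z) l ^ n / fact n)" for n
      using pot_prim_nonneg[of "norm z" l] l_pos by auto
    have *: "(\<Sum>i<n. (norm a + norm b) * (pot_prim (norm z) l ^ i / fact i)) \<le> M"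
      unfolding M_def by (rule sum_le_suminf[OF picard_majorant_summable]) (use nn in auto)
    show "norm (\<Sum>i<n. fst (picard a b z i) x) \<le> M" "norm (\<Sum>i<n. snd (picard a b z i) x) \<le> M"
      by (rule order_trans[OF sum_norm_le *], use picard_bound'[OF order_refl that] in blast)+
  qed
  have conv: "(\<lambda>n. \<Sum>i<n. fst (picard a b z i) x) \<longlonglongrightarrow> sol a b z x" "(\<lambda>n. \<Sum>i<n. snd (picard a b z i) x) \<longlonglongrightarrow> dsol a b z x"
    if "x \<in> {0..l}" for x
    unfolding sol_def dsol_def using picard_summable[OF that] summable_LIMSEQ by blast+
  have cont: "continuous_on {0..l} (\<lambda>x. \<Sum>i<n. fst (picard a b z i) x)" "continuous_on {0..l} (\<lambda>x. \<Sum>i<n. snd (picard a b z i) x)" for n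
    using picard_continuous by (auto intro!: continuous_on_sum)
  have "primitive_on l (sol a b z) (dsol a b z)"
    unfolding primitive_on_def
  proof
    fix x assume x: "x \<in> {0..l}"
    have sub: "{0..x} \<subseteq> {0..l}" using x by auto
    have i: "(\<lambda>t. \<Sum>i<n. snd (picard a b z i) t) integrable_on {0..x}" for n
      by (intro integrable_continuous_real continuous_on_subset[OF cont(2) sub])
    have e: "integral {0..x} (\<lambda>t. \<Sum>i<n. snd (picard a b z i) t) = (\<Sum>i<Suc n. fst (picard a b z i) x) - a" for n
    proof -
      have "integral {0..x} (\<lambda>t. \<Sum>i<n. snd (picard a b z i) t) = (\<Sum>i<n. integral {0..x} (snd (picard a b z i)))"
        by (intro integral_sum finite_lessThan integrable_continuous_real continuous_on_subset[OF _ sub]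
            picard_continuous[THEN conjunct2])
      also have "\<dots> = (\<Sum>i<Suc n. fst (picard a b z i) x) - a"
        by (subst sum.lessThan_Suc_shift) simp
      finally show ?thesis .
    qed
    note dc = dominated_convergence[of "\<lambda>n t. \<Sum>i<n. snd (picard a b z i) t" "{0..x}" "\<lambda>_. M" "dsol a b z",
        OF i integrable_const_ivl part(2) conv(2)]
    have "dsol a b z integrable_on {0..x}" "(\<lambda>n. (\<Sum>i<Suc n. fst (picard a b z i) x) - a) \<longlonglongrightarrow> integral {0..x} (dsol a b z)"
      using dc sub unfolding e by auto
    moreover have "(\<lambda>n. (\<Sum>i<Suc n. fst (picard a b z i) x) - a) \<longlonglongrightarrow> sol a b z x - a"
      by (intro tendsto_diff tendsto_const LIMSEQ_Suc conv x)
    ultimately show "(dsol a b z has_integral sol a b z x - sol a b z 0) {0..x}"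
      using LIMSEQ_unique by (auto simp: has_integral_iff)
  qed
  moreover have "primitive_on l (dsol a b z) (\<lambda>t. (complex_of_real (q t) - z) * sol a b z t)"
    unfolding primitive_on_def
  proof
    fix x assume x: "x \<in> {0..l}"
    have sub: "{0..x} \<subseteq> {0..l}" using x by auto
    have i0: "(\<lambda>t. (complex_of_real (q t) - z) * y t) integrable_on {0..x}" if "continuous_on {0..l} y" for y
      by (rule integrable_on_subinterval[OF absolutely_integrable_on_def[THEN iffD1, THEN conjunct1, OF potential_mult_integrable[OF that]] sub])
    have i: "(\<lambda>t. (complex_of_real (q t) - z) * (\<Sum>i<n. fst (picard a b z i) t)) integrable_on {0..x}" for n
      by (rule i0[OF cont(1)])
    have e: "integral {0..x} (\<lambda>t. (complex_of_real (q t) - z) * (\<Sum>i<n. fst (picard a b z i) t)) = (\<Sum>i<Suc n. snd (picard a b z i) x) - b" for n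
    proof -
      have "integral {0..x} (\<lambda>t. (complex_of_real (q t) - z) * (\<Sum>i<n. fst (picard a b z i) t))
          = (\<Sum>i<n. integral {0..x} (\<lambda>t. (complex_of_real (q t) - z) * fst (picard a b z i) t))"
        unfolding sum_distrib_left
        by (rule integral_sum) (use picard_continuous i0 in auto)
      also have "\<dots> = (\<Sum>i<Suc n. snd (picard a b z i) x) - b"
        by (subst sum.lessThan_Suc_shift) simp
      finally show ?thesis .
    qed
    have hb: "(\<lambda>t. M * pot_bound (norm z) t) integrable_on {0..x}"
      by (intro integrable_on_mult_right primitive_on_integrable[OF primitive_pot_prim] x)
    have le: "norm ((complex_of_real (q t) - z) * (\<Sum>i<n. fst (picard a b z i) t)) \<le> M * pot_bound (norm z) t" if "t \<in> {0..x}" for n t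
      unfolding norm_mult mult.commute[of M] using norm_potential_le[OF order_refl, of t z] part(1)[of t n] that sub
      by (intro mult_mono) (auto intro: order_trans[OF norm_ge_zero])
    have cv: "(\<lambda>n. (complex_of_real (q t) - z) * (\<Sum>i<n. fst (picard a b z i) t)) \<longlonglongrightarrow> (complex_of_real (q t) - z) * sol a b z t" if "t \<in> {0..x}" for t
      using that sub by (intro tendsto_mult tendsto_const conv) auto
    note dc = dominated_convergence[OF i hb le cv]
    have "(\<lambda>t. (complex_of_real (q t) - z) * sol a b z t) integrable_on {0..x}"
       "(\<lambda>n. (\<Sum>i<Suc n. snd (picard a b z i) x) - b) \<longlonglongrightarrow> integral {0..x} (\<lambda>t. (complex_of_real (q t) - z) * sol a b z t)"
      using dc unfolding e by auto
    moreover have "(\<lambda>n. (\<Sum>i<Suc n. snd (picard a b z i) x) - b) \<longlonglongrightarrow> dsol a b z x - b"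
      by (intro tendsto_diff tendsto_const LIMSEQ_Suc conv x)
    ultimately show "((\<lambda>t. (complex_of_real (q t) - z) * sol a b z t) has_integral dsol a b z x - dsol a b z 0) {0..x}"
      using LIMSEQ_unique by (auto simp: has_integral_iff)
  qed
  ultimately show ?thesis by (simp add: is_solution_def)
qed

lemma is_solution_add:
  assumes "is_solution z y v" "is_solution z y' v'"
  shows "is_solution z (\<lambda>x. y x + y' x) (\<lambda>x. v x + v' x)"
  using assms primitive_on_add[of l y v y' v']
    primitive_on_add[of l v "\<lambda>t. (complex_of_real (q t) - z) * y t" v' "\<lambda>t. (complex_of_real (q t) - z) * y' t"]
  by (simp add: is_solution_def algebra_simps)

lemma is_solution_cmult:
  assumes "is_solution z y v"
  shows "is_solution z (\<lambda>x. c * y x) (\<lambda>x. c * v x)"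
  using assms primitive_on_cmult[of l y v c] primitive_on_cmult[of l v "\<lambda>t. (complex_of_real (q t) - z) * y t" c]
  by (simp add: is_solution_def algebra_simps)

lemma is_solution_eq_sol:
  assumes "is_solution z y v" "x \<in> {0..l}"
  shows "y x = sol (y 0) (v 0) z x" "v x = dsol (y 0) (v 0) z x"
  using solution_unique[OF is_solution_add[OF assms(1) is_solution_cmult[OF sol_is_solution[of z "y 0" "v 0"], of "-1"]] _ _ assms(2)]
  by simp_all

lemma sol_linear:
  assumes "x \<in> {0..l}"
  shows "sol a b z x = a * sol 1 0 z x + b * sol 0 1 z x" "dsol a b z x = a * dsol 1 0 z x + b * dsol 0 1 z x"
  using is_solution_eq_sol[OF is_solution_add[OF is_solution_cmult[OF sol_is_solution[of z 1 0], of a]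
       is_solution_cmult[OF sol_is_solution[of z 0 1], of b]] assms] by simp_all

text \<open>The product rule makes the Wronskian a primitive of \<open>0\<close>.\<close>

lemma wronskian:
  assumes s: "is_solution z y v" "is_solution z y' v'" and x: "x \<in> {0..l}"
  shows "y x * v' x - v x * y' x = y 0 * v' 0 - v 0 * y' 0"
proof -
  have "primitive_on l (\<lambda>x. y x * v' x - v x * y' x)
    (\<lambda>t. (v t * v' t + y t * ((complex_of_real (q t) - z) * y' t)) - (((complex_of_real (q t) - z) * y t) * y' t + v t * v' t))"
    using s unfolding is_solution_def by (intro primitive_on_diff primitive_on_mult) auto
  then have "primitive_on l (\<lambda>x. y x * v' x - v x * y' x) (\<lambda>t. 0)"
    by (rule primitive_on_cong) (auto simp: algebra_simps)
  from primitive_on_eq[OF this x] show ?thesis by simp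
qed

end

section \<open>Absolutely continuous solutions and variation of constants\<close>

lemma cmod_sin_le: "cmod (sin z) \<le> exp \<bar>Im z\<bar>" and cmod_cos_le: "cmod (cos z) \<le> exp \<bar>Im z\<bar>"
  using cmod_sin_le_exp[of 1 z] cmod_cos_le_exp[of 1 z] by simp_all

context edge
begin

text \<open>This is the only place where the definition of a solution through absolute
continuity and almost everywhere derivatives enters for a nonzero potential; it reduces every
eigenfunction to a combination of the two fundamental solutions.\<close>

theorem edge_solution_is_solution:
  assumes "edge_solution l q z y"
  shows "is_solution z y (edge_deriv l y)"
proof -
  have d: "y differentiable_on {0..l}" and ac: "absolutely_continuous_on {0..l} (edge_deriv l y)"
    and ae: "AE x in lebesgue_on {0..l}. \<exists>y2. (edge_deriv l y has_vector_derivative y2) (at x within {0..l}) \<and>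
        - y2 + complex_of_real (q x) * y x = z * y x"
    using assms by (auto simp: edge_solution_def)
  have 1: "primitive_on l y (edge_deriv l y)"
  proof (rule primitive_on_deriv)
    fix x assume "x \<in> {0..l}"
    then have "y differentiable (at x within {0..l})" using d by (simp add: differentiable_on_def)
    then show "(y has_vector_derivative edge_deriv l y x) (at x within {0..l})"
      unfolding edge_deriv_def by (simp add: vector_derivative_works)
  qed
  let ?f = "\<lambda>t. (complex_of_real (q t) - z) * y t"
  have "AE x in lebesgue. x \<in> {0..l} \<longrightarrow> (edge_deriv l y has_vector_derivative ?f x) (at x within {0..l})"
  proof -
    have "AE x in lebesgue. x \<in> {0..l} \<longrightarrow> (\<exists>y2. (edge_deriv l y has_vector_derivative y2) (at x within {0..l}) \<and>
        - y2 + complex_of_real (q x) * y x = z * y x)"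
      using ae by (subst (asm) AE_restrict_space_iff) auto
    then show ?thesis
    proof (rule AE_mp, intro AE_I2 impI)
      fix x assume "x \<in> {0..l} \<longrightarrow> (\<exists>y2. (edge_deriv l y has_vector_derivative y2) (at x within {0..l}) \<and>
        - y2 + complex_of_real (q x) * y x = z * y x)" "x \<in> {0..l}"
      then obtain y2 where y2: "(edge_deriv l y has_vector_derivative y2) (at x within {0..l})"
        "- y2 + complex_of_real (q x) * y x = z * y x" by blast
      then have "y2 = ?f x" by (simp add: algebra_simps)
      then show "(edge_deriv l y has_vector_derivative ?f x) (at x within {0..l})" using y2 by simp
    qed
  qed
  then obtain N where N: "N \<in> null_sets lebesgue"
    "{x \<in> space lebesgue. \<not> (x \<in> {0..l} \<longrightarrow> (edge_deriv l y has_vector_derivative ?f x) (at x within {0..l}))} \<subseteq> N"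
    by (auto simp: eventually_ae_filter)
  have 2: "primitive_on l (edge_deriv l y) ?f"
    unfolding primitive_on_def
  proof
    fix x assume x: "x \<in> {0..l}"
    show "(?f has_integral edge_deriv l y x - edge_deriv l y 0) {0..x}"
    proof (rule absolutely_continuous_has_integral)
      show "0 \<le> x" using x by simp
      show "absolutely_continuous_on {0..x} (edge_deriv l y)"
        by (rule absolutely_continuous_on_subset[OF ac]) (use x in auto)
      show "negligible N" using N(1) by (simp add: negligible_iff_null_sets)
      fix t assume "t \<in> {0..x} - N"
      then have "(edge_deriv l y has_vector_derivative ?f t) (at t within {0..l})" using N(2) x by auto
      then show "(edge_deriv l y has_vector_derivative ?f t) (at t within {0..x})"
        by (rule has_vector_derivative_within_subset) (use x in auto)
    qed
  qed
  from 1 2 show ?thesis by (simp add: is_solution_def)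
qed

text \<open>The derivative of \<open>t \<mapsto> sin (\<rho> (x - t)) / \<rho> v(t) + cos (\<rho> (x - t)) y(t)\<close> is
\<open>sin (\<rho> (x - t)) / \<rho> q(t) y(t)\<close>, since the terms of the free equation cancel; the second formula
comes from the derivative of this function with respect to \<open>x\<close>.\<close>

lemma variation_of_constants:
  assumes s: "is_solution (\<rho>\<^sup>2) y v" and "\<rho> \<noteq> 0" and x: "x \<in> {0..l}"
  shows "((\<lambda>t. sin (\<rho> * of_real (x - t)) / \<rho> * (of_real (q t) * y t)) has_integral
          (y x - (cos (\<rho> * of_real x) * y 0 + sin (\<rho> * of_real x) / \<rho> * v 0))) {0..x}" (is ?A)
    and "((\<lambda>t. cos (\<rho> * of_real (x - t)) * (of_real (q t) * y t)) has_integral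
          (v x - (cos (\<rho> * of_real x) * v 0 - \<rho> * sin (\<rho> * of_real x) * y 0))) {0..x}" (is ?B)
proof -
  define G where "G t = sin (\<rho> * of_real (x - t)) / \<rho>" for t
  define H where "H t = cos (\<rho> * of_real (x - t))" for t
  have G': "primitive_on x G (\<lambda>t. - H t)"
  proof (rule primitive_on_deriv)
    fix t
    have "((\<lambda>w. sin (\<rho> * (of_real x - w)) / \<rho>) has_field_derivative - H t) (at (of_real t))"
      unfolding H_def by (rule derivative_eq_intros refl | use \<open>\<rho> \<noteq> 0\<close> in simp)+
    from has_vector_derivative_real_field[OF this]
    show "(G has_vector_derivative - H t) (at t within {0..x})" by (simp add: G_def[abs_def])
  qed
  have H': "primitive_on x H (\<lambda>t. \<rho>\<^sup>2 * G t)"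
  proof (rule primitive_on_deriv)
    fix t
    have "((\<lambda>w. cos (\<rho> * (of_real x - w))) has_field_derivative \<rho>\<^sup>2 * G t) (at (of_real t))"
      unfolding G_def by (rule derivative_eq_intros refl | use \<open>\<rho> \<noteq> 0\<close> in \<open>simp add: power2_eq_square\<close>)+
    from has_vector_derivative_real_field[OF this]
    show "(H has_vector_derivative \<rho>\<^sup>2 * G t) (at t within {0..x})" by (simp add: H_def[abs_def])
  qed
  have y: "primitive_on x y v" and v: "primitive_on x v (\<lambda>t. (of_real (q t) - \<rho>\<^sup>2) * y t)"
    using s x by (auto simp: is_solution_def intro: primitive_on_mono)
  have "primitive_on x (\<lambda>t. G t * v t + H t * y t)
     (\<lambda>t. (- H t * v t + G t * ((of_real (q t) - \<rho>\<^sup>2) * y t)) + (\<rho>\<^sup>2 * G t * y t + H t * v t))"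
    by (intro primitive_on_add primitive_on_mult G' H' y v)
  then have "primitive_on x (\<lambda>t. G t * v t + H t * y t) (\<lambda>t. G t * (of_real (q t) * y t))"
    by (rule primitive_on_cong) (auto simp: algebra_simps)
  from primitive_onD[OF this, of x] x show ?A by (simp add: G_def H_def algebra_simps)
  have "primitive_on x (\<lambda>t. H t * v t - \<rho>\<^sup>2 * (G t * y t))
     (\<lambda>t. (\<rho>\<^sup>2 * G t * v t + H t * ((of_real (q t) - \<rho>\<^sup>2) * y t)) - \<rho>\<^sup>2 * (- H t * y t + G t * v t))"
    by (intro primitive_on_diff primitive_on_cmult primitive_on_mult G' H' y v)
  then have "primitive_on x (\<lambda>t. H t * v t - \<rho>\<^sup>2 * (G t * y t)) (\<lambda>t. H t * (of_real (q t) * y t))"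
    by (rule primitive_on_cong) (auto simp: algebra_simps)
  from primitive_onD[OF this, of x] x \<open>\<rho> \<noteq> 0\<close> show ?B
    by (simp add: G_def H_def algebra_simps power2_eq_square)
qed

definition q_norm :: real where "q_norm = integral {0..l} (\<lambda>t. \<bar>q t\<bar>)"

lemma abs_q_integrable: "x \<in> {0..l} \<Longrightarrow> (\<lambda>t. \<bar>q t\<bar>) integrable_on {0..x}"
  using absolutely_integrable_on_def[THEN iffD1, THEN conjunct2, OF q_int]
  by (auto intro: integrable_on_subinterval)

lemma q_norm_nonneg: "q_norm \<ge> 0"
  unfolding q_norm_def using abs_q_integrable[of l] l_pos by (intro integral_nonneg) auto

lemma q_norm_ge: "x \<in> {0..l} \<Longrightarrow> integral {0..x} (\<lambda>t. \<bar>q t\<bar>) \<le> q_norm"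
  unfolding q_norm_def using abs_q_integrable[of l] abs_q_integrable[of x] l_pos by (intro integral_subset_le) auto

lemma weighted_integral_bound:
  fixes f :: "real \<Rightarrow> complex"
  assumes I: "(f has_integral J) {0..x}" and x: "x \<in> {0..l}" and "B \<ge> 0"
    and le: "\<And>t. t \<in> {0..x} \<Longrightarrow> norm (f t) \<le> B * \<bar>q t\<bar>"
  shows "norm J \<le> B * q_norm"
proof -
  have "norm (integral {0..x} f) \<le> integral {0..x} (\<lambda>t. B * \<bar>q t\<bar>)"
    by (rule integral_norm_bound_integral) (use I le abs_q_integrable[OF x] in \<open>auto intro: integrable_on_mult_right\<close>)
  also have "\<dots> \<le> B * q_norm" using q_norm_ge[OF x] \<open>B \<ge> 0\<close> by (simp add: mult_left_mono)
  finally show ?thesis using integral_unique[OF I] by simp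
qed

lemma exp_growth_split: "exp (\<bar>Im (\<rho> * complex_of_real (x - t))\<bar>) * exp (\<bar>Im \<rho>\<bar> * t) = exp (\<bar>Im \<rho>\<bar> * x)" if "t \<le> x"
proof -
  have "\<bar>Im (\<rho> * complex_of_real (x - t))\<bar> = \<bar>Im \<rho>\<bar> * (x - t)"
    using that by (simp only: Im_complex_of_real Re_complex_of_real times_complex.simps) (simp add: abs_mult)
  then show ?thesis by (simp add: exp_add[symmetric] algebra_simps)
qed

text \<open>For \<open>|\<rho>| \<ge> 2 \<parallel>q\<parallel>\<^sub>1\<close> the integral term in the variation of constants formula is at most
half of the supremum \<open>M\<close> of \<open>|y(x)| exp (- |Im \<rho>| x)\<close>, so it can be absorbed: \<open>M \<le> K + M / 2\<close>.\<close>

lemma solution_bound: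
  assumes s: "is_solution (\<rho>\<^sup>2) y v" and "\<rho> \<noteq> 0" and large: "2 * q_norm \<le> norm \<rho>"
    and free: "\<And>x. x \<in> {0..l} \<Longrightarrow> norm (cos (\<rho> * of_real x) * y 0 + sin (\<rho> * of_real x) / \<rho> * v 0) \<le> K * exp (\<bar>Im \<rho>\<bar> * x)"
    and x: "x \<in> {0..l}"
  shows "norm (y x) \<le> 2 * K * exp (\<bar>Im \<rho>\<bar> * x)"
    and "norm (y x - (cos (\<rho> * of_real x) * y 0 + sin (\<rho> * of_real x) / \<rho> * v 0)) \<le> 2 * K * q_norm / norm \<rho> * exp (\<bar>Im \<rho>\<bar> * x)"
    and "norm (v x - (cos (\<rho> * of_real x) * v 0 - \<rho> * sin (\<rho> * of_real x) * y 0)) \<le> 2 * K * q_norm * exp (\<bar>Im \<rho>\<bar> * x)"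
proof -
  have "primitive_on l y v" using s by (simp add: is_solution_def)
  then have cy: "continuous_on {0..l} y" by (rule primitive_on_continuous)
  have "continuous_on {0..l} (\<lambda>x. norm (y x) * exp (- (\<bar>Im \<rho>\<bar> * x)))"
    by (intro continuous_intros cy)
  then obtain x0 where x0: "x0 \<in> {0..l}" "\<And>t. t \<in> {0..l} \<Longrightarrow> norm (y t) * exp (- (\<bar>Im \<rho>\<bar> * t)) \<le> norm (y x0) * exp (- (\<bar>Im \<rho>\<bar> * x0))"
    using continuous_attains_sup[of "{0..l}" "\<lambda>x. norm (y x) * exp (- (\<bar>Im \<rho>\<bar> * x))"] l_pos by auto
  define M where "M = norm (y x0) * exp (- (\<bar>Im \<rho>\<bar> * x0))"
  have M0: "M \<ge> 0" by (simp add: M_def)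
  have yM: "norm (y t) \<le> M * exp (\<bar>Im \<rho>\<bar> * t)" if "t \<in> {0..l}" for t
    using x0(2)[OF that] by (simp add: M_def exp_minus field_simps)
  have pt: "norm (k * (of_real (q t) * y t)) \<le> (c * M * exp (\<bar>Im \<rho>\<bar> * x)) * \<bar>q t\<bar>"
    if "norm k \<le> c * exp \<bar>Im (\<rho> * of_real (x - t))\<bar>" "t \<in> {0..x}" "x \<in> {0..l}" "c \<ge> 0" for k c x t
  proof -
    have "norm (k * (of_real (q t) * y t)) = norm k * norm (y t) * \<bar>q t\<bar>" by (simp add: norm_mult)
    also have "\<dots> \<le> (c * exp \<bar>Im (\<rho> * of_real (x - t))\<bar>) * (M * exp (\<bar>Im \<rho>\<bar> * t)) * \<bar>q t\<bar>"
      using that yM[of t] by (intro mult_right_mono mult_mono) auto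
    also have "\<dots> = c * M * (exp \<bar>Im (\<rho> * of_real (x - t))\<bar> * exp (\<bar>Im \<rho>\<bar> * t)) * \<bar>q t\<bar>" by (simp add: mult_ac)
    also have "\<dots> = (c * M * exp (\<bar>Im \<rho>\<bar> * x)) * \<bar>q t\<bar>" using that(2) by (subst exp_growth_split) auto
    finally show ?thesis .
  qed
  have y_diff: "norm (y x - (cos (\<rho> * of_real x) * y 0 + sin (\<rho> * of_real x) / \<rho> * v 0)) \<le> (M / norm \<rho> * exp (\<bar>Im \<rho>\<bar> * x)) * q_norm"
    if x: "x \<in> {0..l}" for x
  proof (rule weighted_integral_bound[OF variation_of_constants(1)[OF s \<open>\<rho> \<noteq> 0\<close> x] x])
    fix t assume t: "t \<in> {0..x}"
    have "norm (sin (\<rho> * of_real (x - t)) / \<rho>) \<le> (1 / norm \<rho>) * exp \<bar>Im (\<rho> * of_real (x - t))\<bar>"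
      using cmod_sin_le[of "\<rho> * of_real (x - t)"] by (simp add: norm_divide divide_right_mono)
    from pt[OF this t x] show "norm (sin (\<rho> * of_real (x - t)) / \<rho> * (of_real (q t) * y t)) \<le> M / norm \<rho> * exp (\<bar>Im \<rho>\<bar> * x) * \<bar>q t\<bar>"
      by simp
  qed (use M0 in auto)
  have v_diff: "norm (v x - (cos (\<rho> * of_real x) * v 0 - \<rho> * sin (\<rho> * of_real x) * y 0)) \<le> (M * exp (\<bar>Im \<rho>\<bar> * x)) * q_norm"
    if x: "x \<in> {0..l}" for x
  proof (rule weighted_integral_bound[OF variation_of_constants(2)[OF s \<open>\<rho> \<noteq> 0\<close> x] x])
    fix t assume t: "t \<in> {0..x}"
    have "norm (cos (\<rho> * of_real (x - t))) \<le> 1 * exp \<bar>Im (\<rho> * of_real (x - t))\<bar>"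
      using cmod_cos_le[of "\<rho> * of_real (x - t)"] by simp
    from pt[OF this t x] show "norm (cos (\<rho> * of_real (x - t)) * (of_real (q t) * y t)) \<le> M * exp (\<bar>Im \<rho>\<bar> * x) * \<bar>q t\<bar>"
      by simp
  qed (use M0 in auto)
  have "M \<le> 2 * K"
  proof -
    have "norm (y x0) \<le> norm (cos (\<rho> * of_real x0) * y 0 + sin (\<rho> * of_real x0) / \<rho> * v 0) + (M / norm \<rho> * exp (\<bar>Im \<rho>\<bar> * x0)) * q_norm"
      using y_diff[OF x0(1)] norm_triangle_sub[of "y x0" "cos (\<rho> * of_real x0) * y 0 + sin (\<rho> * of_real x0) / \<rho> * v 0"] by linarith
    also have "\<dots> \<le> K * exp (\<bar>Im \<rho>\<bar> * x0) + (M / norm \<rho> * exp (\<bar>Im \<rho>\<bar> * x0)) * q_norm"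
      using free[OF x0(1)] by simp
    also have "\<dots> = (K + M * (q_norm / norm \<rho>)) * exp (\<bar>Im \<rho>\<bar> * x0)" by (simp add: algebra_simps)
    finally have "norm (y x0) * exp (- (\<bar>Im \<rho>\<bar> * x0)) \<le> K + M * (q_norm / norm \<rho>)"
      by (simp add: exp_minus field_simps)
    moreover have "M * (q_norm / norm \<rho>) \<le> M * (1 / 2)"
      using large \<open>\<rho> \<noteq> 0\<close> M0 by (intro mult_left_mono) (auto simp: field_simps)
    ultimately show ?thesis unfolding M_def[symmetric] by linarith
  qed
  show "norm (y x) \<le> 2 * K * exp (\<bar>Im \<rho>\<bar> * x)"
    by (rule order_trans[OF yM[OF x]]) (use \<open>M \<le> 2 * K\<close> in simp)
  show "norm (y x - (cos (\<rho> * of_real x) * y 0 + sin (\<rho> * of_real x) / \<rho> * v 0)) \<le> 2 * K * q_norm / norm \<rho> * exp (\<bar>Im \<rho>\<bar> * x)"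
    by (rule order_trans[OF y_diff[OF x]])
       (use mult_right_mono[OF \<open>M \<le> 2 * K\<close>, of "q_norm / norm \<rho> * exp (\<bar>Im \<rho>\<bar> * x)"] q_norm_nonneg in \<open>simp add: mult_ac\<close>)
  show "norm (v x - (cos (\<rho> * of_real x) * v 0 - \<rho> * sin (\<rho> * of_real x) * y 0)) \<le> 2 * K * q_norm * exp (\<bar>Im \<rho>\<bar> * x)"
    by (rule order_trans[OF v_diff[OF x]])
       (use mult_right_mono[OF \<open>M \<le> 2 * K\<close>, of "q_norm * exp (\<bar>Im \<rho>\<bar> * x)"] q_norm_nonneg in \<open>simp add: mult_ac\<close>)
qed

lemma abs_Im_mult_of_real: "x \<ge> 0 \<Longrightarrow> \<bar>Im (\<rho> * of_real x)\<bar> = \<bar>Im \<rho>\<bar> * x"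
  by (simp add: abs_mult)

lemma fundamental_bound:
  assumes large: "2 * q_norm \<le> norm \<rho>" "1 \<le> norm \<rho>" and x: "x \<in> {0..l}"
  shows "norm (sol 1 0 (\<rho>\<^sup>2) x) \<le> 2 * exp (\<bar>Im \<rho>\<bar> * x)"
    "norm (dsol 1 0 (\<rho>\<^sup>2) x) \<le> 2 * norm \<rho> * exp (\<bar>Im \<rho>\<bar> * x)"
    "norm (sol 0 1 (\<rho>\<^sup>2) x) \<le> 2 / norm \<rho> * exp (\<bar>Im \<rho>\<bar> * x)"
    "norm (dsol 0 1 (\<rho>\<^sup>2) x) \<le> 2 * exp (\<bar>Im \<rho>\<bar> * x)"
    "norm (sol 1 0 (\<rho>\<^sup>2) x - cos (\<rho> * of_real x)) \<le> 2 * q_norm / norm \<rho> * exp (\<bar>Im \<rho>\<bar> * x)"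
    "norm (dsol 0 1 (\<rho>\<^sup>2) x - cos (\<rho> * of_real x)) \<le> 2 * q_norm / norm \<rho> * exp (\<bar>Im \<rho>\<bar> * x)"
proof -
  have r0: "\<rho> \<noteq> 0" using large by auto
  have sc: "norm (sin (\<rho> * of_real x)) \<le> exp (\<bar>Im \<rho>\<bar> * x)" "norm (cos (\<rho> * of_real x)) \<le> exp (\<bar>Im \<rho>\<bar> * x)" if "x \<in> {0..l}" for x
    using cmod_sin_le[of "\<rho> * of_real x"] cmod_cos_le[of "\<rho> * of_real x"] that abs_Im_mult_of_real[of x \<rho>] by simp_all
  have q2: "2 * q_norm / norm \<rho> \<le> 1" using large r0 by (simp add: field_simps)
  have free1: "norm (cos (\<rho> * of_real x) * sol 1 0 (\<rho>\<^sup>2) 0 + sin (\<rho> * of_real x) / \<rho> * dsol 1 0 (\<rho>\<^sup>2) 0) \<le> 1 * exp (\<bar>Im \<rho>\<bar> * x)" if "x \<in> {0..l}" for x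
    using sc(2)[OF that] by simp
  have free2: "norm (cos (\<rho> * of_real x) * sol 0 1 (\<rho>\<^sup>2) 0 + sin (\<rho> * of_real x) / \<rho> * dsol 0 1 (\<rho>\<^sup>2) 0) \<le> (1 / norm \<rho>) * exp (\<bar>Im \<rho>\<bar> * x)" if "x \<in> {0..l}" for x
    using sc(1)[OF that] by (simp add: norm_divide divide_right_mono)
  note b1 = solution_bound[OF sol_is_solution r0 large(1) free1 x]
  note b2 = solution_bound[OF sol_is_solution r0 large(1) free2 x]
  show "norm (sol 1 0 (\<rho>\<^sup>2) x) \<le> 2 * exp (\<bar>Im \<rho>\<bar> * x)" using b1(1) by simp
  show "norm (sol 1 0 (\<rho>\<^sup>2) x - cos (\<rho> * of_real x)) \<le> 2 * q_norm / norm \<rho> * exp (\<bar>Im \<rho>\<bar> * x)"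
    using b1(2) by simp
  show "norm (sol 0 1 (\<rho>\<^sup>2) x) \<le> 2 / norm \<rho> * exp (\<bar>Im \<rho>\<bar> * x)" using b2(1) by simp
  show *: "norm (dsol 0 1 (\<rho>\<^sup>2) x - cos (\<rho> * of_real x)) \<le> 2 * q_norm / norm \<rho> * exp (\<bar>Im \<rho>\<bar> * x)"
    using b2(3) by simp
  have "norm (dsol 0 1 (\<rho>\<^sup>2) x) \<le> norm (cos (\<rho> * of_real x)) + norm (dsol 0 1 (\<rho>\<^sup>2) x - cos (\<rho> * of_real x))"
    by (rule norm_triangle_sub)
  also have "\<dots> \<le> exp (\<bar>Im \<rho>\<bar> * x) + 1 * exp (\<bar>Im \<rho>\<bar> * x)"
    by (intro add_mono sc(2) x order_trans[OF * mult_right_mono[OF q2]]) auto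
  finally show "norm (dsol 0 1 (\<rho>\<^sup>2) x) \<le> 2 * exp (\<bar>Im \<rho>\<bar> * x)" by simp
  have "norm (dsol 1 0 (\<rho>\<^sup>2) x) \<le> norm (- \<rho> * sin (\<rho> * of_real x)) + norm (dsol 1 0 (\<rho>\<^sup>2) x - (- \<rho> * sin (\<rho> * of_real x)))"
    by (rule norm_triangle_sub)
  also have "\<dots> \<le> norm \<rho> * exp (\<bar>Im \<rho>\<bar> * x) + 2 * q_norm * exp (\<bar>Im \<rho>\<bar> * x)"
  proof (rule add_mono)
    show "norm (- \<rho> * sin (\<rho> * of_real x)) \<le> norm \<rho> * exp (\<bar>Im \<rho>\<bar> * x)"
      using sc(1)[OF x] by (simp add: norm_mult mult_left_mono)
    show "norm (dsol 1 0 (\<rho>\<^sup>2) x - (- \<rho> * sin (\<rho> * of_real x))) \<le> 2 * q_norm * exp (\<bar>Im \<rho>\<bar> * x)"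
      using b1(3) by simp
  qed
  also have "\<dots> \<le> norm \<rho> * exp (\<bar>Im \<rho>\<bar> * x) + norm \<rho> * exp (\<bar>Im \<rho>\<bar> * x)"
    using large by (intro add_mono mult_right_mono) auto
  finally show "norm (dsol 1 0 (\<rho>\<^sup>2) x) \<le> 2 * norm \<rho> * exp (\<bar>Im \<rho>\<bar> * x)" by simp
qed

lemma is_solution_cnj:
  assumes "is_solution z y v"
  shows "is_solution (cnj z) (\<lambda>x. cnj (y x)) (\<lambda>x. cnj (v x))"
proof -
  have p: "primitive_on l (\<lambda>x. cnj (f x)) (\<lambda>x. cnj (g x))" if "primitive_on l f g" for f g
    unfolding primitive_on_def
  proof
    fix x assume "x \<in> {0..l}"
    from has_integral_linear[OF primitive_onD[OF that this] bounded_linear_cnj]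
    show "((\<lambda>x. cnj (g x)) has_integral cnj (f x) - cnj (f 0)) {0..x}" by (simp add: o_def)
  qed
  show ?thesis using assms p[of y v] p[of v "\<lambda>t. (complex_of_real (q t) - z) * y t"]
    by (simp add: is_solution_def)
qed

lemma sol_real:
  assumes "a \<in> \<real>" "b \<in> \<real>" "z \<in> \<real>" "x \<in> {0..l}"
  shows "sol a b z x \<in> \<real>" "dsol a b z x \<in> \<real>"
  using is_solution_eq_sol[OF is_solution_cnj[OF sol_is_solution[of z a b]] assms(4)] assms(1-3)
  by (simp_all add: Reals_cnj_iff)

end

section \<open>First-order asymptotics at minus infinity\<close>

text \<open>The function \<open>exp (- \<kappa> s) cosh (\<kappa> s)\<close>, in a form whose limit for \<open>\<kappa> \<rightarrow> \<infinity>\<close> is visible.\<close>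

definition damped_cosh :: "real \<Rightarrow> real \<Rightarrow> complex" where
  "damped_cosh \<kappa> s = of_real ((1 + exp (- 2 * \<kappa> * s)) / 2)"

text \<open>The function \<open>exp (- \<kappa> s) sinh (\<kappa> s)\<close>.\<close>

definition damped_sinh :: "real \<Rightarrow> real \<Rightarrow> complex" where
  "damped_sinh \<kappa> s = of_real ((1 - exp (- 2 * \<kappa> * s)) / 2)"

lemma cos_i_of_real: "cos (\<i> * of_real \<kappa> * of_real s) = of_real (exp (\<kappa> * s)) * damped_cosh \<kappa> s"
  and sin_i_of_real: "sin (\<i> * of_real \<kappa> * of_real s) = \<i> * (of_real (exp (\<kappa> * s)) * damped_sinh \<kappa> s)"
proof -
  have e: "inverse (exp (\<kappa> * s)) = exp (\<kappa> * s) * exp (- 2 * \<kappa> * s)"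
    by (simp add: exp_minus[symmetric] exp_add[symmetric])
  have 1: "\<i> * of_real \<kappa> * of_real s = \<i> * complex_of_real (\<kappa> * s)" by (simp add: mult.assoc)
  have c: "(exp (\<kappa> * s) + inverse (exp (\<kappa> * s))) / 2 = exp (\<kappa> * s) * ((1 + exp (- 2 * \<kappa> * s)) / 2)"
    and d: "(exp (\<kappa> * s) - inverse (exp (\<kappa> * s))) / 2 = exp (\<kappa> * s) * ((1 - exp (- 2 * \<kappa> * s)) / 2)"
    unfolding e by (simp_all add: algebra_simps)
  have "cos (\<i> * complex_of_real (\<kappa> * s)) = of_real ((exp (\<kappa> * s) + inverse (exp (\<kappa> * s))) / 2)"
    unfolding cos_i_times by (simp add: exp_of_real del: of_real_mult)
  then show "cos (\<i> * of_real \<kappa> * of_real s) = of_real (exp (\<kappa> * s)) * damped_cosh \<kappa> s"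
    unfolding 1 c damped_cosh_def of_real_mult .
  have "sin (\<i> * complex_of_real (\<kappa> * s)) = \<i> * of_real ((exp (\<kappa> * s) - inverse (exp (\<kappa> * s))) / 2)"
    unfolding sin_i_times by (simp add: exp_of_real del: of_real_mult)
  then show "sin (\<i> * of_real \<kappa> * of_real s) = \<i> * (of_real (exp (\<kappa> * s)) * damped_sinh \<kappa> s)"
    unfolding 1 d damped_sinh_def of_real_mult .
qed

lemma norm_damped_le:
  assumes "\<kappa> \<ge> 0" "s \<ge> 0"
  shows "norm (damped_cosh \<kappa> s) \<le> 1" "norm (damped_sinh \<kappa> s) \<le> 1"
proof -
  have "0 \<le> exp (- 2 * \<kappa> * s)" "exp (- 2 * \<kappa> * s) \<le> 1" using assms by auto
  moreover have "\<bar>(1 - E) / 2\<bar> \<le> 1" "\<bar>(1 + E) / 2\<bar> \<le> 1" if "0 \<le> E" "E \<le> 1" for E :: real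
    using that by (auto simp: abs_if)
  ultimately show "norm (damped_cosh \<kappa> s) \<le> 1" "norm (damped_sinh \<kappa> s) \<le> 1"
    unfolding damped_cosh_def damped_sinh_def norm_of_real by blast+
qed

lemma damped_tendsto:
  fixes \<kappa> :: "nat \<Rightarrow> real"
  assumes \<kappa>: "filterlim \<kappa> at_top sequentially" and "s > 0"
  shows "(\<lambda>n. damped_cosh (\<kappa> n) s) \<longlonglongrightarrow> 1/2" "(\<lambda>n. damped_sinh (\<kappa> n) s) \<longlonglongrightarrow> 1/2"
    "(\<lambda>n. of_real (\<kappa> n) * (damped_cosh (\<kappa> n) s - 1/2)) \<longlonglongrightarrow> 0" "(\<lambda>n. of_real (\<kappa> n) * (damped_sinh (\<kappa> n) s - 1/2)) \<longlonglongrightarrow> 0"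
proof -
  have lim: "(\<lambda>n. complex_of_real (f (\<kappa> n))) \<longlonglongrightarrow> of_real c" if "(f \<longlongrightarrow> c) at_top" for f c
    by (intro tendsto_of_real filterlim_compose[OF that \<kappa>])
  have "((\<lambda>k. (1 + exp (- 2 * k * s)) / 2) \<longlongrightarrow> 1/2) at_top" "((\<lambda>k. (1 - exp (- 2 * k * s)) / 2) \<longlongrightarrow> 1/2) at_top"
    "((\<lambda>k. k * ((1 + exp (- 2 * k * s)) / 2 - 1/2)) \<longlongrightarrow> 0) at_top" "((\<lambda>k. k * ((1 - exp (- 2 * k * s)) / 2 - 1/2)) \<longlongrightarrow> 0) at_top"
    using \<open>s > 0\<close> by real_asymp+
  from this[THEN lim] show "(\<lambda>n. damped_cosh (\<kappa> n) s) \<longlonglongrightarrow> 1/2" "(\<lambda>n. damped_sinh (\<kappa> n) s) \<longlonglongrightarrow> 1/2"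
    "(\<lambda>n. of_real (\<kappa> n) * (damped_cosh (\<kappa> n) s - 1/2)) \<longlonglongrightarrow> 0" "(\<lambda>n. of_real (\<kappa> n) * (damped_sinh (\<kappa> n) s - 1/2)) \<longlonglongrightarrow> 0"
    unfolding damped_cosh_def damped_sinh_def by simp_all
qed

context edge
begin

text \<open>Dominated convergence on the open interval: the factors converge only there, since the kernel
does not tend to \<open>1/2\<close> at \<open>t = l\<close>, nor the solution at \<open>t = 0\<close>.\<close>

lemma kernel_limit:
  fixes k w :: "nat \<Rightarrow> real \<Rightarrow> complex"
  assumes k: "\<And>n t. t \<in> {0<..<l} \<Longrightarrow> norm (k n t) \<le> 1" "\<And>t. t \<in> {0<..<l} \<Longrightarrow> (\<lambda>n. k n t) \<longlonglongrightarrow> 1/2"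
    and w: "\<And>n t. t \<in> {0<..<l} \<Longrightarrow> norm (w n t) \<le> 2" "\<And>t. t \<in> {0<..<l} \<Longrightarrow> (\<lambda>n. w n t) \<longlonglongrightarrow> 1/2"
    and I: "\<And>n. ((\<lambda>t. k n t * (of_real (q t) * w n t)) has_integral J n) {0..l}"
  shows "J \<longlonglongrightarrow> of_real (integral {0..l} q / 4)"
proof -
  have I': "((\<lambda>t. k n t * (of_real (q t) * w n t)) has_integral J n) {0<..<l}" for n
    using I[of n] by (simp add: has_integral_Icc_iff_Ioo)
  have h: "(\<lambda>t. 2 * \<bar>q t\<bar>) integrable_on {0<..<l}"
    using abs_q_integrable[of l] l_pos by (auto intro!: integrable_on_mult_right simp: integrable_on_Icc_iff_Ioo[symmetric])
  have le: "norm (k n t * (of_real (q t) * w n t)) \<le> 2 * \<bar>q t\<bar>" if "t \<in> {0<..<l}" for n t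
  proof -
    have "norm (k n t * (of_real (q t) * w n t)) = norm (k n t) * norm (w n t) * \<bar>q t\<bar>" by (simp add: norm_mult)
    also have "\<dots> \<le> 1 * 2 * \<bar>q t\<bar>" using k(1)[OF that, of n] w(1)[OF that, of n] by (intro mult_right_mono mult_mono) auto
    finally show ?thesis by simp
  qed
  have lim: "(\<lambda>n. k n t * (of_real (q t) * w n t)) \<longlonglongrightarrow> 1/2 * (of_real (q t) * (1/2))" if "t \<in> {0<..<l}" for t
    by (intro tendsto_mult tendsto_const k(2) w(2) that)
  have "(\<lambda>n. integral {0<..<l} (\<lambda>t. k n t * (of_real (q t) * w n t))) \<longlonglongrightarrow> integral {0<..<l} (\<lambda>t. 1/2 * (complex_of_real (q t) * (1/2)))"
    by (rule dominated_convergence(2)[OF has_integral_integrable[OF I'] h le lim])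
  moreover have "integral {0<..<l} (\<lambda>t. k n t * (of_real (q t) * w n t)) = J n" for n
    using I'[of n] by (rule integral_unique)
  moreover have "integral {0<..<l} (\<lambda>t. 1/2 * (complex_of_real (q t) * (1/2))) = of_real (integral {0..l} q / 4)"
  proof (rule integral_unique)
    have "(q has_integral integral {0..l} q) {0<..<l}"
      using absolutely_integrable_on_def[THEN iffD1, THEN conjunct1, OF q_int]
      by (simp add: has_integral_Icc_iff_Ioo[symmetric] has_integral_integral[symmetric])
    from has_integral_mult_right[OF has_integral_linear[OF this bounded_linear_of_real], of "1/4 :: complex"]
    show "((\<lambda>t. 1/2 * (complex_of_real (q t) * (1/2))) has_integral of_real (integral {0..l} q / 4)) {0<..<l}"
      by (simp add: o_def)
  qed
  ultimately show ?thesis by simp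
qed

text \<open>At \<open>z = - \<kappa>\<^sup>2\<close> the solution, multiplied by \<open>exp (- \<kappa> x)\<close>, is \<open>F + O(1 / \<kappa>)\<close>
with \<open>F\<close> the damped free solution, so \<open>1/2\<close> in the limit. Inserting this in the variation of constants
formula gives the coefficient of \<open>1 / \<kappa>\<close> as the limit of \<open>\<integral> k q w\<close>, where the kernel \<open>k\<close> and the
damped solution \<open>w\<close> both tend to \<open>1/2\<close>. The initial data \<open>(1, 0)\<close> and \<open>(0, \<kappa>)\<close> are scaled so that
both fundamental solutions are covered.\<close>

lemma growing_solution_asymptotics:
  fixes \<kappa> :: "nat \<Rightarrow> real" and a b :: complex
  assumes ab: "(a, b) = (1, 0) \<or> (a, b) = (0, 1)"
    and \<kappa>: "\<And>n. \<kappa> n \<ge> 1" "\<And>n. \<kappa> n \<ge> 2 * q_norm" "filterlim \<kappa> at_top sequentially"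
  defines "y \<equiv> \<lambda>n. sol a (of_real (\<kappa> n) * b) ((\<i> * complex_of_real (\<kappa> n))\<^sup>2)"
    and "v \<equiv> \<lambda>n. dsol a (of_real (\<kappa> n) * b) ((\<i> * complex_of_real (\<kappa> n))\<^sup>2)"
  shows "(\<lambda>n. of_real (\<kappa> n) * (of_real (exp (- \<kappa> n * l)) * y n l - 1/2)) \<longlonglongrightarrow> of_real (integral {0..l} q / 4)" (is ?A)
    and "(\<lambda>n. of_real (\<kappa> n) * (of_real (exp (- \<kappa> n * l)) * v n l / of_real (\<kappa> n) - 1/2)) \<longlonglongrightarrow> of_real (integral {0..l} q / 4)" (is ?B)
proof -
  have k0: "\<kappa> n \<ge> 0" and kc: "complex_of_real (\<kappa> n) \<noteq> 0" for n using \<kappa>(1)[of n] by auto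
  have r: "\<i> * complex_of_real (\<kappa> n) \<noteq> 0" "norm (\<i> * complex_of_real (\<kappa> n)) = \<kappa> n" "\<bar>Im (\<i> * complex_of_real (\<kappa> n))\<bar> = \<kappa> n" for n
    using \<kappa>(1)[of n] by (auto simp: norm_mult)
  have ll: "l \<in> {0..l}" using l_pos by simp
  define e where "e n x = complex_of_real (exp (- \<kappa> n * x))" for n x
  have eE: "e n x * of_real (exp (\<kappa> n * x)) = 1" for n x
    unfolding e_def of_real_mult[symmetric] exp_add[symmetric] by simp
  have shift: "e n l * of_real (exp (\<kappa> n * (l - t))) = e n t" for n t
    unfolding e_def of_real_mult[symmetric] exp_add[symmetric] by (simp add: algebra_simps)
  define F where "F n x = a * damped_cosh (\<kappa> n) x + b * damped_sinh (\<kappa> n) x" for n x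
  define F' where "F' n x = a * damped_sinh (\<kappa> n) x + b * damped_cosh (\<kappa> n) x" for n x
  have F_le: "norm (F n x) \<le> 1" if "x \<ge> 0" for n x using ab norm_damped_le[OF k0 that] by (auto simp: F_def)
  have F_lim: "(\<lambda>n. F n x) \<longlonglongrightarrow> 1/2" "(\<lambda>n. of_real (\<kappa> n) * (F n x - 1/2)) \<longlonglongrightarrow> 0" "(\<lambda>n. of_real (\<kappa> n) * (F' n x - 1/2)) \<longlonglongrightarrow> 0" if "x > 0" for x
    using ab damped_tendsto[OF \<kappa>(3) that] by (auto simp: F_def F'_def)
  have free: "cos (\<i> * of_real (\<kappa> n) * of_real x) * y n 0 + sin (\<i> * of_real (\<kappa> n) * of_real x) / (\<i> * of_real (\<kappa> n)) * v n 0 = of_real (exp (\<kappa> n * x)) * F n x"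
    "cos (\<i> * of_real (\<kappa> n) * of_real x) * v n 0 - \<i> * of_real (\<kappa> n) * sin (\<i> * of_real (\<kappa> n) * of_real x) * y n 0 = of_real (\<kappa> n) * (of_real (exp (\<kappa> n * x)) * F' n x)" for n x
    using kc[of n] unfolding cos_i_of_real sin_i_of_real F_def F'_def y_def v_def sol_0 by (simp_all add: field_simps)
  have s: "is_solution ((\<i> * complex_of_real (\<kappa> n))\<^sup>2) (y n) (v n)" for n unfolding y_def v_def by (rule sol_is_solution)
  have bound: "norm (y n t) \<le> 2 * exp (\<kappa> n * t)" "norm (y n t - of_real (exp (\<kappa> n * t)) * F n t) \<le> 2 * q_norm / \<kappa> n * exp (\<kappa> n * t)" if "t \<in> {0..l}" for n t
  proof -
    have "norm (of_real (exp (\<kappa> n * x)) * F n x) \<le> 1 * exp (\<kappa> n * x)" if "x \<in> {0..l}" for x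
      using mult_left_mono[OF F_le[of x n], of "exp (\<kappa> n * x)"] that by (simp add: norm_mult)
    note b = solution_bound[OF s r(1), unfolded r free, OF \<kappa>(2) this \<open>t \<in> {0..l}\<close>]
    show "norm (y n t) \<le> 2 * exp (\<kappa> n * t)" "norm (y n t - of_real (exp (\<kappa> n * t)) * F n t) \<le> 2 * q_norm / \<kappa> n * exp (\<kappa> n * t)"
      using b(1,2) by simp_all
  qed
  define w where "w n t = e n t * y n t" for n t
  have en: "norm (e n t) * exp (\<kappa> n * t) = 1" for n t
    by (simp add: e_def exp_add[symmetric])
  have w_le: "norm (w n t) \<le> 2" if "t \<in> {0<..<l}" for n t
    using mult_left_mono[OF bound(1)[of t n], of "norm (e n t)"] that en[of n t] by (simp add: w_def norm_mult)
  have w_lim: "(\<lambda>n. w n t) \<longlonglongrightarrow> 1/2" if "t \<in> {0<..<l}" for t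
  proof -
    have d: "norm (w n t - F n t) \<le> 2 * q_norm / \<kappa> n" for n
    proof -
      have "w n t - F n t = e n t * (y n t - of_real (exp (\<kappa> n * t)) * F n t)"
        unfolding w_def right_diff_distrib mult.assoc[symmetric] eE by simp
      then have "norm (w n t - F n t) \<le> norm (e n t) * (2 * q_norm / \<kappa> n * exp (\<kappa> n * t))"
        using mult_left_mono[OF bound(2)[of t n], of "norm (e n t)"] that by (simp add: norm_mult)
      also have "\<dots> = 2 * q_norm / \<kappa> n * (norm (e n t) * exp (\<kappa> n * t))" by (simp only: mult_ac)
      finally show ?thesis unfolding en by simp
    qed
    have "(\<lambda>n. 2 * q_norm / \<kappa> n) \<longlonglongrightarrow> 0"
      by (intro tendsto_divide_0[OF tendsto_const] filterlim_at_top_imp_at_infinity \<kappa>(3))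
    then have "(\<lambda>n. w n t - F n t) \<longlonglongrightarrow> 0"
      by (rule Lim_null_comparison[rotated]) (use d in auto)
    from tendsto_add[OF this F_lim(1)[of t]] show ?thesis using that by simp
  qed
  have k_le: "norm (damped_cosh (\<kappa> n) (l - t)) \<le> 1" "norm (damped_sinh (\<kappa> n) (l - t)) \<le> 1" if "t \<in> {0<..<l}" for n t
    using norm_damped_le[OF k0, of "l - t"] that by auto
  have k_lim: "(\<lambda>n. damped_cosh (\<kappa> n) (l - t)) \<longlonglongrightarrow> 1/2" "(\<lambda>n. damped_sinh (\<kappa> n) (l - t)) \<longlonglongrightarrow> 1/2" if "t \<in> {0<..<l}" for t
    using damped_tendsto(1,2)[OF \<kappa>(3), of "l - t"] that by auto
  have I1: "((\<lambda>t. damped_sinh (\<kappa> n) (l - t) * (of_real (q t) * w n t)) has_integral of_real (\<kappa> n) * (e n l * y n l - F n l)) {0..l}" for n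
  proof -
    have A: "((\<lambda>t. of_real (\<kappa> n) * e n l * (sin (\<i> * of_real (\<kappa> n) * of_real (l - t)) / (\<i> * of_real (\<kappa> n)) * (of_real (q t) * y n t)))
       has_integral of_real (\<kappa> n) * e n l * (y n l - of_real (exp (\<kappa> n * l)) * F n l)) {0..l}"
      unfolding free[symmetric] by (intro has_integral_mult_right variation_of_constants(1)[OF s r(1) ll])
    have "of_real (\<kappa> n) * e n l * (sin (\<i> * of_real (\<kappa> n) * of_real (l - t)) / (\<i> * of_real (\<kappa> n)) * (of_real (q t) * y n t))
        = (e n l * of_real (exp (\<kappa> n * (l - t)))) * (damped_sinh (\<kappa> n) (l - t) * (of_real (q t) * y n t))" for t
      unfolding sin_i_of_real using kc[of n] by (simp add: field_simps)
    then have 1: "of_real (\<kappa> n) * e n l * (sin (\<i> * of_real (\<kappa> n) * of_real (l - t)) / (\<i> * of_real (\<kappa> n)) * (of_real (q t) * y n t))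
        = damped_sinh (\<kappa> n) (l - t) * (of_real (q t) * w n t)" for t
      unfolding shift w_def by (simp only: mult_ac)
    have 2: "of_real (\<kappa> n) * e n l * (y n l - of_real (exp (\<kappa> n * l)) * F n l) = of_real (\<kappa> n) * (e n l * y n l - F n l)"
      unfolding mult.assoc right_diff_distrib mult.assoc[of "e n l", symmetric] eE by simp
    show ?thesis using A unfolding 1 2 .
  qed
  have I2: "((\<lambda>t. damped_cosh (\<kappa> n) (l - t) * (of_real (q t) * w n t)) has_integral of_real (\<kappa> n) * (e n l * v n l / of_real (\<kappa> n) - F' n l)) {0..l}" for n
  proof -
    have A: "((\<lambda>t. e n l * (cos (\<i> * of_real (\<kappa> n) * of_real (l - t)) * (of_real (q t) * y n t)))
       has_integral e n l * (v n l - of_real (\<kappa> n) * (of_real (exp (\<kappa> n * l)) * F' n l))) {0..l}"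
      unfolding free[symmetric] by (intro has_integral_mult_right variation_of_constants(2)[OF s r(1) ll])
    have "e n l * (cos (\<i> * of_real (\<kappa> n) * of_real (l - t)) * (of_real (q t) * y n t))
        = (e n l * of_real (exp (\<kappa> n * (l - t)))) * (damped_cosh (\<kappa> n) (l - t) * (of_real (q t) * y n t))" for t
      unfolding cos_i_of_real by (simp only: mult_ac)
    then have 1: "e n l * (cos (\<i> * of_real (\<kappa> n) * of_real (l - t)) * (of_real (q t) * y n t))
        = damped_cosh (\<kappa> n) (l - t) * (of_real (q t) * w n t)" for t
      unfolding shift w_def by (simp only: mult_ac)
    have "e n l * (v n l - of_real (\<kappa> n) * (of_real (exp (\<kappa> n * l)) * F' n l))
        = e n l * v n l - of_real (\<kappa> n) * ((e n l * of_real (exp (\<kappa> n * l))) * F' n l)"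
      by (simp add: algebra_simps)
    then have 2: "e n l * (v n l - of_real (\<kappa> n) * (of_real (exp (\<kappa> n * l)) * F' n l)) = of_real (\<kappa> n) * (e n l * v n l / of_real (\<kappa> n) - F' n l)"
      unfolding eE using kc[of n] by (simp add: right_diff_distrib)
    show ?thesis using A unfolding 1 2 .
  qed
  have "(\<lambda>n. of_real (\<kappa> n) * (e n l * y n l - F n l) + of_real (\<kappa> n) * (F n l - 1/2)) \<longlonglongrightarrow> of_real (integral {0..l} q / 4) + 0"
    by (intro tendsto_add kernel_limit[OF k_le(2) k_lim(2) w_le w_lim I1] F_lim(2) l_pos)
  then show ?A by (simp add: e_def ring_distribs)
  have "(\<lambda>n. of_real (\<kappa> n) * (e n l * v n l / of_real (\<kappa> n) - F' n l) + of_real (\<kappa> n) * (F' n l - 1/2)) \<longlonglongrightarrow> of_real (integral {0..l} q / 4) + 0"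
    by (intro tendsto_add kernel_limit[OF k_le(1) k_lim(1) w_le w_lim I2] F_lim(3) l_pos)
  then show ?B by (simp add: e_def right_diff_distrib)
qed

lemma fundamental_asymptotics:
  fixes \<kappa> :: "nat \<Rightarrow> real"
  assumes \<kappa>: "\<And>n. \<kappa> n \<ge> 1" "\<And>n. \<kappa> n \<ge> 2 * q_norm" "filterlim \<kappa> at_top sequentially"
  defines "z \<equiv> \<lambda>n. (\<i> * complex_of_real (\<kappa> n))\<^sup>2"
  shows "(\<lambda>n. of_real (\<kappa> n) * (of_real (exp (- \<kappa> n * l)) * sol 1 0 (z n) l - 1/2)) \<longlonglongrightarrow> of_real (integral {0..l} q / 4)"
    "(\<lambda>n. of_real (\<kappa> n) * (of_real (exp (- \<kappa> n * l)) * dsol 1 0 (z n) l / of_real (\<kappa> n) - 1/2)) \<longlonglongrightarrow> of_real (integral {0..l} q / 4)"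
    "(\<lambda>n. of_real (\<kappa> n) * (of_real (exp (- \<kappa> n * l)) * (of_real (\<kappa> n) * sol 0 1 (z n) l) - 1/2)) \<longlonglongrightarrow> of_real (integral {0..l} q / 4)"
    "(\<lambda>n. of_real (\<kappa> n) * (of_real (exp (- \<kappa> n * l)) * dsol 0 1 (z n) l - 1/2)) \<longlonglongrightarrow> of_real (integral {0..l} q / 4)"
proof -
  have ll: "l \<in> {0..l}" using l_pos by simp
  have kc: "complex_of_real (\<kappa> n) \<noteq> 0" for n using \<kappa>(1)[of n] by auto
  note g = growing_solution_asymptotics[OF _ \<kappa>, folded z_def]
  show "(\<lambda>n. of_real (\<kappa> n) * (of_real (exp (- \<kappa> n * l)) * sol 1 0 (z n) l - 1/2)) \<longlonglongrightarrow> of_real (integral {0..l} q / 4)"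
    "(\<lambda>n. of_real (\<kappa> n) * (of_real (exp (- \<kappa> n * l)) * dsol 1 0 (z n) l / of_real (\<kappa> n) - 1/2)) \<longlonglongrightarrow> of_real (integral {0..l} q / 4)"
    using g[of 1 0] by (simp_all add: z_def)
  have lin: "sol 0 (of_real (\<kappa> n)) w l = of_real (\<kappa> n) * sol 0 1 w l"
    "dsol 0 (of_real (\<kappa> n)) w l = of_real (\<kappa> n) * dsol 0 1 w l" for n w
    using sol_linear[OF ll, of 0 "of_real (\<kappa> n)" w] by simp_all
  show "(\<lambda>n. of_real (\<kappa> n) * (of_real (exp (- \<kappa> n * l)) * (of_real (\<kappa> n) * sol 0 1 (z n) l) - 1/2)) \<longlonglongrightarrow> of_real (integral {0..l} q / 4)"
    "(\<lambda>n. of_real (\<kappa> n) * (of_real (exp (- \<kappa> n * l)) * dsol 0 1 (z n) l - 1/2)) \<longlonglongrightarrow> of_real (integral {0..l} q / 4)"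
    using g[of 0 1] kc by (simp_all add: lin z_def)
qed

end

section \<open>Quotients of entire functions\<close>

text \<open>Near a common zero \<open>a\<close> both functions are divided by \<open>z - a\<close>; the
denominator then no longer vanishes at \<open>a\<close>.\<close>

lemma entire_divide_simple_zeros:
  assumes f: "f holomorphic_on UNIV" and g: "g holomorphic_on UNIV"
    and z: "\<And>z. g z = 0 \<Longrightarrow> deriv g z \<noteq> 0 \<and> f z = 0"
  obtains h where "h holomorphic_on UNIV" "\<And>z. f z = h z * g z" "\<And>z. g z = 0 \<Longrightarrow> h z = deriv f z / deriv g z"
proof -
  define h where "h z = (if g z = 0 then deriv f z / deriv g z else f z / g z)" for z
  have "h field_differentiable at a" for a
  proof (cases "g a = 0")
    case False
    have "open {z. g z \<noteq> 0}"
      using holomorphic_on_imp_continuous_on[OF g] by (intro open_Collect_neq) auto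
    moreover have "h holomorphic_on {z. g z \<noteq> 0}"
    proof -
      have "(\<lambda>z. f z / g z) holomorphic_on {z. g z \<noteq> 0}"
        by (intro holomorphic_on_divide holomorphic_on_subset[OF f] holomorphic_on_subset[OF g]) auto
      then show ?thesis by (rule holomorphic_transform) (auto simp: h_def)
    qed
    ultimately show ?thesis using False by (auto intro: holomorphic_on_imp_differentiable_at)
  next
    case True
    define F where "F z = (if z = a then deriv f a else (f z - f a) / (z - a))" for z
    define G where "G z = (if z = a then deriv g a else (g z - g a) / (z - a))" for z
    have F: "F holomorphic_on UNIV" and G: "G holomorphic_on UNIV"
      unfolding F_def[abs_def] G_def[abs_def] by (rule pole_lemma_open[OF f open_UNIV], rule pole_lemma_open[OF g open_UNIV])
    have Ga: "G a \<noteq> 0" using z[OF True] by (simp add: G_def)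
    have "open {z. G z \<noteq> 0}"
      using holomorphic_on_imp_continuous_on[OF G] by (intro open_Collect_neq) auto
    moreover have "h holomorphic_on {z. G z \<noteq> 0}"
    proof -
      have "(\<lambda>z. F z / G z) holomorphic_on {z. G z \<noteq> 0}"
        by (intro holomorphic_on_divide holomorphic_on_subset[OF F] holomorphic_on_subset[OF G]) auto
      then show ?thesis
      proof (rule holomorphic_transform)
        fix w assume w: "w \<in> {z. G z \<noteq> 0}"
        show "F w / G w = h w"
        proof (cases "w = a")
          case True
          then show ?thesis using \<open>g a = 0\<close> by (simp add: h_def F_def G_def)
        next
          case False
          then show ?thesis using w \<open>g a = 0\<close> z[OF \<open>g a = 0\<close>] by (auto simp: h_def F_def G_def)
        qed
      qed
    qed
    ultimately show ?thesis using Ga by (auto intro: holomorphic_on_imp_differentiable_at)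
  qed
  then have "h holomorphic_on UNIV" by (auto simp: holomorphic_on_def intro: field_differentiable_at_within)
  then show ?thesis by (rule that) (use z in \<open>auto simp: h_def\<close>)
qed

lemma holomorphic_shift:
  assumes "f holomorphic_on UNIV"
  shows "(\<lambda>w. f (c + w)) holomorphic_on UNIV"
proof -
  have "(\<lambda>w. c + w) holomorphic_on UNIV" by (intro holomorphic_intros)
  from holomorphic_on_compose_gen[OF this assms] show ?thesis by (simp add: o_def)
qed

text \<open>The zeros of \<open>f\<close> in the strip prevent a direct estimate. If \<open>h\<close> were
unbounded at points \<open>Z n\<close>, then by Montel a subsequence of the translates of \<open>f\<close> by \<open>Re (Z n)\<close> would
converge, and the limit is not identically zero because of the lower bound on the line \<open>Im z = b\<close>.
It has no zeros on a suitable circle around the origin that encloses the translated points, so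
\<open>h = (h f) / f\<close> is bounded on the translated circles, and by the maximum principle at the points
\<open>Z n\<close>, uniformly in \<open>n\<close>.\<close>

lemma entire_quotient_bounded_on_strip:
  assumes f: "f holomorphic_on UNIV" and h: "h holomorphic_on UNIV"
    and bd: "\<And>R. \<exists>B. \<forall>z. \<bar>Im z\<bar> \<le> R \<longrightarrow> norm (f z) \<le> B \<and> norm (h z * f z) \<le> B"
    and m: "m > 0" "b > 0" "\<And>x. norm (f (of_real x + \<i> * of_real b)) \<ge> m"
  shows "\<exists>B. \<forall>z. \<bar>Im z\<bar> \<le> b \<longrightarrow> norm (h z) \<le> B"
proof (rule ccontr)
  assume "\<not> ?thesis"
  then have "\<forall>n::nat. \<exists>z. \<bar>Im z\<bar> \<le> b \<and> norm (h z) > real n" by (meson not_le)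
  then obtain Z where Z: "\<And>n::nat. \<bar>Im (Z n)\<bar> \<le> b" "\<And>n. norm (h (Z n)) > real n" by metis
  define \<F> where "\<F> n w = f (of_real (Re (Z n)) + w)" for n w
  define H where "H = range \<F>"
  obtain \<phi> r where \<phi>: "\<phi> holomorphic_on UNIV" and r: "strict_mono (r :: nat \<Rightarrow> nat)"
    and lim: "\<And>x. ((\<lambda>n. \<F> (r n) x) \<longlongrightarrow> \<phi> x) sequentially"
    and unif: "\<And>K. compact K \<Longrightarrow> uniform_limit K (\<F> \<circ> r) \<phi> sequentially"
  proof (rule Montel[of UNIV H \<F>])
    show "k holomorphic_on UNIV" if "k \<in> H" for k
    proof -
      obtain n where "k = \<F> n" using \<open>k \<in> H\<close> by (auto simp: H_def)
      then have "k = (\<lambda>w. f (of_real (Re (Z n)) + w))" by (simp add: \<F>_def fun_eq_iff)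
      then show ?thesis using holomorphic_shift[OF f] by simp
    qed
    fix K :: "complex set" assume "compact K"
    then obtain R where R: "\<And>w. w \<in> K \<Longrightarrow> norm w \<le> R" using compact_imp_bounded bounded_iff by metis
    obtain B where B: "\<And>z. \<bar>Im z\<bar> \<le> R \<Longrightarrow> norm (f z) \<le> B" using bd by blast
    have "norm (k w) \<le> B" if "k \<in> H" "w \<in> K" for k w
    proof -
      obtain n where k: "k = \<F> n" using \<open>k \<in> H\<close> by (auto simp: H_def)
      have "\<bar>Im (of_real (Re (Z n)) + w)\<bar> \<le> R" using R[OF that(2)] abs_Im_le_cmod[of w] by simp
      then show ?thesis unfolding k \<F>_def by (rule B)
    qed
    then show "\<exists>B. \<forall>h\<in>H. \<forall>z\<in>K. norm (h z) \<le> B" by blast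
  qed (auto simp: H_def)
  have ge: "norm (\<phi> (\<i> * of_real b)) \<ge> m"
  proof (rule LIMSEQ_le_const[OF tendsto_norm[OF lim]])
    show "\<exists>N. \<forall>n\<ge>N. m \<le> norm (\<F> (r n) (\<i> * of_real b))" using m(3) by (auto simp: \<F>_def)
  qed
  \<comment> \<open>Finitely many zeros of the limit leave room for a zero-free circle of radius between \<open>b\<close> and \<open>b + 1\<close>.\<close>
  have "finite {w \<in> cball 0 (b + 1). \<phi> w = 0}"
  proof (cases "\<phi> constant_on UNIV")
    case False
    then show ?thesis by (intro holomorphic_compact_finite_zeros[OF \<phi>]) auto
  next
    case True
    then obtain c where "\<And>w. \<phi> w = c" by (auto simp: constant_on_def)
    then have e: "{w \<in> cball 0 (b + 1). \<phi> w = 0} = {}" using ge m(1) by auto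
    show ?thesis unfolding e by simp
  qed
  then have "finite (norm ` {w \<in> cball 0 (b + 1). \<phi> w = 0})" by (rule finite_imageI)
  moreover have "infinite {b<..<b + 1}" by (simp add: infinite_Ioo)
  ultimately obtain R where R: "R \<in> {b<..<b + 1}" "R \<notin> norm ` {w \<in> cball 0 (b + 1). \<phi> w = 0}"
  proof -
    assume *: "finite (norm ` {w \<in> cball 0 (b + 1). \<phi> w = 0})" "infinite {b<..<b + 1}"
    have "\<not> {b<..<b + 1} \<subseteq> norm ` {w \<in> cball 0 (b + 1). \<phi> w = 0}"
      using *(2) finite_subset[OF _ *(1)] by blast
    then show thesis using that by blast
  qed
  have nz: "\<phi> w \<noteq> 0" if "w \<in> sphere 0 R" for w
    using R that by (force simp: image_iff)
  have "continuous_on (sphere 0 R) (\<lambda>w. norm (\<phi> w))"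
    by (intro continuous_on_norm continuous_on_subset[OF holomorphic_on_imp_continuous_on[OF \<phi>]]) auto
  moreover have ne: "sphere (0::complex) R \<noteq> {}" using R m(2) by simp
  ultimately obtain w0 where w0: "w0 \<in> sphere 0 R" "\<And>w. w \<in> sphere 0 R \<Longrightarrow> norm (\<phi> w0) \<le> norm (\<phi> w)"
    using continuous_attains_inf[of "sphere (0::complex) R" "\<lambda>w. norm (\<phi> w)"] by auto
  define \<delta> where "\<delta> = norm (\<phi> w0)"
  have "\<delta> > 0" using nz[OF w0(1)] by (simp add: \<delta>_def)
  have "\<forall>\<^sub>F n in sequentially. \<forall>w\<in>sphere 0 R. dist ((\<F> \<circ> r) n w) (\<phi> w) < \<delta> / 2"
    using unif[OF compact_sphere, of 0 R, unfolded uniform_limit_iff, rule_format, of "\<delta> / 2"] \<open>\<delta> > 0\<close> by simp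
  then obtain N where "\<forall>n\<ge>N. \<forall>w\<in>sphere 0 R. dist ((\<F> \<circ> r) n w) (\<phi> w) < \<delta> / 2"
    unfolding eventually_sequentially by blast
  then have N: "\<And>n w. n \<ge> N \<Longrightarrow> w \<in> sphere 0 R \<Longrightarrow> dist (\<F> (r n) w) (\<phi> w) < \<delta> / 2"
    by simp
  obtain B where B: "\<And>z. \<bar>Im z\<bar> \<le> R \<Longrightarrow> norm (h z * f z) \<le> B" using bd by blast
  have main: "norm (h (Z (r n))) \<le> B / (\<delta> / 2)" if "n \<ge> N" for n
  proof -
    define x where "x = complex_of_real (Re (Z (r n)))"
    have hol: "(\<lambda>w. h (x + w)) holomorphic_on UNIV"
      by (rule holomorphic_shift[OF h])
    have "norm (h (x + \<i> * of_real (Im (Z (r n))))) \<le> B / (\<delta> / 2)"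
    proof (rule maximum_modulus_frontier[where f = "\<lambda>w. h (x + w)" and S = "cball 0 R"])
      show "(\<lambda>w. h (x + w)) holomorphic_on interior (cball 0 R)" by (rule holomorphic_on_subset[OF hol]) auto
      show "continuous_on (closure (cball 0 R)) (\<lambda>w. h (x + w))"
        by (rule continuous_on_subset[OF holomorphic_on_imp_continuous_on[OF hol]]) auto
      show "\<i> * of_real (Im (Z (r n))) \<in> cball 0 R" using Z(1)[of "r n"] R by (simp add: norm_mult)
      fix w :: complex assume "w \<in> frontier (cball 0 R)"
      then have w: "w \<in> sphere 0 R" by simp
      have "norm (\<phi> w) \<le> norm (\<F> (r n) w) + dist (\<F> (r n) w) (\<phi> w)"
        using norm_triangle_sub[of "\<phi> w" "\<F> (r n) w"] by (simp add: dist_norm norm_minus_commute)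
      then have "norm (\<F> (r n) w) \<ge> \<delta> / 2" using N[OF that w] w0(2)[OF w] unfolding \<delta>_def[symmetric] by linarith
      then have fd: "norm (f (x + w)) \<ge> \<delta> / 2" by (simp add: \<F>_def x_def)
      have "\<bar>Im (x + w)\<bar> \<le> R" using w abs_Im_le_cmod[of w] by (simp add: x_def)
      then have "norm (h (x + w)) * norm (f (x + w)) \<le> B" using B by (simp add: norm_mult)
      then have "norm (h (x + w)) * (\<delta> / 2) \<le> B"
        using mult_left_mono[OF fd, of "norm (h (x + w))"] by simp
      then show "norm (h (x + w)) \<le> B / (\<delta> / 2)" using \<open>\<delta> > 0\<close> by (simp add: field_simps)
    qed auto
    moreover have "x + \<i> * of_real (Im (Z (r n))) = Z (r n)" by (simp add: x_def complex_eq_iff)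
    ultimately show ?thesis by simp
  qed
  obtain n where n: "real n > B / (\<delta> / 2)" using reals_Archimedean2 by blast
  define k where "k = max n N"
  have "real n \<le> real (r k)" using seq_suble[OF r, of k] by (simp add: k_def)
  moreover have "norm (h (Z (r k))) \<le> B / (\<delta> / 2)" by (rule main) (simp add: k_def)
  ultimately show False using Z(2)[of "r k"] n by linarith
qed

section \<open>The characteristic function of the zero potential\<close>

lemma norm_sin_ge: "norm (sin w) \<ge> (exp \<bar>Im w\<bar> - exp (- \<bar>Im w\<bar>)) / 2"
proof -
  have n: "norm (sin w) = norm (exp (\<i> * w) - exp (- (\<i> * w))) / 2"
    by (simp add: sin_exp_eq norm_divide norm_mult)
  have 2: "norm (exp (\<i> * w) - exp (- (\<i> * w))) \<ge> \<bar>exp (- Im w) - exp (Im w)\<bar>"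
    using norm_triangle_ineq3[of "exp (\<i> * w)" "exp (- (\<i> * w))"] by simp
  have 3: "\<bar>exp (- Im w) - exp (Im w)\<bar> \<ge> exp \<bar>Im w\<bar> - exp (- \<bar>Im w\<bar>)"
    by (cases "Im w \<ge> 0") auto
  show ?thesis unfolding n by (intro divide_right_mono order_trans[OF 3 2]) simp
qed

text \<open>The antisymmetric functions on the loop: its nonzero zeros are the square roots of the
eigenvalues that have an eigenfunction vanishing on the boundary edge.\<close>

definition loop_sin :: "real \<Rightarrow> complex \<Rightarrow> complex" where
  "loop_sin l2 \<rho> = sin (\<rho> * of_real (l2 / 2))"

text \<open>The characteristic function of the zero potential on functions that are symmetric on the loop,
after division by \<open>- \<rho>\<close>.\<close>

definition sym_char :: "real \<Rightarrow> real \<Rightarrow> complex \<Rightarrow> complex" where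
  "sym_char l1 l2 \<rho> = 2 * cos (\<rho> * of_real l1) * sin (\<rho> * of_real (l2 / 2)) + sin (\<rho> * of_real l1) * cos (\<rho> * of_real (l2 / 2))"

lemma free_char_eq:
  "cos (\<rho> * of_real l1) * (2 * cos (\<rho> * of_real l2) - 2) - sin (\<rho> * of_real l1) * sin (\<rho> * of_real l2) =
   - 2 * (loop_sin l2 \<rho> * sym_char l1 l2 \<rho>)"
proof -
  define b where "b = \<rho> * of_real (l2 / 2)"
  have b2: "\<rho> * of_real l2 = 2 * b" by (simp add: b_def)
  show ?thesis unfolding loop_sin_def sym_char_def b_def[symmetric] b2 cos_double_sin sin_double
    by (simp add: algebra_simps power2_eq_square)
qed

lemma loop_sin_has_derivative: "(loop_sin l2 has_field_derivative of_real (l2 / 2) * cos (\<rho> * of_real (l2 / 2))) (at \<rho>)"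
  unfolding loop_sin_def[abs_def] by (rule derivative_eq_intros refl | simp)+

lemma sym_char_has_derivative:
  "(sym_char l1 l2 has_field_derivative (of_real (l1 + l2) * (cos (\<rho> * of_real l1) * cos (\<rho> * of_real (l2 / 2)))
     - of_real (2 * l1 + l2 / 2) * (sin (\<rho> * of_real l1) * sin (\<rho> * of_real (l2 / 2))))) (at \<rho>)"
  unfolding sym_char_def[abs_def] by (rule derivative_eq_intros refl | simp add: algebra_simps add_divide_distrib)+

lemma loop_sin_simple_zeros:
  assumes "l2 > 0" "loop_sin l2 \<rho> = 0"
  shows "deriv (loop_sin l2) \<rho> \<noteq> 0"
proof -
  have "cos (\<rho> * of_real (l2 / 2)) \<noteq> 0"
    using assms(2) sin_cos_squared_add[of "\<rho> * of_real (l2 / 2)"] by (auto simp: loop_sin_def)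
  then show ?thesis unfolding DERIV_imp_deriv[OF loop_sin_has_derivative[of l2 \<rho>]] using assms(1) by simp
qed

text \<open>With \<open>a = r l1\<close> and \<open>b = r l2 / 2\<close>, a zero satisfies
\<open>sin a cos b = - 2 cos a sin b\<close>, so \<open>cos a cos b\<close> and \<open>sin a sin b\<close> have opposite signs; if the
derivative vanished too, they would have equal signs, and both would be zero.\<close>

lemma sym_char_simple_real_zeros:
  fixes r :: real
  assumes l: "l1 > 0" "l2 > 0" and z: "sym_char l1 l2 (of_real r) = 0"
  shows "deriv (sym_char l1 l2) (of_real r) \<noteq> 0"
proof
  define a b where "a = r * l1" and "b = r * (l2 / 2)"
  have e: "complex_of_real r * of_real l1 = of_real a" "complex_of_real r * of_real (l2 / 2) = of_real b"
    by (simp_all add: a_def b_def)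
  have "complex_of_real (2 * cos a * sin b + sin a * cos b) = 0"
    using z unfolding sym_char_def e by (simp add: cos_of_real sin_of_real)
  then have T: "2 * cos a * sin b + sin a * cos b = 0" by (simp only: of_real_eq_0_iff)
  assume "deriv (sym_char l1 l2) (of_real r) = 0"
  then have "complex_of_real ((l1 + l2) * (cos a * cos b) - (2 * l1 + l2 / 2) * (sin a * sin b)) = 0"
    using DERIV_imp_deriv[OF sym_char_has_derivative[of l1 l2 "of_real r"]] unfolding e by (simp add: cos_of_real sin_of_real)
  then have D: "(l1 + l2) * (cos a * cos b) - (2 * l1 + l2 / 2) * (sin a * sin b) = 0" by (simp only: of_real_eq_0_iff)
  have "sin a * cos b = - 2 * (cos a * sin b)" using T by (simp add: algebra_simps)
  then have "sin a * cos b * (cos a * sin b) = - 2 * (cos a * sin b)\<^sup>2" by (simp add: power2_eq_square)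
  then have neg: "(cos a * cos b) * (sin a * sin b) \<le> 0"
    by (simp add: mult_ac)
  have "(2 * l1 + l2 / 2) * (sin a * sin b) = (l1 + l2) * (cos a * cos b)" using D by simp
  then have eq: "(2 * l1 + l2 / 2) * ((sin a * sin b) * (sin a * sin b)) = (l1 + l2) * ((cos a * cos b) * (sin a * sin b))"
    by (simp only: mult.assoc[symmetric])
  have "(2 * l1 + l2 / 2) * ((sin a * sin b) * (sin a * sin b)) \<le> 0"
    unfolding eq using l by (intro mult_nonneg_nonpos neg) auto
  then have ss: "sin a * sin b = 0" 
    using l mult_pos_pos[of "2 * l1 + l2 / 2" "(sin a * sin b) * (sin a * sin b)"] not_real_square_gt_zero[of "sin a * sin b"]
    by fastforce
  then have cc: "cos a * cos b = 0" using D l unfolding ss by simp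
  have "sin a = 0 \<Longrightarrow> cos a \<noteq> 0" "sin b = 0 \<Longrightarrow> cos b \<noteq> 0" using sin_cos_squared_add[of a] sin_cos_squared_add[of b] by auto
  then show False using ss cc T by auto
qed

text \<open>Writing \<open>T = 3/2 sin (a + b) - 1/2 sin (a - b)\<close>, the first term dominates because
\<open>|Im (a - b)| \<le> |Im (a + b)|\<close>.\<close>

lemma free_char_lower_bound:
  assumes l: "l1 > 0" "l2 > 0" and h: "\<bar>Im \<rho>\<bar> \<ge> 2 / l2"
  shows "norm (loop_sin l2 \<rho> * sym_char l1 l2 \<rho>) \<ge> exp (\<bar>Im \<rho>\<bar> * (l1 + l2)) / 32"
proof -
  define y where "y = \<bar>Im \<rho>\<bar> * (l2 / 2)"
  define Y where "Y = \<bar>Im \<rho>\<bar> * (l1 + l2 / 2)"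
  have y1: "y \<ge> 1" using h l by (simp add: y_def field_simps)
  have Y1: "Y \<ge> y" unfolding y_def Y_def by (rule mult_left_mono) (use l in auto)
  have e7: "exp (2::real) \<ge> 6"
  proof -
    have "exp (1::real) \<ge> 5 / 2" using exp_lower_Taylor_quadratic[of "1::real"] by simp
    then have "(5/2) * (5/2) \<le> exp (1::real) * exp 1" by (intro mult_mono) auto
    then show ?thesis by (simp add: exp_add[symmetric])
  qed
  have small: "6 * exp (- t) \<le> exp t" if "t \<ge> 1" for t :: real
  proof -
    have "6 * exp (- t) \<le> exp (2 * t) * exp (- t)"
      using e7 that by (intro mult_right_mono order_trans[OF e7]) auto
    then show ?thesis by (simp add: exp_add[symmetric])
  qed
  have Imb: "\<bar>Im (\<rho> * of_real (l2 / 2))\<bar> = y" using l by (simp add: y_def abs_mult)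
  have "E / 4 \<le> N" if "(E - e) / 2 \<le> N" "6 * e \<le> E" "0 \<le> e" for E e N :: real
  proof -
    have "e \<le> E / 6" using that by simp
    then have "(E - E / 6) / 2 \<le> (E - e) / 2" by simp
    moreover have "E / 4 \<le> (E - E / 6) / 2" using that by simp
    ultimately show ?thesis using that(1) by simp
  qed
  from this[OF _ small[OF y1] exp_ge_zero] have s: "norm (loop_sin l2 \<rho>) \<ge> exp y / 4"
    using norm_sin_ge[of "\<rho> * of_real (l2 / 2)"] unfolding loop_sin_def Imb .
  define a b where "a = \<rho> * of_real l1" and "b = \<rho> * of_real (l2 / 2)"
  have "sym_char l1 l2 \<rho> = 3 / 2 * sin (a + b) - 1 / 2 * sin (a - b)"
    unfolding sym_char_def a_def[symmetric] b_def[symmetric] sin_add sin_diff by (simp add: algebra_simps)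
  then have "norm (sym_char l1 l2 \<rho>) \<ge> norm (3 / 2 * sin (a + b)) - norm (1 / 2 * sin (a - b))"
    using norm_triangle_ineq2 by metis
  then have T1: "norm (sym_char l1 l2 \<rho>) \<ge> 3 / 2 * norm (sin (a + b)) - 1 / 2 * norm (sin (a - b))"
    by (simp add: norm_mult norm_divide)
  have Ip: "\<bar>Im (a + b)\<bar> = Y"
  proof -
    have "Im (a + b) = Im \<rho> * (l1 + l2 / 2)" by (simp add: a_def b_def algebra_simps)
    then show ?thesis using l by (simp add: Y_def abs_mult)
  qed
  have Im: "\<bar>Im (a - b)\<bar> \<le> Y"
  proof -
    have "Im (a - b) = Im \<rho> * (l1 - l2 / 2)" by (simp add: a_def b_def algebra_simps)
    then have "\<bar>Im (a - b)\<bar> = \<bar>Im \<rho>\<bar> * \<bar>l1 - l2 / 2\<bar>" by (simp add: abs_mult)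
    also have "\<dots> \<le> Y" unfolding Y_def using l by (intro mult_left_mono) auto
    finally show ?thesis .
  qed
  have "norm (sin (a - b)) \<le> exp Y" using cmod_sin_le[of "a - b"] Im by (meson exp_le_cancel_iff order_trans)
  moreover have "norm (sin (a + b)) \<ge> (exp Y - exp (- Y)) / 2" using norm_sin_ge[of "a + b"] unfolding Ip .
  ultimately have "norm (sym_char l1 l2 \<rho>) \<ge> 3 / 2 * ((exp Y - exp (- Y)) / 2) - 1 / 2 * exp Y"
    using T1 by linarith
  moreover have "6 * exp (- Y) \<le> exp Y" by (rule small) (use y1 Y1 in linarith)
  ultimately have T: "norm (sym_char l1 l2 \<rho>) \<ge> exp Y / 8" by argo
  have "exp (\<bar>Im \<rho>\<bar> * (l1 + l2)) / 32 = (exp y / 4) * (exp Y / 8)"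
    by (simp add: exp_add[symmetric] y_def Y_def algebra_simps)
  also have "\<dots> \<le> norm (loop_sin l2 \<rho>) * norm (sym_char l1 l2 \<rho>)" using s T by (intro mult_mono) auto
  finally show ?thesis by (simp add: norm_mult)
qed

section \<open>Eigenspaces and the characteristic function\<close>

locale lasso_problem = e1: edge l1 q1 + e2: edge l2 q2
  for l1 l2 :: real and q1 q2 :: "real \<Rightarrow> real"
begin

definition char_fun :: "complex \<Rightarrow> complex" where
  "char_fun z = e1.sol 1 0 z l1 * (e2.sol 1 0 z l2 + e2.dsol 0 1 z l2 - 2) + e1.dsol 1 0 z l1 * e2.sol 0 1 z l2"

text \<open>The matching conditions for the eigenfunction with \<open>y\<^sub>1(0) = a\<close> and \<open>y\<^sub>2'(0) = d\<close> read
\<open>a m11 + d m12 = 0\<close> (continuity at the end of the loop) and \<open>a m21 + d m22 = 0\<close> (balance of the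
derivatives); the remaining conditions are built into the parametrisation.\<close>

definition m11 :: "complex \<Rightarrow> complex" where "m11 z = e1.sol 1 0 z l1 * (e2.sol 1 0 z l2 - 1)"
definition m12 :: "complex \<Rightarrow> complex" where "m12 z = e2.sol 0 1 z l2"
definition m21 :: "complex \<Rightarrow> complex" where "m21 z = e1.dsol 1 0 z l1 + e1.sol 1 0 z l1 * e2.dsol 1 0 z l2"
definition m22 :: "complex \<Rightarrow> complex" where "m22 z = e2.dsol 0 1 z l2 - 1"

lemma l_mem: "l1 \<in> {0..l1}" "l2 \<in> {0..l2}" "0 \<in> {0..l1}" "0 \<in> {0..l2}"
  using e1.l_pos e2.l_pos by auto

lemma wronskian_e2: "e2.sol 1 0 z l2 * e2.dsol 0 1 z l2 - e2.dsol 1 0 z l2 * e2.sol 0 1 z l2 = 1"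
  using e2.wronskian[OF e2.sol_is_solution[of z 1 0] e2.sol_is_solution[of z 0 1] l_mem(2)] by simp

lemma char_fun_det: "char_fun z = m12 z * m21 z - m11 z * m22 z"
proof -
  have "m12 z * m21 z - m11 z * m22 z = char_fun z - e1.sol 1 0 z l1 * ((e2.sol 1 0 z l2 * e2.dsol 0 1 z l2 - e2.dsol 1 0 z l2 * e2.sol 0 1 z l2) - 1)"
    unfolding m11_def m12_def m21_def m22_def char_fun_def by (simp add: algebra_simps)
  then show ?thesis unfolding wronskian_e2 by simp
qed

lemma m_holomorphic:
  "m11 holomorphic_on UNIV" "m12 holomorphic_on UNIV" "m21 holomorphic_on UNIV" "m22 holomorphic_on UNIV"
  unfolding m11_def[abs_def] m12_def[abs_def] m21_def[abs_def] m22_def[abs_def]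
  by (intro holomorphic_intros e1.sol_holomorphic e2.sol_holomorphic l_mem)+

lemma char_fun_holomorphic: "char_fun holomorphic_on UNIV"
  unfolding char_fun_def[abs_def]
  by (intro holomorphic_intros e1.sol_holomorphic e2.sol_holomorphic l_mem)

text \<open>The candidate eigenfunction with \<open>y\<^sub>1(0) = a\<close>, \<open>y\<^sub>1'(0) = 0\<close> and \<open>y\<^sub>2'(0) = d\<close> that is continuous at
the vertex when the loop is entered.\<close>

definition evec :: "complex \<Rightarrow> complex \<Rightarrow> complex \<Rightarrow> lasso_fun" where
  "evec z a d = ((\<lambda>x. if x \<in> {0..l1} then a * e1.sol 1 0 z x else 0),
     (\<lambda>x. if x \<in> {0..l2} then a * e1.sol 1 0 z l1 * e2.sol 1 0 z x + d * e2.sol 0 1 z x else 0))"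

lemma evec_scale: "lasso_scale c (evec z a d) = evec z (c * a) (c * d)"
  by (auto simp: lasso_scale_def evec_def fun_eq_iff algebra_simps)

lemma evec_add: "evec z a d + evec z a' d' = evec z (a + a') (d + d')"
  by (auto simp: evec_def fun_eq_iff algebra_simps)

lemma evec_0 [simp]: "evec z 0 0 = 0"
  by (auto simp: evec_def fun_eq_iff zero_prod_def)

lemma eigenspace_parametrisation:
  assumes "y \<in> lasso_eigenspace l1 l2 q1 q2 z"
  obtains a d where "y = evec z a d" "a * m11 z + d * m12 z = 0" "a * m21 z + d * m22 z = 0"
proof -
  obtain y1 y2 where y: "y = (y1, y2)" by (metis surj_pair)
  note A = assms[unfolded y lasso_eigenspace_def, simplified]
  have s1: "e1.is_solution z y1 (edge_deriv l1 y1)" using A by (intro e1.edge_solution_is_solution) auto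
  have s2: "e2.is_solution z y2 (edge_deriv l2 y2)" using A by (intro e2.edge_solution_is_solution) auto
  define a where "a = y1 0"
  define d where "d = edge_deriv l2 y2 0"
  have d1: "edge_deriv l1 y1 0 = 0" using A by simp
  have y1: "y1 x = a * e1.sol 1 0 z x" "edge_deriv l1 y1 x = a * e1.dsol 1 0 z x" if "x \<in> {0..l1}" for x
    using e1.is_solution_eq_sol[OF s1 that] e1.sol_linear[OF that, of a 0 z] d1 by (simp_all add: a_def)
  have y2': "y2 x = y2 0 * e2.sol 1 0 z x + d * e2.sol 0 1 z x" "edge_deriv l2 y2 x = y2 0 * e2.dsol 1 0 z x + d * e2.dsol 0 1 z x" if "x \<in> {0..l2}" for x
    using e2.is_solution_eq_sol[OF s2 that] e2.sol_linear[OF that, of "y2 0" d z] by (simp_all add: d_def)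
  have y20: "y2 0 = a * e1.sol 1 0 z l1" using A y1(1)[OF l_mem(1)] by simp
  note y2 = y2'[unfolded y20]
  have "y = evec z a d"
    unfolding y evec_def using A y1(1) y2(1) by (auto simp: fun_eq_iff mult.assoc)
  moreover have "a * m11 z + d * m12 z = 0"
  proof -
    have "y2 l2 = y2 0" using A by simp
    then have "a * e1.sol 1 0 z l1 * e2.sol 1 0 z l2 + d * e2.sol 0 1 z l2 = a * e1.sol 1 0 z l1"
      using y2(1)[OF l_mem(2)] y20 by simp
    then show ?thesis by (simp add: m11_def m12_def algebra_simps)
  qed
  moreover have "a * m21 z + d * m22 z = 0"
  proof -
    have "edge_deriv l1 y1 l1 + edge_deriv l2 y2 l2 - edge_deriv l2 y2 0 = 0" using A by simp
    then have "a * e1.dsol 1 0 z l1 + (a * e1.sol 1 0 z l1 * e2.dsol 1 0 z l2 + d * e2.dsol 0 1 z l2) - d = 0"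
      using y1(2)[OF l_mem(1)] y2(2)[OF l_mem(2)] by (simp add: d_def)
    then show ?thesis by (simp add: m21_def m22_def algebra_simps)
  qed
  ultimately show ?thesis by (rule that)
qed

lemma eigenspace_finite_dimensional:
  "lasso_eigenspace l1 l2 q1 q2 z \<subseteq> lasso.span {evec z 1 0, evec z 0 1}"
proof
  fix y assume "y \<in> lasso_eigenspace l1 l2 q1 q2 z"
  then obtain a d where "y = evec z a d" by (rule eigenspace_parametrisation)
  then have "y = lasso_scale a (evec z 1 0) + lasso_scale d (evec z 0 1)" by (simp add: evec_scale evec_add)
  then show "y \<in> lasso.span {evec z 1 0, evec z 0 1}"
    by (auto intro!: lasso.span_add lasso.span_scale intro: lasso.span_base)
qed

lemma char_fun_zero:
  assumes "lasso.dim (lasso_eigenspace l1 l2 q1 q2 z) \<ge> 1"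
  shows "char_fun z = 0"
proof -
  let ?V = "lasso_eigenspace l1 l2 q1 q2 z"
  obtain B where B: "B \<subseteq> ?V" "lasso.independent B" "card B = lasso.dim ?V"
    by (rule lasso.basis_exists[of ?V])
  then have "B \<noteq> {}" using assms by auto
  then obtain y where y: "y \<in> B" by blast
  then have yV: "y \<in> ?V" and "y \<noteq> 0" using B lasso.dependent_zero[of B] by auto
  obtain a d where ad: "y = evec z a d" "a * m11 z + d * m12 z = 0" "a * m21 z + d * m22 z = 0"
    by (rule eigenspace_parametrisation[OF yV])
  then have "a \<noteq> 0 \<or> d \<noteq> 0" using \<open>y \<noteq> 0\<close> by auto
  then show ?thesis
  proof
    assume "a \<noteq> 0"
    have "a * char_fun z = m12 z * (a * m21 z + d * m22 z) - m22 z * (a * m11 z + d * m12 z)"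
      by (simp add: char_fun_det algebra_simps)
    then show ?thesis using ad \<open>a \<noteq> 0\<close> by simp
  next
    assume "d \<noteq> 0"
    have "d * char_fun z = m21 z * (a * m11 z + d * m12 z) - m11 z * (a * m21 z + d * m22 z)"
      by (simp add: char_fun_det algebra_simps)
    then show ?thesis using ad \<open>d \<noteq> 0\<close> by simp
  qed
qed

text \<open>Two independent eigenfunctions give two independent vectors in the kernel of a
\<open>2 \<times> 2\<close> matrix, so the whole matrix vanishes; then the determinant vanishes to second order.\<close>

lemma char_fun_double_zero:
  assumes "lasso.dim (lasso_eigenspace l1 l2 q1 q2 z) \<ge> 2"
  shows "deriv char_fun z = 0"
proof -
  let ?V = "lasso_eigenspace l1 l2 q1 q2 z"
  obtain B where B: "B \<subseteq> ?V" "lasso.independent B" "card B = lasso.dim ?V"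
    by (rule lasso.basis_exists[of ?V])
  then have c2: "card B \<ge> 2" using assms by simp
  then have "finite B" by (intro card_ge_0_finite) simp
  then obtain v w where vw: "v \<in> B" "w \<in> B" "v \<noteq> w" using c2 card_le_Suc0_iff_eq[of B] by auto
  obtain a d where ad: "v = evec z a d" "a * m11 z + d * m12 z = 0" "a * m21 z + d * m22 z = 0"
    by (rule eigenspace_parametrisation[OF subsetD[OF B(1) vw(1)]])
  obtain a' d' where ad': "w = evec z a' d'" "a' * m11 z + d' * m12 z = 0" "a' * m21 z + d' * m22 z = 0"
    by (rule eigenspace_parametrisation[OF subsetD[OF B(1) vw(2)]])
  have "v \<noteq> 0" using vw(1) B(2) lasso.dependent_zero[of B] by auto
  then have v0: "a \<noteq> 0 \<or> d \<noteq> 0" using ad by auto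
  have ind: "w \<notin> lasso.span {v}"
  proof
    assume "w \<in> lasso.span {v}"
    then have "w \<in> lasso.span (B - {w})" using lasso.span_mono[of "{v}" "B - {w}"] vw by auto
    then show False using B(2) vw(2) by (auto simp: lasso.dependent_def)
  qed
  have not_mult: "\<not> (a' = c * a \<and> d' = c * d)" for c
  proof
    assume "a' = c * a \<and> d' = c * d"
    then have "w = lasso_scale c v" by (simp add: ad ad' evec_scale)
    then show False using ind by (auto intro: lasso.span_scale lasso.span_base)
  qed
  have D: "a * d' - a' * d \<noteq> 0"
  proof
    assume 0: "a * d' - a' * d = 0"
    from v0 show False
    proof
      assume "a \<noteq> 0" then show False using not_mult[of "a' / a"] 0 by (simp add: field_simps)
    next
      assume "d \<noteq> 0" then show False using not_mult[of "d' / d"] 0 by (simp add: field_simps)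
    qed
  qed
  have row: "r = 0 \<and> s = 0" if "a * r + d * s = 0" "a' * r + d' * s = 0" for r s
  proof -
    have "(a * d' - a' * d) * r = d' * (a * r + d * s) - d * (a' * r + d' * s)"
         "(a * d' - a' * d) * s = a * (a' * r + d' * s) - a' * (a * r + d * s)"
      by (simp_all add: algebra_simps)
    then show ?thesis using that D by simp
  qed
  have 0: "m11 z = 0" "m12 z = 0" "m21 z = 0" "m22 z = 0" using row[OF ad(2) ad'(2)] row[OF ad(3) ad'(3)] by blast+
  have df: "(f has_field_derivative deriv f z) (at z)" if "f holomorphic_on UNIV" for f
    by (rule holomorphic_derivI[OF that open_UNIV]) auto
  have "((\<lambda>z. m12 z * m21 z - m11 z * m22 z) has_field_derivative
      (m12 z * deriv m21 z + deriv m12 z * m21 z) - (m11 z * deriv m22 z + deriv m11 z * m22 z)) (at z)"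
    by (intro DERIV_diff DERIV_mult' df m_holomorphic)
  then have "(char_fun has_field_derivative 0) (at z)"
    unfolding char_fun_det[abs_def] by (simp add: 0)
  then show ?thesis by (rule DERIV_imp_deriv)
qed

text \<open>Lower bounds for the dimension need the eigenspace to be finite-dimensional, since \<open>lasso.dim\<close>
assigns \<open>0\<close> to an infinite-dimensional space.\<close>

lemma dim_ge_1:
  assumes "v \<in> lasso_eigenspace l1 l2 q1 q2 z" "v \<noteq> 0"
  shows "lasso.dim (lasso_eigenspace l1 l2 q1 q2 z) \<ge> 1"
proof -
  let ?V = "lasso_eigenspace l1 l2 q1 q2 z"
  have i: "lasso.independent {v}" using assms(2) by simp
  obtain B where B: "{v} \<subseteq> B" "B \<subseteq> ?V" "lasso.independent B" "?V \<subseteq> lasso.span B"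
    by (rule lasso.maximal_independent_subset_extend[of "{v}" ?V]) (use assms i in auto)
  have "finite B"
    using lasso.independent_span_bound[of "{evec z 1 0, evec z 0 1}" B] B eigenspace_finite_dimensional[of z] by auto
  then have "card {v} \<le> card B" using B by (intro card_mono) auto
  then show ?thesis using lasso.basis_card_eq_dim[OF B(2,4,3)] by simp
qed

lemma dim_ge_2:
  assumes "v \<in> lasso_eigenspace l1 l2 q1 q2 z" "w \<in> lasso_eigenspace l1 l2 q1 q2 z" "v \<noteq> 0" "w \<notin> lasso.span {v}"
  shows "lasso.dim (lasso_eigenspace l1 l2 q1 q2 z) \<ge> 2"
proof -
  let ?V = "lasso_eigenspace l1 l2 q1 q2 z"
  have i: "lasso.independent {w, v}" using assms(3,4) by (intro lasso.independent_insertI lasso.independent_empty) auto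
  have "w \<noteq> v" using assms(4) by (auto intro: lasso.span_base)
  obtain B where B: "{w, v} \<subseteq> B" "B \<subseteq> ?V" "lasso.independent B" "?V \<subseteq> lasso.span B"
    by (rule lasso.maximal_independent_subset_extend[of "{w, v}" ?V]) (use assms i in auto)
  have "finite B"
    using lasso.independent_span_bound[of "{evec z 1 0, evec z 0 1}" B] B eigenspace_finite_dimensional[of z] by auto
  then have "card {w, v} \<le> card B" using B by (intro card_mono) auto
  then show ?thesis using lasso.basis_card_eq_dim[OF B(2,4,3)] \<open>w \<noteq> v\<close> by simp
qed

end

section \<open>Eigenfunctions of the zero potential\<close>

lemma lipschitz_of_bounded_derivative:
  fixes f :: "real \<Rightarrow> complex"
  assumes d: "\<And>x. (f has_vector_derivative f' x) (at x)" and c: "continuous_on {0..l} f'"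
  obtains L where "\<And>u v. u \<in> {0..l} \<Longrightarrow> v \<in> {0..l} \<Longrightarrow> norm (f v - f u) \<le> L * \<bar>v - u\<bar>"
proof -
  have "bounded (f' ` {0..l})" using c by (intro compact_imp_bounded compact_continuous_image) auto
  then obtain L where "\<forall>x\<in>{0..l}. norm (f' x) \<le> L" unfolding bounded_iff by auto
  then have L: "\<And>x. x \<in> {0..l} \<Longrightarrow> norm (f' x) \<le> L" by blast
  have "norm (f v - f u) \<le> L * norm (v - u)" if "u \<in> {0..l}" "v \<in> {0..l}" for u v
  proof (rule differentiable_bound[of "{0..l}" f "\<lambda>x h. h *\<^sub>R f' x"])
    fix x assume x: "x \<in> {0..l}"
    show "(f has_derivative (\<lambda>h. h *\<^sub>R f' x)) (at x within {0..l})"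
      using d[of x] unfolding has_vector_derivative_def by (rule has_derivative_at_withinI)
    show "onorm (\<lambda>h. h *\<^sub>R f' x) \<le> L" using L[OF x] by (intro onorm_le) (simp add: mult.commute[of L] mult_left_mono)
  qed (use that in auto)
  then have "norm (f v - f u) \<le> L * \<bar>v - u\<bar>" if "u \<in> {0..l}" "v \<in> {0..l}" for u v
    using that by simp
  then show ?thesis by (rule that)
qed

definition restrict_to_edge :: "real \<Rightarrow> (real \<Rightarrow> complex) \<Rightarrow> real \<Rightarrow> complex" where
  "restrict_to_edge l f x = (if x \<in> {0..l} then f x else 0)"

lemma free_edge_solution:
  assumes l: "l > 0" and f: "\<And>x. (f has_vector_derivative f' x) (at x)"
    and f': "\<And>x. (f' has_vector_derivative (- z * f x)) (at x)"
  shows "edge_solution l (\<lambda>_. 0) z (restrict_to_edge l f)"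
    and "\<And>x. x \<in> {0..l} \<Longrightarrow> edge_deriv l (restrict_to_edge l f) x = f' x"
proof -
  have cf: "continuous_on A f" and cf': "continuous_on A f'" for A
    using f f' by (auto intro!: continuous_at_imp_continuous_on has_vector_derivative_continuous)
  have hd: "(restrict_to_edge l f has_vector_derivative f' x) (at x within {0..l})" if "x \<in> {0..l}" for x
    by (rule has_vector_derivative_transform[OF that _ has_vector_derivative_at_within[OF f]]) (simp add: restrict_to_edge_def)
  show ed: "edge_deriv l (restrict_to_edge l f) x = f' x" if "x \<in> {0..l}" for x
    unfolding edge_deriv_def
    by (rule vector_derivative_within_closed_interval[OF l that hd[OF that]])
  obtain L where L: "\<And>u v. u \<in> {0..l} \<Longrightarrow> v \<in> {0..l} \<Longrightarrow> norm (f v - f u) \<le> L * \<bar>v - u\<bar>"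
    by (rule lipschitz_of_bounded_derivative[OF f cf'[of "{0..l}"]]) (rule that)
  have "continuous_on {0..l} (\<lambda>x. - z * f x)" by (intro continuous_intros cf)
  then obtain L' where L': "\<And>u v. u \<in> {0..l} \<Longrightarrow> v \<in> {0..l} \<Longrightarrow> norm (f' v - f' u) \<le> L' * \<bar>v - u\<bar>"
    by (rule lipschitz_of_bounded_derivative[OF f']) (rule that)
  show "edge_solution l (\<lambda>_. 0) z (restrict_to_edge l f)"
    unfolding edge_solution_def
  proof (intro conjI)
    show "restrict_to_edge l f differentiable_on {0..l}"
      unfolding differentiable_on_def by (intro ballI differentiableI_vector) (rule hd)
    show "absolutely_continuous_on {0..l} (restrict_to_edge l f)"
      by (rule absolutely_continuous_on_cong[OF absolutely_continuous_on_lipschitz[OF L]]) (auto simp: restrict_to_edge_def)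
    show "absolutely_continuous_on {0..l} (edge_deriv l (restrict_to_edge l f))"
      by (rule absolutely_continuous_on_cong[OF absolutely_continuous_on_lipschitz[OF L']]) (auto simp: ed)
    show "AE x in lebesgue_on {0..l}. \<exists>y2. (edge_deriv l (restrict_to_edge l f) has_vector_derivative y2) (at x within {0..l}) \<and>
        - y2 + complex_of_real 0 * restrict_to_edge l f x = z * restrict_to_edge l f x"
    proof (rule AE_I2)
      fix x assume "x \<in> space (lebesgue_on {0..l})"
      then have x: "x \<in> {0..l}" by simp
      have "(edge_deriv l (restrict_to_edge l f) has_vector_derivative - z * f x) (at x within {0..l})"
        by (rule has_vector_derivative_transform[OF x _ has_vector_derivative_at_within[OF f']]) (rule ed)
      then show "\<exists>y2. (edge_deriv l (restrict_to_edge l f) has_vector_derivative y2) (at x within {0..l}) \<and>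
        - y2 + complex_of_real 0 * restrict_to_edge l f x = z * restrict_to_edge l f x"
        using x by (intro exI[of _ "- z * f x"]) (simp add: restrict_to_edge_def)
    qed
  qed
qed

definition trig :: "complex \<Rightarrow> complex \<Rightarrow> complex \<Rightarrow> real \<Rightarrow> complex" where
  "trig \<rho> \<alpha> \<beta> x = \<alpha> * cos (\<rho> * of_real x) + \<beta> * sin (\<rho> * of_real x)"

lemma trig_has_vector_derivative: "(trig \<rho> \<alpha> \<beta> has_vector_derivative trig \<rho> (\<rho> * \<beta>) (- \<rho> * \<alpha>) x) (at x)"
proof -
  have "((\<lambda>w. \<alpha> * cos (\<rho> * w) + \<beta> * sin (\<rho> * w)) has_field_derivative trig \<rho> (\<rho> * \<beta>) (- \<rho> * \<alpha>) x) (at (of_real x))"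
    unfolding trig_def by (rule derivative_eq_intros refl | simp add: algebra_simps)+
  from has_vector_derivative_real_field[OF this] show ?thesis by (simp add: trig_def[abs_def])
qed

lemma trig_edge_solution:
  assumes "l > 0"
  shows "edge_solution l (\<lambda>_. 0) (\<rho>\<^sup>2) (restrict_to_edge l (trig \<rho> \<alpha> \<beta>))"
    and "\<And>x. x \<in> {0..l} \<Longrightarrow> edge_deriv l (restrict_to_edge l (trig \<rho> \<alpha> \<beta>)) x = trig \<rho> (\<rho> * \<beta>) (- \<rho> * \<alpha>) x"
proof -
  have "trig \<rho> (\<rho> * (- \<rho> * \<alpha>)) (- \<rho> * (\<rho> * \<beta>)) x = - (\<rho>\<^sup>2) * trig \<rho> \<alpha> \<beta> x" for x
    by (simp add: trig_def algebra_simps power2_eq_square)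
  then have d: "(trig \<rho> (\<rho> * \<beta>) (- \<rho> * \<alpha>) has_vector_derivative - (\<rho>\<^sup>2) * trig \<rho> \<alpha> \<beta> x) (at x)" for x
    using trig_has_vector_derivative[of \<rho> "\<rho> * \<beta>" "- \<rho> * \<alpha>" x] by simp
  show "edge_solution l (\<lambda>_. 0) (\<rho>\<^sup>2) (restrict_to_edge l (trig \<rho> \<alpha> \<beta>))"
    by (rule free_edge_solution(1)[OF assms trig_has_vector_derivative d])
  show "edge_deriv l (restrict_to_edge l (trig \<rho> \<alpha> \<beta>)) x = trig \<rho> (\<rho> * \<beta>) (- \<rho> * \<alpha>) x" if "x \<in> {0..l}" for x
    by (rule free_edge_solution(2)[OF assms trig_has_vector_derivative d that])
qed

lemma free_eigenfunction:
  assumes l: "l1 > 0" "l2 > 0"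
    and m: "trig \<rho> \<alpha> 0 l1 = \<alpha>2" "trig \<rho> \<alpha>2 \<beta>2 l2 = \<alpha>2"
      "\<rho> * (- \<alpha> * sin (\<rho> * of_real l1) - \<alpha>2 * sin (\<rho> * of_real l2) + \<beta>2 * cos (\<rho> * of_real l2) - \<beta>2) = 0"
  shows "(restrict_to_edge l1 (trig \<rho> \<alpha> 0), restrict_to_edge l2 (trig \<rho> \<alpha>2 \<beta>2)) \<in> lasso_eigenspace l1 l2 (\<lambda>_. 0) (\<lambda>_. 0) (\<rho>\<^sup>2)"
proof -
  have e: "edge_deriv l1 (restrict_to_edge l1 (trig \<rho> \<alpha> 0)) l1 = - \<rho> * \<alpha> * sin (\<rho> * of_real l1)"
    "edge_deriv l1 (restrict_to_edge l1 (trig \<rho> \<alpha> 0)) 0 = 0"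
    "edge_deriv l2 (restrict_to_edge l2 (trig \<rho> \<alpha>2 \<beta>2)) l2 = \<rho> * \<beta>2 * cos (\<rho> * of_real l2) - \<rho> * \<alpha>2 * sin (\<rho> * of_real l2)"
    "edge_deriv l2 (restrict_to_edge l2 (trig \<rho> \<alpha>2 \<beta>2)) 0 = \<rho> * \<beta>2"
    using l trig_edge_solution(2)[OF l(1), of l1 \<rho> \<alpha> 0] trig_edge_solution(2)[OF l(1), of 0 \<rho> \<alpha> 0]
      trig_edge_solution(2)[OF l(2), of l2 \<rho> \<alpha>2 \<beta>2] trig_edge_solution(2)[OF l(2), of 0 \<rho> \<alpha>2 \<beta>2]
    by (simp_all add: trig_def)
  have t0: "trig \<rho> \<alpha>2 \<beta>2 0 = \<alpha>2" by (simp add: trig_def)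
  have k: "- \<rho> * \<alpha> * sin (\<rho> * of_real l1) + (\<rho> * \<beta>2 * cos (\<rho> * of_real l2) - \<rho> * \<alpha>2 * sin (\<rho> * of_real l2)) - \<rho> * \<beta>2 = 0"
    using m(3) by (simp only: algebra_simps) (simp add: algebra_simps)
  show ?thesis
    unfolding lasso_eigenspace_def
    using trig_edge_solution(1)[OF l(1), of \<rho> \<alpha> 0] trig_edge_solution(1)[OF l(2), of \<rho> \<alpha>2 \<beta>2] e k m(1,2) l t0
    by (simp add: restrict_to_edge_def)
qed

lemma lasso_problem_free: "l1 > 0 \<Longrightarrow> l2 > 0 \<Longrightarrow> lasso_problem l1 l2 (\<lambda>_. 0) (\<lambda>_. 0)"
  unfolding lasso_problem_def edge_def by simp

text \<open>The eigenfunction is \<open>cos (\<rho> x)\<close> on the boundary edge and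
\<open>\<gamma> cos (\<rho> (x - l2 / 2))\<close> on the loop. With \<open>a = \<rho> l1\<close> and \<open>b = \<rho> l2 / 2\<close> the matching conditions are
\<open>cos a = \<gamma> cos b\<close> and \<open>sin a + 2 \<gamma> sin b = 0\<close>, and the condition for a common solution \<open>\<gamma>\<close> is
\<open>T = 0\<close>.\<close>

lemma symmetric_eigenfunction:
  assumes l: "l1 > 0" "l2 > 0" and z: "sym_char l1 l2 \<rho> = 0"
  obtains \<alpha> \<beta> where "(restrict_to_edge l1 (trig \<rho> 1 0), restrict_to_edge l2 (trig \<rho> \<alpha> \<beta>)) \<in> lasso_eigenspace l1 l2 (\<lambda>_. 0) (\<lambda>_. 0) (\<rho>\<^sup>2)"
proof -
  define a b where "a = \<rho> * of_real l1" and "b = \<rho> * of_real (l2 / 2)"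
  have b2: "\<rho> * of_real l2 = 2 * b" by (simp add: b_def)
  have T: "2 * cos a * sin b + sin a * cos b = 0" using z by (simp add: sym_char_def a_def b_def)
  obtain \<gamma> where g: "cos a = \<gamma> * cos b" "sin a + 2 * \<gamma> * sin b = 0"
  proof (cases "cos b = 0")
    case True
    then have s: "sin b \<noteq> 0" using sin_cos_squared_add[of b] by auto
    then have "cos a = 0" using T True by simp
    show ?thesis by (rule that[of "- sin a / (2 * sin b)"]) (use True s \<open>cos a = 0\<close> in auto)
  next
    case False
    show ?thesis
    proof (rule that[of "cos a / cos b"])
      have "(sin a + 2 * (cos a / cos b) * sin b) * cos b = 2 * cos a * sin b + sin a * cos b"
        using False by (simp add: field_simps)
      then show "sin a + 2 * (cos a / cos b) * sin b = 0" using T False by (metis mult_eq_0_iff)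
    qed (use False in simp)
  qed
  have m: "trig \<rho> 1 0 l1 = \<gamma> * cos b" "trig \<rho> (\<gamma> * cos b) (\<gamma> * sin b) l2 = \<gamma> * cos b"
  proof -
    show "trig \<rho> 1 0 l1 = \<gamma> * cos b" using g by (simp add: trig_def a_def)
    have "trig \<rho> (\<gamma> * cos b) (\<gamma> * sin b) l2 = \<gamma> * (cos (2 * b) * cos b + sin (2 * b) * sin b)"
      unfolding trig_def b2 by (simp add: algebra_simps)
    also have "\<dots> = \<gamma> * cos (2 * b - b)" unfolding cos_diff ..
    finally show "trig \<rho> (\<gamma> * cos b) (\<gamma> * sin b) l2 = \<gamma> * cos b" by simp
  qed
  have "- 1 * sin a - \<gamma> * cos b * sin (2 * b) + \<gamma> * sin b * cos (2 * b) - \<gamma> * sin b = - (sin a + \<gamma> * sin (2 * b - b) + \<gamma> * sin b)"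
    unfolding sin_diff by (simp add: algebra_simps)
  also have "\<dots> = 0" using g(2) by (simp add: algebra_simps)
  finally have "\<rho> * (- 1 * sin (\<rho> * of_real l1) - \<gamma> * cos b * sin (\<rho> * of_real l2) + \<gamma> * sin b * cos (\<rho> * of_real l2) - \<gamma> * sin b) = 0"
    unfolding b2 a_def by simp
  from free_eigenfunction[OF l m this] show ?thesis by (rule that)
qed

lemma antisymmetric_eigenfunction:
  assumes l: "l1 > 0" "l2 > 0" and z: "loop_sin l2 \<rho> = 0"
  shows "(restrict_to_edge l1 (trig \<rho> 0 0), restrict_to_edge l2 (trig \<rho> 0 1)) \<in> lasso_eigenspace l1 l2 (\<lambda>_. 0) (\<lambda>_. 0) (\<rho>\<^sup>2)"
proof (rule free_eigenfunction[OF l])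
  define b where "b = \<rho> * of_real (l2 / 2)"
  have b2: "\<rho> * of_real l2 = 2 * b" by (simp add: b_def)
  have s: "sin b = 0" using z by (simp add: loop_sin_def b_def)
  show "trig \<rho> 0 0 l1 = 0" "trig \<rho> 0 1 l2 = 0" unfolding trig_def b2 by (simp_all add: sin_double s)
  show "\<rho> * (- 0 * sin (\<rho> * of_real l1) - 0 * sin (\<rho> * of_real l2) + 1 * cos (\<rho> * of_real l2) - 1) = 0"
    unfolding b2 by (simp add: cos_double_sin s)
qed

lemma symmetric_nonzero: "l1 > 0 \<Longrightarrow> (restrict_to_edge l1 (trig \<rho> 1 0), g) \<noteq> 0"
  by (auto simp: zero_prod_def fun_eq_iff restrict_to_edge_def trig_def intro!: exI[of _ 0])

lemma antisymmetric_nonzero: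
  assumes "l2 > 0" "\<rho> \<noteq> 0"
  shows "(g, restrict_to_edge l2 (trig \<rho> 0 1)) \<noteq> 0"
proof
  assume "(g, restrict_to_edge l2 (trig \<rho> 0 1)) = 0"
  then have e: "restrict_to_edge l2 (trig \<rho> 0 1) = (\<lambda>_. 0)" by (simp add: zero_prod_def zero_fun_def)
  have "edge_deriv l2 (restrict_to_edge l2 (trig \<rho> 0 1)) 0 = \<rho>"
    using trig_edge_solution(2)[OF assms(1), of 0 \<rho> 0 1] assms(1) by (simp add: trig_def)
  moreover have "edge_deriv l2 (\<lambda>_. 0) 0 = 0"
    unfolding edge_deriv_def
    by (rule vector_derivative_within_closed_interval[OF assms(1)]) (use assms(1) in auto)
  ultimately show False using assms(2) unfolding e by simp
qed

lemma free_dim_symmetric: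
  assumes l: "l1 > 0" "l2 > 0" and z: "sym_char l1 l2 \<rho> = 0"
  shows "lasso.dim (lasso_eigenspace l1 l2 (\<lambda>_. 0) (\<lambda>_. 0) (\<rho>\<^sup>2)) \<ge> 1"
proof -
  obtain \<alpha> \<beta> where e: "(restrict_to_edge l1 (trig \<rho> 1 0), restrict_to_edge l2 (trig \<rho> \<alpha> \<beta>)) \<in> lasso_eigenspace l1 l2 (\<lambda>_. 0) (\<lambda>_. 0) (\<rho>\<^sup>2)"
    by (rule symmetric_eigenfunction[OF assms])
  show ?thesis by (rule lasso_problem.dim_ge_1[OF lasso_problem_free[OF l] e symmetric_nonzero[OF l(1)]])
qed

lemma free_dim_antisymmetric:
  assumes l: "l1 > 0" "l2 > 0" and z: "loop_sin l2 \<rho> = 0" and "\<rho> \<noteq> 0"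
  shows "lasso.dim (lasso_eigenspace l1 l2 (\<lambda>_. 0) (\<lambda>_. 0) (\<rho>\<^sup>2)) \<ge> 1"
  by (rule lasso_problem.dim_ge_1[OF lasso_problem_free[OF l] antisymmetric_eigenfunction[OF l z] antisymmetric_nonzero[OF l(2) assms(4)]])

lemma free_dim_both:
  assumes l: "l1 > 0" "l2 > 0" and z: "loop_sin l2 \<rho> = 0" "sym_char l1 l2 \<rho> = 0" and "\<rho> \<noteq> 0"
  shows "lasso.dim (lasso_eigenspace l1 l2 (\<lambda>_. 0) (\<lambda>_. 0) (\<rho>\<^sup>2)) \<ge> 2"
proof -
  obtain \<alpha> \<beta> where e: "(restrict_to_edge l1 (trig \<rho> 1 0), restrict_to_edge l2 (trig \<rho> \<alpha> \<beta>)) \<in> lasso_eigenspace l1 l2 (\<lambda>_. 0) (\<lambda>_. 0) (\<rho>\<^sup>2)"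
    by (rule symmetric_eigenfunction[OF l z(2)])
  show ?thesis
  proof (rule lasso_problem.dim_ge_2[OF lasso_problem_free[OF l] antisymmetric_eigenfunction[OF l z(1)] e antisymmetric_nonzero[OF l(2) assms(5)]])
    show "(restrict_to_edge l1 (trig \<rho> 1 0), restrict_to_edge l2 (trig \<rho> \<alpha> \<beta>)) \<notin> lasso.span {(restrict_to_edge l1 (trig \<rho> 0 0), restrict_to_edge l2 (trig \<rho> 0 1))}"
    proof
      assume "(restrict_to_edge l1 (trig \<rho> 1 0), restrict_to_edge l2 (trig \<rho> \<alpha> \<beta>)) \<in> lasso.span {(restrict_to_edge l1 (trig \<rho> 0 0), restrict_to_edge l2 (trig \<rho> 0 1))}"
      then obtain k where "(restrict_to_edge l1 (trig \<rho> 1 0), restrict_to_edge l2 (trig \<rho> \<alpha> \<beta>)) = lasso_scale k (restrict_to_edge l1 (trig \<rho> 0 0), restrict_to_edge l2 (trig \<rho> 0 1))"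
        unfolding lasso.span_singleton by auto
      then have "restrict_to_edge l1 (trig \<rho> 1 0) 0 = k * restrict_to_edge l1 (trig \<rho> 0 0) 0"
        by (simp add: lasso_scale_def)
      then show False using l by (simp add: restrict_to_edge_def trig_def)
    qed
  qed
qed

lemma cos_i_cosh: "cos (\<i> * complex_of_real x) = of_real (cosh x)"
  and sin_i_sinh: "sin (\<i> * complex_of_real x) = \<i> * of_real (sinh x)"
  by (simp_all add: cos_i_times sin_i_times cosh_field_def sinh_field_def exp_of_real exp_minus)

lemma sym_char_imaginary_nonzero:
  assumes l: "l1 > 0" "l2 > 0" and "\<kappa> \<noteq> 0"
  shows "sym_char l1 l2 (\<i> * complex_of_real \<kappa>) \<noteq> 0"
proof -
  define a b where "a = \<kappa> * l1" and "b = \<kappa> * (l2 / 2)"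
  have e: "\<i> * complex_of_real \<kappa> * of_real l1 = \<i> * of_real a" "\<i> * complex_of_real \<kappa> * of_real (l2 / 2) = \<i> * of_real b"
    by (simp_all add: a_def b_def)
  have "sym_char l1 l2 (\<i> * complex_of_real \<kappa>) = \<i> * of_real (2 * cosh a * sinh b + sinh a * cosh b)"
    unfolding sym_char_def e cos_i_cosh sin_i_sinh by (simp add: algebra_simps)
  moreover have "2 * cosh a * sinh b + sinh a * cosh b \<noteq> 0"
  proof (cases "\<kappa> > 0")
    case True
    then have "sinh a > 0" "sinh b > 0" using l by (simp_all add: a_def b_def)
    then have "2 * cosh a * sinh b + sinh a * cosh b > 0" using cosh_real_pos[of a] cosh_real_pos[of b] by (intro add_pos_pos mult_pos_pos) auto
    then show ?thesis by simp
  next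
    case False
    then have "sinh a < 0" "sinh b < 0" using l \<open>\<kappa> \<noteq> 0\<close> by (simp_all add: a_def b_def mult_neg_pos)
    then have "2 * cosh a * sinh b + sinh a * cosh b < 0" using cosh_real_pos[of a] cosh_real_pos[of b] by (intro add_neg_neg mult_pos_neg mult_neg_pos) auto
    then show ?thesis by simp
  qed
  ultimately show ?thesis by (simp only: mult_eq_0_iff of_real_eq_0_iff) simp
qed

text \<open>All zeros are real or imaginary because the eigenvalues are real, and \<open>T\<close> does
not vanish on the imaginary axis except at \<open>0\<close>.\<close>

lemma sym_char_simple_zeros:
  assumes l: "l1 > 0" "l2 > 0"
    and real: "\<And>z. lasso.dim (lasso_eigenspace l1 l2 (\<lambda>_. 0) (\<lambda>_. 0) z) \<ge> 1 \<Longrightarrow> z \<in> \<real>"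
    and z: "sym_char l1 l2 \<rho> = 0"
  shows "deriv (sym_char l1 l2) \<rho> \<noteq> 0"
proof -
  have "\<rho>\<^sup>2 \<in> \<real>" by (rule real[OF free_dim_symmetric[OF l z]])
  then have "Im (\<rho>\<^sup>2) = 0" by (simp add: complex_is_Real_iff)
  then have "Re \<rho> = 0 \<or> Im \<rho> = 0" by (auto simp: power2_eq_square)
  then have "Im \<rho> = 0"
  proof
    assume "Re \<rho> = 0"
    then have "\<rho> = \<i> * of_real (Im \<rho>)" by (simp add: complex_eq_iff)
    then show "Im \<rho> = 0" using sym_char_imaginary_nonzero[OF l, of "Im \<rho>"] z by auto
  qed
  then have "\<rho> = of_real (Re \<rho>)" by (simp add: complex_eq_iff)
  then show ?thesis using sym_char_simple_real_zeros[OF l, of "Re \<rho>"] z by simp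
qed

lemma loop_sin_holomorphic: "loop_sin l2 holomorphic_on UNIV"
  unfolding loop_sin_def[abs_def] by (intro holomorphic_intros)

lemma sym_char_holomorphic: "sym_char l1 l2 holomorphic_on UNIV"
  unfolding sym_char_def[abs_def] by (intro holomorphic_intros)

section \<open>Isospectral problems have proportional characteristic functions\<close>

lemma free_char_upper_bound:
  assumes "l1 > 0" "l2 > 0"
  shows "norm (loop_sin l2 \<rho> * sym_char l1 l2 \<rho>) \<le> 3 * exp (\<bar>Im \<rho>\<bar> * (l1 + l2))"
proof -
  define a b where "a = \<rho> * of_real l1" and "b = \<rho> * of_real (l2 / 2)"
  have Ia: "\<bar>Im a\<bar> = \<bar>Im \<rho>\<bar> * l1" and Ib: "\<bar>Im b\<bar> = \<bar>Im \<rho>\<bar> * (l2 / 2)"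
    using assms by (simp_all add: a_def b_def abs_mult)
  have "norm (sym_char l1 l2 \<rho>) \<le> norm (2 * cos a * sin b) + norm (sin a * cos b)"
    unfolding sym_char_def a_def[symmetric] b_def[symmetric] by (rule norm_triangle_ineq)
  also have "\<dots> \<le> 2 * (exp \<bar>Im a\<bar> * exp \<bar>Im b\<bar>) + exp \<bar>Im a\<bar> * exp \<bar>Im b\<bar>"
    unfolding norm_mult mult.assoc
    by (intro add_mono mult_mono cmod_sin_le cmod_cos_le) auto
  finally have T: "norm (sym_char l1 l2 \<rho>) \<le> 3 * (exp \<bar>Im a\<bar> * exp \<bar>Im b\<bar>)" by simp
  have s: "norm (loop_sin l2 \<rho>) \<le> exp \<bar>Im b\<bar>" unfolding loop_sin_def b_def[symmetric] by (rule cmod_sin_le)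
  have "norm (loop_sin l2 \<rho> * sym_char l1 l2 \<rho>) \<le> exp \<bar>Im b\<bar> * (3 * (exp \<bar>Im a\<bar> * exp \<bar>Im b\<bar>))"
    unfolding norm_mult using s T by (intro mult_mono) auto
  also have "\<dots> = 3 * exp (\<bar>Im \<rho>\<bar> * (l1 + l2))"
    unfolding Ia Ib by (simp add: exp_add[symmetric] algebra_simps)
  finally show ?thesis .
qed

context lasso_problem
begin

definition q_threshold :: real where "q_threshold = 1 + 2 * e1.q_norm + 2 * e2.q_norm"

lemma q_threshold: "q_threshold \<ge> 1" "q_threshold \<ge> 2 * e1.q_norm" "q_threshold \<ge> 2 * e2.q_norm"
  using e1.q_norm_nonneg e2.q_norm_nonneg by (auto simp: q_threshold_def)

lemma char_fun_bound:
  assumes "norm \<rho> \<ge> q_threshold"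
  shows "norm (char_fun (\<rho>\<^sup>2)) \<le> 16 * exp (\<bar>Im \<rho>\<bar> * (l1 + l2))"
proof -
  define E1 E2 where "E1 = exp (\<bar>Im \<rho>\<bar> * l1)" and "E2 = exp (\<bar>Im \<rho>\<bar> * l2)"
  have E: "E1 > 0" "E2 \<ge> 1" using e1.l_pos e2.l_pos by (auto simp: E1_def E2_def)
  have n: "1 \<le> norm \<rho>" "2 * e1.q_norm \<le> norm \<rho>" "2 * e2.q_norm \<le> norm \<rho>" using assms q_threshold by linarith+
  note b1 = e1.fundamental_bound[OF n(2,1) l_mem(1), folded E1_def]
  note b2 = e2.fundamental_bound[OF n(3,1) l_mem(2), folded E2_def]
  have "norm (e2.sol 1 0 (\<rho>\<^sup>2) l2 + e2.dsol 0 1 (\<rho>\<^sup>2) l2 - 2) \<le> norm (e2.sol 1 0 (\<rho>\<^sup>2) l2 + e2.dsol 0 1 (\<rho>\<^sup>2) l2) + norm (2::complex)"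
    by (rule norm_triangle_ineq4)
  also have "\<dots> \<le> (2 * E2 + 2 * E2) + 2"
    using norm_triangle_ineq[of "e2.sol 1 0 (\<rho>\<^sup>2) l2" "e2.dsol 0 1 (\<rho>\<^sup>2) l2"] b2(1,4) by simp
  also have "\<dots> \<le> 6 * E2" using E by simp
  finally have A: "norm (e2.sol 1 0 (\<rho>\<^sup>2) l2 + e2.dsol 0 1 (\<rho>\<^sup>2) l2 - 2) \<le> 6 * E2" .
  have "norm (char_fun (\<rho>\<^sup>2)) \<le> norm (e1.sol 1 0 (\<rho>\<^sup>2) l1) * norm (e2.sol 1 0 (\<rho>\<^sup>2) l2 + e2.dsol 0 1 (\<rho>\<^sup>2) l2 - 2)
      + norm (e1.dsol 1 0 (\<rho>\<^sup>2) l1) * norm (e2.sol 0 1 (\<rho>\<^sup>2) l2)"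
    unfolding char_fun_def norm_mult[symmetric] by (rule norm_triangle_ineq)
  also have "\<dots> \<le> (2 * E1) * (6 * E2) + (2 * norm \<rho> * E1) * (2 / norm \<rho> * E2)"
    using b1 b2 A E by (intro add_mono mult_mono) auto
  also have "\<dots> = 16 * (E1 * E2)" 
  proof -
    have "norm \<rho> \<noteq> 0" using n(1) by linarith
    then show ?thesis by (simp add: field_simps)
  qed
  also have "E1 * E2 = exp (\<bar>Im \<rho>\<bar> * (l1 + l2))" by (simp add: E1_def E2_def exp_add[symmetric] algebra_simps)
  finally show ?thesis .
qed

text \<open>The factors \<open>s\<close> and \<open>T\<close> are divided out one after the other. After division by \<open>s\<close>
the quotient still vanishes at the zeros of \<open>T\<close>: where \<open>s \<noteq> 0\<close> because \<open>T = 0\<close> yields an eigenvalue,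
and at common zeros because these are double eigenvalues, except for \<open>\<rho> = 0\<close>, where the substitution
\<open>z = \<rho>\<^sup>2\<close> provides the second order.\<close>

theorem isospectral_char_fun:
  assumes dims: "\<And>z. lasso.dim (lasso_eigenspace l1 l2 q1 q2 z) = lasso.dim (lasso_eigenspace l1 l2 (\<lambda>_. 0) (\<lambda>_. 0) z)"
    and real: "\<And>z. lasso.dim (lasso_eigenspace l1 l2 (\<lambda>_. 0) (\<lambda>_. 0) z) \<ge> 1 \<Longrightarrow> z \<in> \<real>"
  obtains c where "\<And>\<rho>. char_fun (\<rho>\<^sup>2) = c * (loop_sin l2 \<rho> * sym_char l1 l2 \<rho>)"
proof -
  note l = e1.l_pos e2.l_pos
  define D where "D \<rho> = char_fun (\<rho>\<^sup>2)" for \<rho>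
  have D': "(D has_field_derivative deriv char_fun (\<rho>\<^sup>2) * (2 * \<rho>)) (at \<rho>)" for \<rho>
  proof -
    have "(char_fun has_field_derivative deriv char_fun (\<rho>\<^sup>2)) (at (\<rho>\<^sup>2))"
      by (rule holomorphic_derivI[OF char_fun_holomorphic open_UNIV]) auto
    moreover have "((\<lambda>\<rho>. \<rho>\<^sup>2) has_field_derivative 2 * \<rho>) (at \<rho>)"
      by (rule derivative_eq_intros refl | simp)+
    ultimately show ?thesis unfolding D_def[abs_def] by (rule DERIV_chain2)
  qed
  have Dhol: "D holomorphic_on UNIV"
    using D' by (auto simp: holomorphic_on_def field_differentiable_def intro: has_field_derivative_at_within)
  have Dsym: "D \<rho> = 0" if "sym_char l1 l2 \<rho> = 0" for \<rho>
    unfolding D_def by (rule char_fun_zero) (use free_dim_symmetric[OF l that] dims in simp)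
  have sym0: "sym_char l1 l2 0 = 0" by (simp add: sym_char_def)
  have Dloop: "D \<rho> = 0" if "loop_sin l2 \<rho> = 0" for \<rho>
  proof (cases "\<rho> = 0")
    case True
    then show ?thesis using Dsym[OF sym0] by simp
  next
    case False
    show ?thesis unfolding D_def by (rule char_fun_zero) (use free_dim_antisymmetric[OF l that False] dims in simp)
  qed
  have Dboth: "deriv D \<rho> = 0" if "loop_sin l2 \<rho> = 0" "sym_char l1 l2 \<rho> = 0" for \<rho>
  proof (cases "\<rho> = 0")
    case True
    then show ?thesis using DERIV_imp_deriv[OF D'[of \<rho>]] by simp
  next
    case False
    have "deriv char_fun (\<rho>\<^sup>2) = 0" by (rule char_fun_double_zero) (use free_dim_both[OF l that False] dims in simp)
    then show ?thesis using DERIV_imp_deriv[OF D'[of \<rho>]] by simp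
  qed
  obtain h where h: "h holomorphic_on UNIV" "\<And>\<rho>. D \<rho> = h \<rho> * loop_sin l2 \<rho>" "\<And>\<rho>. loop_sin l2 \<rho> = 0 \<Longrightarrow> h \<rho> = deriv D \<rho> / deriv (loop_sin l2) \<rho>"
  proof (rule entire_divide_simple_zeros[OF Dhol loop_sin_holomorphic])
    show "deriv (loop_sin l2) z \<noteq> 0 \<and> D z = 0" if "loop_sin l2 z = 0" for z
      using loop_sin_simple_zeros[OF l(2) that] Dloop[OF that] by simp
  qed (rule that)
  \<comment> \<open>At a common zero the value of the quotient is a ratio of derivatives, whose numerator vanishes.\<close>
  have hsym: "h \<rho> = 0" if "sym_char l1 l2 \<rho> = 0" for \<rho>
  proof (cases "loop_sin l2 \<rho> = 0")
    case True
    then show ?thesis using h(3)[OF True] Dboth[OF True that] by simp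
  next
    case False
    then show ?thesis using h(2)[of \<rho>] Dsym[OF that] by simp
  qed
  obtain F where F: "F holomorphic_on UNIV" "\<And>\<rho>. h \<rho> = F \<rho> * sym_char l1 l2 \<rho>"
  proof (rule entire_divide_simple_zeros[OF h(1) sym_char_holomorphic])
    show "deriv (sym_char l1 l2) z \<noteq> 0 \<and> h z = 0" if "sym_char l1 l2 z = 0" for z
      using sym_char_simple_zeros[OF l real that] hsym[OF that] by simp
  qed (rule that)
  define f where "f \<rho> = loop_sin l2 \<rho> * sym_char l1 l2 \<rho>" for \<rho>
  have DF: "D \<rho> = F \<rho> * f \<rho>" for \<rho> by (simp add: h(2) F(2) f_def mult_ac)
  have fhol: "f holomorphic_on UNIV" unfolding f_def[abs_def]
    by (intro holomorphic_on_mult loop_sin_holomorphic sym_char_holomorphic)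
  have cmp: "\<exists>B. \<forall>\<rho>. norm \<rho> \<le> q_threshold \<longrightarrow> norm (k \<rho>) \<le> B" if "k holomorphic_on UNIV" for k :: "complex \<Rightarrow> complex"
  proof -
    have "bounded (k ` cball 0 q_threshold)"
      by (intro compact_imp_bounded compact_continuous_image continuous_on_subset[OF holomorphic_on_imp_continuous_on[OF that]]) auto
    then obtain B where "\<forall>x\<in>cball 0 q_threshold. norm (k x) \<le> B" unfolding bounded_iff by auto
    then show ?thesis by (intro exI[of _ B]) auto
  qed
  obtain BD where BD: "\<And>\<rho>. norm \<rho> \<le> q_threshold \<Longrightarrow> norm (D \<rho>) \<le> BD" using cmp[OF Dhol] by blast
  obtain BF where BF: "\<And>\<rho>. norm \<rho> \<le> q_threshold \<Longrightarrow> norm (F \<rho>) \<le> BF" using cmp[OF F(1)] by blast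
  define b where "b = 2 / l2"
  have b0: "b > 0" using l by (simp add: b_def)
  have "\<exists>B. \<forall>z. \<bar>Im z\<bar> \<le> b \<longrightarrow> norm (F z) \<le> B"
  proof (rule entire_quotient_bounded_on_strip[OF fhol F(1), where m = "1/32" and b = b])
    fix R :: real
    define E where "E = exp (R * (l1 + l2))"
    have "norm (f z) \<le> max (3 * E) (max (16 * E) BD) \<and> norm (F z * f z) \<le> max (3 * E) (max (16 * E) BD)" if "\<bar>Im z\<bar> \<le> R" for z
    proof -
      have e: "exp (\<bar>Im z\<bar> * (l1 + l2)) \<le> E" using that l by (simp add: E_def mult_right_mono)
      have "norm (f z) \<le> 3 * E" using free_char_upper_bound[OF l, of z] e unfolding f_def by linarith
      moreover have "norm (D z) \<le> max (16 * E) BD"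
      proof (cases "norm z \<le> q_threshold")
        case True then show ?thesis using BD[OF True] by simp
      next
        case False
        then have "norm (D z) \<le> 16 * E" using char_fun_bound[of z] e unfolding D_def by simp
        then show ?thesis by simp
      qed
      ultimately show ?thesis unfolding DF[symmetric] by (simp add: le_max_iff_disj)
    qed
    then show "\<exists>B. \<forall>z. \<bar>Im z\<bar> \<le> R \<longrightarrow> norm (f z) \<le> B \<and> norm (F z * f z) \<le> B" by blast
  next
    show "b > 0" by (rule b0)
    show "(1/32 :: real) > 0" by simp
    fix x
    have i: "\<bar>Im (complex_of_real x + \<i> * complex_of_real b)\<bar> = b" using b0 by simp
    have "exp (b * (l1 + l2)) / 32 \<le> norm (f (complex_of_real x + \<i> * complex_of_real b))"
      using free_char_lower_bound[OF l, of "complex_of_real x + \<i> * complex_of_real b", unfolded i, folded f_def, folded b_def] by simp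
    moreover have "1 \<le> exp (b * (l1 + l2))" using b0 l by simp
    ultimately show "1/32 \<le> norm (f (complex_of_real x + \<i> * complex_of_real b))" by linarith
  qed
  then obtain B1 where B1: "\<And>z. \<bar>Im z\<bar> \<le> b \<Longrightarrow> norm (F z) \<le> B1" by blast
  have "norm (F z) \<le> max B1 (max BF 512)" for z
  proof (cases "\<bar>Im z\<bar> \<le> b")
    case True then show ?thesis using B1[OF True] by simp
  next
    case False
    show ?thesis
    proof (cases "norm z \<le> q_threshold")
      case True then show ?thesis using BF[OF True] by simp
    next
      case f2: False
      define E where "E = exp (\<bar>Im z\<bar> * (l1 + l2))"
      have "norm (F z) * (E / 32) \<le> norm (F z) * norm (f z)"
        using free_char_lower_bound[OF l, of z] False unfolding f_def E_def b_def by (intro mult_left_mono) auto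
      also have "\<dots> \<le> 16 * E" using char_fun_bound[of z] f2 DF[of z] unfolding D_def E_def by (simp add: norm_mult)
      finally have "norm (F z) \<le> 512" using exp_gt_zero[of "\<bar>Im z\<bar> * (l1 + l2)"] by (simp add: E_def)
      then show ?thesis by simp
    qed
  qed
  then have "bounded (range F)" unfolding bounded_iff by auto
  then have "F constant_on UNIV" by (rule Liouville_theorem[OF F(1)])
  then obtain c where "\<And>z. F z = c" by (auto simp: constant_on_def)
  then have "char_fun (\<rho>\<^sup>2) = c * (loop_sin l2 \<rho> * sym_char l1 l2 \<rho>)" for \<rho>
    using DF[of \<rho>] by (simp add: D_def f_def)
  then show ?thesis by (rule that)
qed

end

section \<open>The mean of the potential\<close>

text \<open>The expansion of the characteristic function when each ingredient is \<open>1/2\<close> plus a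
multiple of \<open>1 / \<kappa>\<close> and \<open>\<epsilon>\<close> stands for the exponentially small term \<open>exp (- \<kappa> l2)\<close>.\<close>

lemma first_order_product:
  fixes \<kappa> :: "nat \<Rightarrow> real" and A A' C S S' \<epsilon> :: "nat \<Rightarrow> complex"
  assumes \<kappa>: "filterlim \<kappa> at_top sequentially"
    and A: "(\<lambda>n. of_real (\<kappa> n) * (A n - 1/2)) \<longlonglongrightarrow> \<alpha>" and A': "(\<lambda>n. of_real (\<kappa> n) * (A' n - 1/2)) \<longlonglongrightarrow> \<alpha>"
    and C: "(\<lambda>n. of_real (\<kappa> n) * (C n - 1/2)) \<longlonglongrightarrow> \<beta>" and S: "(\<lambda>n. of_real (\<kappa> n) * (S n - 1/2)) \<longlonglongrightarrow> \<beta>"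
    and S': "(\<lambda>n. of_real (\<kappa> n) * (S' n - 1/2)) \<longlonglongrightarrow> \<beta>" and e: "(\<lambda>n. of_real (\<kappa> n) * \<epsilon> n) \<longlonglongrightarrow> 0"
  shows "(\<lambda>n. of_real (\<kappa> n) * (A n * (C n + S' n - 2 * \<epsilon> n) + A' n * S n - 3/4)) \<longlonglongrightarrow> 3/2 * (\<alpha> + \<beta>)"
    and "(\<lambda>n. A n * (C n + S' n - 2 * \<epsilon> n) + A' n * S n) \<longlonglongrightarrow> 3/4"
proof -
  have inv: "(\<lambda>n. of_real (inverse (\<kappa> n))) \<longlonglongrightarrow> complex_of_real 0"
    by (intro tendsto_of_real tendsto_inverse_0_at_top \<kappa>)
  have nz: "\<forall>\<^sub>F n in sequentially. \<kappa> n \<noteq> 0"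
    using filterlim_at_top_dense[THEN iffD1, OF \<kappa>, rule_format, of 0] by (rule eventually_mono) simp
  have down: "X \<longlonglongrightarrow> x" if "(\<lambda>n. of_real (\<kappa> n) * (X n - x)) \<longlonglongrightarrow> \<xi>" for X :: "nat \<Rightarrow> complex" and x \<xi>
  proof -
    have "(\<lambda>n. of_real (inverse (\<kappa> n)) * (of_real (\<kappa> n) * (X n - x))) \<longlonglongrightarrow> complex_of_real 0 * \<xi>"
      by (rule tendsto_mult[OF inv that])
    then have h: "(\<lambda>n. of_real (inverse (\<kappa> n)) * (of_real (\<kappa> n) * (X n - x))) \<longlonglongrightarrow> 0" by simp
    have "(\<lambda>n. X n - x) \<longlonglongrightarrow> 0"
      by (rule Lim_transform_eventually[OF h], rule eventually_mono[OF nz]) simp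
    then show ?thesis by (simp add: LIM_zero_iff)
  qed
  have e0: "\<epsilon> \<longlonglongrightarrow> 0" using down[of \<epsilon> 0 0] e by simp
  have "(\<lambda>n. of_real (\<kappa> n) * (A n - 1/2) * (C n + S' n - 2 * \<epsilon> n) + 1/2 * (of_real (\<kappa> n) * (C n - 1/2) + of_real (\<kappa> n) * (S' n - 1/2) - 2 * (of_real (\<kappa> n) * \<epsilon> n))
     + of_real (\<kappa> n) * (A' n - 1/2) * S n + 1/2 * (of_real (\<kappa> n) * (S n - 1/2)))
     \<longlonglongrightarrow> \<alpha> * (1/2 + 1/2 - 2 * 0) + 1/2 * (\<beta> + \<beta> - 2 * 0) + \<alpha> * (1/2) + 1/2 * \<beta>"
    by (intro tendsto_intros A A' C S S' e e0 down[OF C] down[OF S'] down[OF S])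
  moreover have "k * (a - 1/2) * (c + s' - 2 * e) + 1/2 * (k * (c - 1/2) + k * (s' - 1/2) - 2 * (k * e)) + k * (a' - 1/2) * s + 1/2 * (k * (s - 1/2))
      = k * (a * (c + s' - 2 * e) + a' * s - 3/4)" for k a c s' e a' s :: complex
    by (simp add: field_simps)
  moreover have "\<alpha> * (1/2 + 1/2 - 2 * 0) + 1/2 * (\<beta> + \<beta> - 2 * 0) + \<alpha> * (1/2) + 1/2 * \<beta> = 3/2 * (\<alpha> + \<beta>)"
    by (simp add: field_simps)
  ultimately show "(\<lambda>n. of_real (\<kappa> n) * (A n * (C n + S' n - 2 * \<epsilon> n) + A' n * S n - 3/4)) \<longlonglongrightarrow> 3/2 * (\<alpha> + \<beta>)"
    by (simp only:)
  from down[OF this] show "(\<lambda>n. A n * (C n + S' n - 2 * \<epsilon> n) + A' n * S n) \<longlonglongrightarrow> 3/4" .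
qed

context lasso_problem
begin

lemma isospectral_mean_zero:
  assumes c: "\<And>\<rho>. char_fun (\<rho>\<^sup>2) = c * (loop_sin l2 \<rho> * sym_char l1 l2 \<rho>)"
  shows "c = - 2" "integral {0..l1} q1 + integral {0..l2} q2 = 0"
proof -
  note l = e1.l_pos e2.l_pos
  define \<kappa> where "\<kappa> n = q_threshold + real n" for n
  have \<kappa>: "\<kappa> n \<ge> 1" "\<kappa> n \<ge> 2 * e1.q_norm" "\<kappa> n \<ge> 2 * e2.q_norm" for n
    using q_threshold by (auto simp: \<kappa>_def)
  have \<kappa>lim: "filterlim \<kappa> at_top sequentially"
    unfolding \<kappa>_def[abs_def] by (intro filterlim_tendsto_add_at_top[OF tendsto_const] filterlim_real_sequentially)
  have kc: "complex_of_real (\<kappa> n) \<noteq> 0" for n using \<kappa>(1)[of n] by auto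
  define z where "z n = (\<i> * complex_of_real (\<kappa> n))\<^sup>2" for n
  define A where "A n = of_real (exp (- \<kappa> n * l1)) * e1.sol 1 0 (z n) l1" for n
  define A' where "A' n = of_real (exp (- \<kappa> n * l1)) * e1.dsol 1 0 (z n) l1 / of_real (\<kappa> n)" for n
  define C where "C n = of_real (exp (- \<kappa> n * l2)) * e2.sol 1 0 (z n) l2" for n
  define S where "S n = of_real (exp (- \<kappa> n * l2)) * (of_real (\<kappa> n) * e2.sol 0 1 (z n) l2)" for n
  define S' where "S' n = of_real (exp (- \<kappa> n * l2)) * e2.dsol 0 1 (z n) l2" for n
  define \<epsilon> where "\<epsilon> n = complex_of_real (exp (- \<kappa> n * l2))" for n
  define Q1 where "Q1 = complex_of_real (integral {0..l1} q1 / 4)"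
  define Q2 where "Q2 = complex_of_real (integral {0..l2} q2 / 4)"
  note a1 = e1.fundamental_asymptotics[OF \<kappa>(1,2) \<kappa>lim, folded z_def Q1_def, folded A_def A'_def]
  note a2 = e2.fundamental_asymptotics[OF \<kappa>(1,3) \<kappa>lim, folded z_def Q2_def, folded C_def S_def S'_def]
  have elim: "(\<lambda>n. of_real (\<kappa> n) * complex_of_real (exp (- \<kappa> n * s))) \<longlonglongrightarrow> 0" if "s > 0" for s
  proof -
    have "((\<lambda>k::real. k * exp (- k * s)) \<longlongrightarrow> 0) at_top" using that by real_asymp
    from tendsto_of_real[OF filterlim_compose[OF this \<kappa>lim], where ?'a = complex]
    show ?thesis by simp
  qed
  note G = first_order_product[OF \<kappa>lim a1(1) a1(2) a2(1) a2(3) a2(4) elim[OF l(2), folded \<epsilon>_def]]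
  define c1 s1 c2 s2 where "c1 n = damped_cosh (\<kappa> n) l1" and "s1 n = damped_sinh (\<kappa> n) l1"
    and "c2 n = damped_cosh (\<kappa> n) l2" and "s2 n = damped_sinh (\<kappa> n) l2" for n
  note h1 = damped_tendsto(3,4)[OF \<kappa>lim l(1), folded c1_def s1_def]
  note h2 = damped_tendsto(3,4)[OF \<kappa>lim l(2), folded c2_def s2_def]
  note G0 = first_order_product[OF \<kappa>lim h1(1) h1(2) h2(1) h2(2) h2(1) elim[OF l(2), folded \<epsilon>_def]]
  define X where "X n = A n * (C n + S' n - 2 * \<epsilon> n) + A' n * S n" for n
  define Y where "Y n = c1 n * (c2 n + c2 n - 2 * \<epsilon> n) + s1 n * s2 n" for n
  have XY: "X n = (- c / 2) * Y n" for n
  proof -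
    define E1 where "E1 = complex_of_real (exp (\<kappa> n * l1))"
    define E2 where "E2 = complex_of_real (exp (\<kappa> n * l2))"
    have n1: "E1 * of_real (exp (- \<kappa> n * l1)) = 1" and n2: "E2 * \<epsilon> n = 1"
      unfolding E1_def E2_def \<epsilon>_def of_real_mult[symmetric] exp_add[symmetric] by simp_all
    have n2': "E2 * of_real (exp (- \<kappa> n * l2)) = 1" using n2 by (simp add: \<epsilon>_def)
    have p: "e1.sol 1 0 (z n) l1 = E1 * A n" "e1.dsol 1 0 (z n) l1 = of_real (\<kappa> n) * (E1 * A' n)"
        "e2.sol 1 0 (z n) l2 = E2 * C n" "of_real (\<kappa> n) * e2.sol 0 1 (z n) l2 = E2 * S n" "e2.dsol 0 1 (z n) l2 = E2 * S' n"
    proof -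
      show "e1.sol 1 0 (z n) l1 = E1 * A n" unfolding A_def mult.assoc[symmetric] n1 by simp
      have "of_real (\<kappa> n) * (E1 * A' n) = E1 * of_real (exp (- \<kappa> n * l1)) * e1.dsol 1 0 (z n) l1"
        unfolding A'_def using kc[of n] by (simp add: field_simps)
      then show "e1.dsol 1 0 (z n) l1 = of_real (\<kappa> n) * (E1 * A' n)" unfolding n1 by simp
      show "e2.sol 1 0 (z n) l2 = E2 * C n" unfolding C_def mult.assoc[symmetric] n2' by simp
      have "E2 * S n = (E2 * of_real (exp (- \<kappa> n * l2))) * (of_real (\<kappa> n) * e2.sol 0 1 (z n) l2)" unfolding S_def by (simp only: mult.assoc)
      then show "of_real (\<kappa> n) * e2.sol 0 1 (z n) l2 = E2 * S n" unfolding n2' by simp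
      show "e2.dsol 0 1 (z n) l2 = E2 * S' n" unfolding S'_def mult.assoc[symmetric] n2' by simp
    qed
    have "char_fun (z n) = E1 * E2 * X n"
    proof -
      have "char_fun (z n) = E1 * A n * (E2 * C n + E2 * S' n - 2 * (E2 * \<epsilon> n)) + (E1 * A' n) * (of_real (\<kappa> n) * e2.sol 0 1 (z n) l2)"
        unfolding char_fun_def p(1,2,3,5) n2 by (simp add: mult_ac)
      then show ?thesis unfolding p(4) X_def by (simp add: algebra_simps)
    qed
    moreover have YE: "- 2 * (loop_sin l2 (\<i> * of_real (\<kappa> n)) * sym_char l1 l2 (\<i> * of_real (\<kappa> n))) = E1 * E2 * Y n"
    proof -
      have cs: "cos (\<i> * of_real (\<kappa> n) * of_real l1) = E1 * c1 n" "cos (\<i> * of_real (\<kappa> n) * of_real l2) = E2 * c2 n"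
        "sin (\<i> * of_real (\<kappa> n) * of_real l1) = \<i> * (E1 * s1 n)" "sin (\<i> * of_real (\<kappa> n) * of_real l2) = \<i> * (E2 * s2 n)"
        unfolding cos_i_of_real sin_i_of_real E1_def E2_def c1_def c2_def s1_def s2_def by simp_all
      have "- 2 * (loop_sin l2 (\<i> * of_real (\<kappa> n)) * sym_char l1 l2 (\<i> * of_real (\<kappa> n))) = E1 * c1 n * (2 * (E2 * c2 n) - 2 * (E2 * \<epsilon> n)) + E1 * s1 n * (E2 * s2 n)"
      proof -
        have ii: "- (\<i> * u * (\<i> * v)) = u * v" for u v by (simp add: algebra_simps)
        show ?thesis unfolding free_char_eq[symmetric] cs n2 by (simp add: ii)
      qed
      then show ?thesis by (simp add: Y_def algebra_simps)
    qed
    ultimately have "E1 * E2 * X n = (- c / 2) * (E1 * E2 * Y n)"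
      using c[of "\<i> * of_real (\<kappa> n)", folded z_def] unfolding YE[symmetric] by simp
    then have "E1 * E2 * X n = E1 * E2 * ((- c / 2) * Y n)" by (simp add: mult_ac)
    moreover have nz: "E1 * E2 \<noteq> 0" by (simp add: E1_def E2_def)
    ultimately show ?thesis unfolding mult_left_cancel[OF nz] by blast
  qed
  have X: "X \<longlonglongrightarrow> 3/4" and Y: "Y \<longlonglongrightarrow> 3/4" using G(2) G0(2) by (simp_all add: X_def[abs_def] Y_def[abs_def])
  have "X = (\<lambda>n. (- c / 2) * Y n)" by (rule ext) (rule XY)
  then have "X \<longlonglongrightarrow> (- c / 2) * (3/4)" using tendsto_mult[OF tendsto_const Y, of "- c / 2"] by simp
  with X have e: "3/4 = (- c / 2) * (3/4 :: complex)" by (rule LIMSEQ_unique)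
  have "c = - (8/3) * ((- c / 2) * (3/4))" by simp
  also have "\<dots> = - (8/3) * (3/4)" by (simp only: e[symmetric])
  finally show c2: "c = - 2" by simp
  have "X n = Y n" for n using XY[of n] c2 by simp
  then have "(\<lambda>n. of_real (\<kappa> n) * (X n - 3/4)) \<longlonglongrightarrow> 3/2 * (0 + 0)"
    using G0(1) by (simp add: Y_def)
  then have "3/2 * (Q1 + Q2) = 3/2 * (0 + 0)"
    using LIMSEQ_unique[OF G(1)[folded X_def]] by blast
  then have "Q1 + Q2 = 0" unfolding mult_cancel_left by simp
  moreover have "Q1 + Q2 = complex_of_real ((integral {0..l1} q1 + integral {0..l2} q2) / 4)"
    by (simp add: Q1_def Q2_def add_divide_distrib)
  ultimately have "(integral {0..l1} q1 + integral {0..l2} q2) / 4 = 0" by (simp only: of_real_eq_0_iff)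
  then show "integral {0..l1} q1 + integral {0..l2} q2 = 0" by simp
qed

end

section \<open>Positive solutions\<close>

context edge
begin

definition re_sol :: "real \<Rightarrow> real \<Rightarrow> real \<Rightarrow> real \<Rightarrow> real" where
  "re_sol a b r x = Re (sol (of_real a) (of_real b) (of_real r) x)"

definition re_dsol :: "real \<Rightarrow> real \<Rightarrow> real \<Rightarrow> real \<Rightarrow> real" where
  "re_dsol a b r x = Re (dsol (of_real a) (of_real b) (of_real r) x)"

lemma sol_of_real:
  assumes "x \<in> {0..l}"
  shows "sol (of_real a) (of_real b) (of_real r) x = of_real (re_sol a b r x)"
    "dsol (of_real a) (of_real b) (of_real r) x = of_real (re_dsol a b r x)"
  using sol_real[OF _ _ _ assms, of "of_real a" "of_real b" "of_real r"] by (simp_all add: re_sol_def re_dsol_def of_real_Re)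

lemma re_sol_0 [simp]: "re_sol a b r 0 = a" "re_dsol a b r 0 = b"
  by (simp_all add: re_sol_def re_dsol_def)

lemma primitive_re_sol:
  "primitive_on l (re_sol a b r) (re_dsol a b r)"
  "primitive_on l (re_dsol a b r) (\<lambda>t. (q t - r) * re_sol a b r t)"
proof -
  have R: "primitive_on l (\<lambda>x. Re (f x)) (\<lambda>x. Re (g x))" if "primitive_on l f g" for f g
    unfolding primitive_on_def
  proof
    fix x assume "x \<in> {0..l}"
    from has_integral_linear[OF primitive_onD[OF that this] bounded_linear_Re]
    show "((\<lambda>x. Re (g x)) has_integral Re (f x) - Re (f 0)) {0..x}" by (simp add: o_def)
  qed
  note s = sol_is_solution[of "of_real r" "of_real a" "of_real b", unfolded is_solution_def]
  show "primitive_on l (re_sol a b r) (re_dsol a b r)"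
    unfolding re_sol_def[abs_def] re_dsol_def[abs_def] by (rule R[OF conjunct1[OF s]])
  show "primitive_on l (re_dsol a b r) (\<lambda>t. (q t - r) * re_sol a b r t)"
    using R[OF conjunct2[OF s]] by (simp add: re_sol_def[abs_def] re_dsol_def[abs_def])
qed

lemma re_sol_continuous: "continuous_on {0..l} (re_sol a b r)" "continuous_on {0..l} (re_dsol a b r)"
  by (rule primitive_on_continuous[OF primitive_re_sol(1)], rule primitive_on_continuous[OF primitive_re_sol(2)])

lemma re_sol_has_derivative:
  assumes "x \<in> {0..l}"
  shows "(re_sol a b r has_real_derivative re_dsol a b r x) (at x within {0..l})"
  unfolding has_real_derivative_iff_has_vector_derivative
  by (rule primitive_on_has_vector_derivative[OF primitive_re_sol(1) re_sol_continuous(2) assms])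

lemma re_sol_has_derivative_interior:
  assumes "0 < x" "x < l"
  shows "(re_sol a b r has_real_derivative re_dsol a b r x) (at x)"
  using re_sol_has_derivative[of x a b r] at_within_Icc_at[OF assms] assms by simp

lemma re_sol_tendsto:
  assumes "\<And>n. X n \<in> {0..l}" "X \<longlonglongrightarrow> x" "r \<longlonglongrightarrow> s" "x \<in> {0..l}"
  shows "(\<lambda>n. re_sol a b (r n) (X n)) \<longlonglongrightarrow> re_sol a b s x" "(\<lambda>n. re_dsol a b (r n) (X n)) \<longlonglongrightarrow> re_dsol a b s x"
proof -
  have "Bseq r" using assms(3) by (intro convergent_imp_Bseq) (auto simp: convergent_def)
  then obtain K where K: "\<And>n. \<bar>r n\<bar> \<le> K" by (auto simp: Bseq_def)
  have s: "\<bar>s\<bar> \<le> K"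
    by (rule LIMSEQ_le_const2[OF tendsto_rabs[OF assms(3)]]) (use K in auto)
  have lim: "(\<lambda>n. (X n, complex_of_real (r n))) \<longlonglongrightarrow> (x, of_real s)"
    by (intro tendsto_Pair tendsto_of_real assms)
  have m: "(x, complex_of_real s) \<in> {0..l} \<times> cball 0 K" using s assms(4) by simp
  have ev: "\<forall>\<^sub>F n in sequentially. (X n, complex_of_real (r n)) \<in> {0..l} \<times> cball 0 K" using K assms(1) by simp
  show "(\<lambda>n. re_sol a b (r n) (X n)) \<longlonglongrightarrow> re_sol a b s x"
    unfolding re_sol_def using tendsto_Re[OF continuous_on_tendsto_compose[OF sol_continuous(1) lim m ev, of "of_real a" "of_real b"]] by simp
  show "(\<lambda>n. re_dsol a b (r n) (X n)) \<longlonglongrightarrow> re_dsol a b s x"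
    unfolding re_dsol_def using tendsto_Re[OF continuous_on_tendsto_compose[OF sol_continuous(2) lim m ev, of "of_real a" "of_real b"]] by simp
qed

lemma re_wronskian:
  assumes "x \<in> {0..l}"
  shows "re_sol a b r x * re_dsol a' b' r x - re_dsol a b r x * re_sol a' b' r x = a * b' - b * a'"
proof -
  have "complex_of_real (re_sol a b r x * re_dsol a' b' r x - re_dsol a b r x * re_sol a' b' r x) = of_real (a * b' - b * a')"
    using wronskian[OF sol_is_solution[of "of_real r" "of_real a" "of_real b"] sol_is_solution[of "of_real r" "of_real a'" "of_real b'"] assms]
    by (simp add: sol_of_real[OF assms])
  then show ?thesis by (simp only: of_real_eq_iff)
qed

lemma re_sol_no_double_zero:
  assumes "x \<in> {0..l}" "(a, b) \<noteq> (0, 0)"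
  shows "re_sol a b r x \<noteq> 0 \<or> re_dsol a b r x \<noteq> 0"
proof (rule ccontr)
  assume "\<not> ?thesis"
  then have "a * a + b * b = 0" using re_wronskian[OF assms(1), of a b r "- b" a] by simp
  then show False using assms(2) by (simp add: sum_squares_eq_zero_iff)
qed

text \<open>Positivity is stated on the half-open interval because the solution with initial data
  \<open>(0, 1)\<close> vanishes at the origin.\<close>

text \<open>The interval is half-open because the solution with initial data \<open>(0, 1)\<close> vanishes at the
origin.\<close>

definition pos_sol :: "real \<Rightarrow> real \<Rightarrow> real \<Rightarrow> bool" where
  "pos_sol a b r \<longleftrightarrow> (\<forall>x\<in>{0<..l}. re_sol a b r x > 0)"

text \<open>For large \<open>\<kappa>\<close> both \<open>C\<close> and \<open>S'\<close> exceed \<open>cosh (\<kappa> x) - exp (\<kappa> x) / 2\<close>,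
so they are positive, and \<open>S\<close> is increasing.\<close>

lemma pos_sol_start:
  assumes "\<kappa> \<ge> 1" "\<kappa> > 4 * q_norm"
  shows "pos_sol 1 0 (- (\<kappa>\<^sup>2))" "pos_sol 0 1 (- (\<kappa>\<^sup>2))"
proof -
  define \<rho> where "\<rho> = \<i> * complex_of_real \<kappa>"
  have r: "norm \<rho> = \<kappa>" "\<bar>Im \<rho>\<bar> = \<kappa>" "\<rho>\<^sup>2 = of_real (- (\<kappa>\<^sup>2))" using assms by (simp_all add: \<rho>_def norm_mult power_mult_distrib)
  have half: "2 * q_norm / \<kappa> < 1 / 2" using assms by (simp add: field_simps)
  have big: "2 * q_norm \<le> norm \<rho>" "1 \<le> norm \<rho>" using assms q_norm_nonneg r by auto
  have key: "Re w > 0" if "norm (w - cos (\<rho> * of_real x)) \<le> 2 * q_norm / norm \<rho> * exp (\<bar>Im \<rho>\<bar> * x)" for w x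
  proof -
    have "Re (cos (\<rho> * of_real x)) - Re w \<le> 2 * q_norm / \<kappa> * exp (\<kappa> * x)"
      using that abs_Re_le_cmod[of "w - cos (\<rho> * of_real x)"] unfolding r by simp
    also have "\<dots> < 1 / 2 * exp (\<kappa> * x)" using half by (intro mult_strict_right_mono) auto
    also have "\<dots> \<le> Re (cos (\<rho> * of_real x))" unfolding \<rho>_def cos_i_of_real damped_cosh_def
      by simp
    finally show ?thesis by simp
  qed
  have C: "re_sol 1 0 (- (\<kappa>\<^sup>2)) x > 0" if "x \<in> {0..l}" for x
    using key[OF fundamental_bound(5)[OF big that]] unfolding r re_sol_def by simp
  have S: "re_dsol 0 1 (- (\<kappa>\<^sup>2)) x > 0" if "x \<in> {0..l}" for x
    using key[OF fundamental_bound(6)[OF big that]] unfolding r re_dsol_def by simp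
  show "pos_sol 1 0 (- (\<kappa>\<^sup>2))" unfolding pos_sol_def using C by auto
  show "pos_sol 0 1 (- (\<kappa>\<^sup>2))" unfolding pos_sol_def
  proof
    fix x assume x: "x \<in> {0<..l}"
    have "re_sol 0 1 (- (\<kappa>\<^sup>2)) 0 < re_sol 0 1 (- (\<kappa>\<^sup>2)) x"
    proof (rule DERIV_pos_imp_increasing_open[where f = "re_sol 0 1 (- (\<kappa>\<^sup>2))"])
      show "0 < x" using x by simp
      show "continuous_on {0..x} (re_sol 0 1 (- (\<kappa>\<^sup>2)))"
        by (rule continuous_on_subset[OF re_sol_continuous(1)]) (use x in auto)
      fix t assume "0 < t" "t < x"
      then show "\<exists>y. (re_sol 0 1 (- (\<kappa>\<^sup>2)) has_real_derivative y) (at t) \<and> y > 0"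
        using x re_sol_has_derivative_interior[of t 0 1] S[of t] by (intro exI[of _ "re_dsol 0 1 (- (\<kappa>\<^sup>2)) t"]) auto
    qed
    then show "re_sol 0 1 (- (\<kappa>\<^sup>2)) x > 0" by simp
  qed
qed

text \<open>A limit of positive solutions is nonnegative. An interior zero would be a minimum, hence a
double zero, which the constancy of the Wronskian excludes.\<close>

lemma pos_sol_limit:
  assumes pos: "\<And>n. pos_sol a b (r n)" and lim: "r \<longlonglongrightarrow> s" and nt: "(a, b) \<noteq> (0, 0)"
  shows "\<And>x. 0 < x \<Longrightarrow> x < l \<Longrightarrow> re_sol a b s x > 0" "re_sol a b s l \<ge> 0" "re_sol a b s l = 0 \<Longrightarrow> re_dsol a b s l < 0"
proof -
  have ge: "re_sol a b s x \<ge> 0" if "x \<in> {0<..l}" for x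
  proof (rule LIMSEQ_le_const)
    show "(\<lambda>n. re_sol a b (r n) x) \<longlonglongrightarrow> re_sol a b s x"
      by (rule re_sol_tendsto(1)[where X = "\<lambda>_. x"]) (use that lim in auto)
    show "\<exists>N. \<forall>n\<ge>N. 0 \<le> re_sol a b (r n) x" using pos that unfolding pos_sol_def by (auto intro!: exI[of _ 0] less_imp_le)
  qed
  show "re_sol a b s l \<ge> 0" using ge[of l] l_pos by simp
  show "re_sol a b s x > 0" if x: "0 < x" "x < l" for x
  proof (rule ccontr)
    assume "\<not> re_sol a b s x > 0"
    then have z: "re_sol a b s x = 0" using ge[of x] x by simp
    have "re_dsol a b s x = 0"
    proof (rule DERIV_local_min[OF re_sol_has_derivative_interior[OF x], of "min x (l - x)"])
      show "\<forall>y. \<bar>x - y\<bar> < min x (l - x) \<longrightarrow> re_sol a b s x \<le> re_sol a b s y"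
      proof (intro allI impI)
        fix y assume "\<bar>x - y\<bar> < min x (l - x)"
        then have "y \<in> {0<..l}" by auto
        then show "re_sol a b s x \<le> re_sol a b s y" using ge z by simp
      qed
    qed (use x in simp)
    then show False using re_sol_no_double_zero[of x a b s] z nt x by auto
  qed
  show "re_dsol a b s l < 0" if z: "re_sol a b s l = 0"
  proof (rule ccontr)
    assume "\<not> re_dsol a b s l < 0"
    then have p: "re_dsol a b s l > 0" using re_sol_no_double_zero[of l a b s] z nt l_pos by fastforce
    obtain d where d: "d > 0" "\<And>h. h > 0 \<Longrightarrow> l - h \<in> {0..l} \<Longrightarrow> h < d \<Longrightarrow> re_sol a b s (l - h) < re_sol a b s l"
      using has_real_derivative_pos_inc_left[OF re_sol_has_derivative[of l a b s] p] l_pos by auto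
    define h where "h = min (d / 2) (l / 2)"
    have "re_sol a b s (l - h) < 0" using d(2)[of h] d(1) l_pos z by (simp add: h_def min_def split: if_splits)
    moreover have "re_sol a b s (l - h) \<ge> 0" by (rule ge) (use d(1) l_pos in \<open>auto simp: h_def min_def\<close>)
    ultimately show False by simp
  qed
qed

text \<open>A compactness argument in \<open>x\<close>. Accumulation of zeros at the origin is excluded through the
derivative when the solution itself vanishes there.\<close>

lemma pos_sol_open:
  assumes pos: "pos_sol a b s" and ab: "(a, b) = (1, 0) \<or> (a, b) = (0, 1)" and lim: "r \<longlonglongrightarrow> s"
  shows "\<exists>n. pos_sol a b (r n)"
proof (rule ccontr)
  assume "\<not> ?thesis"
  then have "\<forall>n. \<exists>x\<in>{0<..l}. re_sol a b (r n) x \<le> 0" unfolding pos_sol_def by (auto simp: not_less)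
  then obtain X where X: "\<And>n. X n \<in> {0<..l}" "\<And>n. re_sol a b (r n) (X n) \<le> 0" by metis
  have "X n \<in> {0..l}" for n using X(1)[of n] by simp
  then obtain x k where k: "x \<in> {0..l}" "strict_mono k" "(X \<circ> k) \<longlonglongrightarrow> x"
    using compact_Icc[of 0 l, unfolded compact_def, rule_format, of X] by blast
  have lk: "(\<lambda>n. r (k n)) \<longlonglongrightarrow> s" using LIMSEQ_subseq_LIMSEQ[OF lim k(2)] by (simp add: o_def)
  have Xk: "X (k n) \<in> {0..l}" for n using X(1)[of "k n"] by auto
  have "(\<lambda>n. re_sol a b (r (k n)) (X (k n))) \<longlonglongrightarrow> re_sol a b s x"
    by (rule re_sol_tendsto(1)[OF Xk _ lk k(1)]) (use k(3) in \<open>simp add: o_def\<close>)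
  then have le: "re_sol a b s x \<le> 0" by (rule LIMSEQ_le_const2) (use X(2) in auto)
  have "x = 0"
  proof (rule ccontr)
    assume "x \<noteq> 0"
    then have "x \<in> {0<..l}" using k(1) by simp
    then have "re_sol a b s x > 0" using pos unfolding pos_sol_def by blast
    then show False using le by simp
  qed
  from ab show False
  proof
    assume "(a, b) = (1, 0)" then show False using le \<open>x = 0\<close> by simp
  next
    assume ab: "(a, b) = (0, 1)"
    have "\<exists>t. 0 < t \<and> t < X (k n) \<and> re_dsol a b (r (k n)) t \<le> 0" for n
    proof -
      have Xn: "0 < X (k n)" "X (k n) \<le> l" using X(1)[of "k n"] by auto
      obtain d t where t: "0 < t" "t < X (k n)" "(re_sol a b (r (k n)) has_real_derivative d) (at t)"
        "re_sol a b (r (k n)) (X (k n)) - re_sol a b (r (k n)) 0 = (X (k n) - 0) * d"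
      proof (rule exE[OF MVT[OF Xn(1), of "re_sol a b (r (k n))"]])
        show "continuous_on {0..X (k n)} (re_sol a b (r (k n)))"
          by (rule continuous_on_subset[OF re_sol_continuous(1)]) (use Xn in auto)
        show "re_sol a b (r (k n)) differentiable (at t)" if "0 < t" "t < X (k n)" for t
          using re_sol_has_derivative_interior[of t a b "r (k n)"] that Xn(2)
          by (auto simp: real_differentiable_def)
      qed (use that in blast)
      have "d = re_dsol a b (r (k n)) t"
        by (rule DERIV_unique[OF t(3) re_sol_has_derivative_interior]) (use t(1,2) Xn in auto)
      then have "re_sol a b (r (k n)) (X (k n)) = X (k n) * re_dsol a b (r (k n)) t" using t(4) ab by auto
      then show ?thesis using X(2)[of "k n"] Xn(1) t(1,2) by (intro exI[of _ t]) (auto simp: mult_le_0_iff)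
    qed
    then obtain T where T: "\<And>n. 0 < T n" "\<And>n. T n < X (k n)" "\<And>n. re_dsol a b (r (k n)) (T n) \<le> 0" by metis
    have T0: "T \<longlonglongrightarrow> 0"
    proof (rule tendsto_sandwich[of "\<lambda>_. 0" T sequentially "\<lambda>n. X (k n)"])
      show "(\<lambda>n. X (k n)) \<longlonglongrightarrow> 0" using k(3) \<open>x = 0\<close> by (simp add: o_def)
    qed (use T in \<open>auto intro!: always_eventually less_imp_le\<close>)
    have "(\<lambda>n. re_dsol a b (r (k n)) (T n)) \<longlonglongrightarrow> re_dsol a b s 0"
    proof (rule re_sol_tendsto(2)[OF _ T0 lk])
      show "T n \<in> {0..l}" for n using T(1,2)[of n] Xk[of n] by auto
    qed (use l_pos in simp)
    then have "re_dsol a b s 0 \<le> 0" by (rule LIMSEQ_le_const2) (use T(3) in auto)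
    then show False using ab by simp
  qed
qed

lemma pos_sol_eventually:
  assumes "pos_sol a b s" "(a, b) = (1, 0) \<or> (a, b) = (0, 1)" "r \<longlonglongrightarrow> s"
  shows "\<forall>\<^sub>F n in sequentially. pos_sol a b (r n)"
proof (rule ccontr)
  assume "\<not> ?thesis"
  then obtain k :: "nat \<Rightarrow> nat" where k: "strict_mono k" "\<And>n. \<not> pos_sol a b (r (k n))"
    using not_eventually_sequentiallyD by blast
  have "(\<lambda>n. r (k n)) \<longlonglongrightarrow> s" using LIMSEQ_subseq_LIMSEQ[OF assms(3) k(1)] by (simp add: o_def)
  from pos_sol_open[OF assms(1,2) this] k(2) show False by blast
qed

text \<open>The Riccati equation of the logarithmic derivative, from the product rule for \<open>y'\<close>,
which is only an indefinite integral, and \<open>1 / y\<close>, which is continuously differentiable because \<open>y\<close> is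
positive.\<close>

lemma riccati_integral:
  assumes pos: "\<And>x. x \<in> {0..l} \<Longrightarrow> re_sol a b 0 x > 0"
  defines "w \<equiv> \<lambda>x. re_dsol a b 0 x / re_sol a b 0 x"
  shows "continuous_on {0..l} w" "primitive_on l w (\<lambda>t. q t - (w t)\<^sup>2)"
    "integral {0..l} q = integral {0..l} (\<lambda>t. (w t)\<^sup>2) + w l - w 0"
proof -
  have nz: "re_sol a b 0 x \<noteq> 0" if "x \<in> {0..l}" for x using pos[OF that] by simp
  show cw: "continuous_on {0..l} w" unfolding w_def by (intro continuous_on_divide re_sol_continuous ballI nz)
  have i: "primitive_on l (\<lambda>x. inverse (re_sol a b 0 x)) (\<lambda>x. - (re_dsol a b 0 x * inverse ((re_sol a b 0 x)\<^sup>2)))"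
  proof (rule primitive_on_deriv)
    fix x assume x: "x \<in> {0..l}"
    have "((\<lambda>x. inverse (re_sol a b 0 x)) has_real_derivative - (re_dsol a b 0 x * inverse ((re_sol a b 0 x)\<^sup>2))) (at x within {0..l})"
      using DERIV_inverse_fun[OF re_sol_has_derivative[OF x] nz[OF x]] by (simp add: power2_eq_square)
    then show "((\<lambda>x. inverse (re_sol a b 0 x)) has_vector_derivative - (re_dsol a b 0 x * inverse ((re_sol a b 0 x)\<^sup>2))) (at x within {0..l})"
      by (simp add: has_real_derivative_iff_has_vector_derivative)
  qed
  show pw: "primitive_on l w (\<lambda>t. q t - (w t)\<^sup>2)"
  proof (rule primitive_on_cong[OF primitive_on_mult[OF primitive_re_sol(2) i]])
    fix x assume x: "x \<in> {0..l}"
    show "re_dsol a b 0 x * inverse (re_sol a b 0 x) = w x" by (simp add: w_def divide_inverse)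
    show "(q x - 0) * re_sol a b 0 x * inverse (re_sol a b 0 x) + re_dsol a b 0 x * - (re_dsol a b 0 x * inverse ((re_sol a b 0 x)\<^sup>2)) = q x - (w x)\<^sup>2"
      using nz[OF x] by (simp add: w_def field_simps power2_eq_square)
  qed
  have wi: "(\<lambda>t. (w t)\<^sup>2) integrable_on {0..l}" by (intro integrable_continuous_real continuous_intros cw)
  have "((\<lambda>t. (q t - (w t)\<^sup>2) + (w t)\<^sup>2) has_integral (w l - w 0) + integral {0..l} (\<lambda>t. (w t)\<^sup>2)) {0..l}"
    by (intro has_integral_add primitive_onD[OF pw] integrable_integral wi) (use l_pos in simp)
  then show "integral {0..l} q = integral {0..l} (\<lambda>t. (w t)\<^sup>2) + w l - w 0"
    by (simp add: integral_unique)
qed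

end

section \<open>Potentials with vanishing mean and a positive solution\<close>

text \<open>If all integrals over subintervals vanish, Henstock's lemma for \<open>q\<close> says that
\<open>\<Sum> |q(x)| |K|\<close> is small on fine divisions, which means that \<open>\<bar>q\<bar>\<close> has integral \<open>0\<close>.\<close>

lemma null_primitive_imp_AE_zero:
  fixes q :: "real \<Rightarrow> real"
  assumes l: "0 \<le> l" and p: "primitive_on l (\<lambda>_. 0) q"
  shows "AE x in lebesgue_on {0..l}. q x = 0"
proof -
  have z: "integral {u..v} q = 0" if "0 \<le> u" "u \<le> v" "v \<le> l" for u v
    using primitive_on_subinterval[OF p that] by (simp add: integral_unique)
  have qi: "q integrable_on cbox 0 l" using primitive_on_integrable[OF p, of l] l by simp
  have I: "((\<lambda>x. \<bar>q x\<bar>) has_integral 0) {0..l}"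
    unfolding has_integral_real
  proof (intro allI impI)
    fix e :: real assume "e > 0"
    obtain \<gamma> where g: "gauge \<gamma>" and H: "\<And>p. \<lbrakk>p tagged_partial_division_of (cbox 0 l); \<gamma> fine p\<rbrakk> \<Longrightarrow>
             sum (\<lambda>(x,k). norm(measure lborel k *\<^sub>R q x - integral k q)) p < e"
      by (rule Henstock_lemma[OF qi \<open>e > 0\<close>]) (erule that)
    have "norm ((\<Sum>(x,K)\<in>p. measure lborel K *\<^sub>R \<bar>q x\<bar>) - 0) < e" if t: "p tagged_division_of {0..l}" "\<gamma> fine p" for p
    proof -
      have eq: "(\<Sum>(x,K)\<in>p. measure lborel K *\<^sub>R \<bar>q x\<bar>) = (\<Sum>(x,K)\<in>p. norm (measure lborel K *\<^sub>R q x - integral K q))"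
      proof (rule sum.cong[OF refl], clarify)
        fix x K assume xK: "(x, K) \<in> p"
        note iv = tagged_division_interval[OF t(1) xK]
        have "integral {Inf K..Sup K} q = 0" using iv(2-5) by (intro z) auto
        then have "integral K q = 0" using iv(1) by simp
        then show "measure lborel K *\<^sub>R \<bar>q x\<bar> = norm (measure lborel K *\<^sub>R q x - integral K q)"
          by (simp add: abs_mult)
      qed
      have lt: "(\<Sum>(x,K)\<in>p. norm (measure lborel K *\<^sub>R q x - integral K q)) < e"
        using H[of p] t by (simp add: tagged_division_of_def)
      have "(\<Sum>(x,K)\<in>p. norm (measure lborel K *\<^sub>R q x - integral K q)) \<ge> 0" by (intro sum_nonneg) auto
      then show ?thesis unfolding eq using lt by simp
    qed
    then show "\<exists>\<gamma>. gauge \<gamma> \<and> (\<forall>\<D>. \<D> tagged_division_of {0..l} \<and> \<gamma> fine \<D> \<longrightarrow>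
        norm ((\<Sum>(x,K)\<in>\<D>. measure lborel K *\<^sub>R \<bar>q x\<bar>) - 0) < e)"
      using g by (intro exI[of _ \<gamma>] conjI allI impI) auto
  qed
  have ai: "(\<lambda>x. \<bar>q x\<bar>) absolutely_integrable_on {0..l}"
    by (rule nonnegative_absolutely_integrable_1) (use I in auto)
  have i: "integrable (lebesgue_on {0..l}) (\<lambda>x. \<bar>q x\<bar>)"
    by (rule absolutely_integrable_imp_integrable[OF ai]) auto
  have "integral\<^sup>L (lebesgue_on {0..l}) (\<lambda>x. \<bar>q x\<bar>) = 0"
    using lebesgue_integral_eq_integral[OF i] I by (simp add: integral_unique)
  then show ?thesis
    using integral_nonneg_eq_0_iff_AE[OF i] by simp
qed

lemma real_L2_absolutely_integrable:
  assumes "real_L2 l q"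
  shows "q absolutely_integrable_on {0..l}"
proof (rule measurable_bounded_by_integrable_imp_absolutely_integrable)
  show "q \<in> borel_measurable (lebesgue_on {0..l})" using assms by (simp add: real_L2_def)
  have "(\<lambda>x. (q x)\<^sup>2) integrable_on {0..l}"
    using assms by (intro integrable_on_lebesgue_on) (auto simp: real_L2_def)
  then show "(\<lambda>x. 1 + (q x)\<^sup>2) integrable_on {0..l}" by (intro integrable_add integrable_const_ivl)
  show "norm (q x) \<le> 1 + (q x)\<^sup>2" for x
    using sum_squares_bound[of 1 "\<bar>q x\<bar>"] by simp
qed auto

context lasso_problem
begin

definition re_char :: "real \<Rightarrow> real" where
  "re_char r = e1.re_sol 1 0 r l1 * (e2.re_sol 1 0 r l2 + e2.re_dsol 0 1 r l2 - 2) + e1.re_dsol 1 0 r l1 * e2.re_sol 0 1 r l2"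

lemma char_fun_of_real: "char_fun (of_real r) = of_real (re_char r)"
  using e1.sol_of_real[OF l_mem(1), of 1 0 r] e2.sol_of_real[OF l_mem(2), of 1 0 r] e2.sol_of_real[OF l_mem(2), of 0 1 r]
  by (simp add: char_fun_def re_char_def)

text \<open>Let \<open>s\<close> be the infimum of the parameters \<open>r \<le> 0\<close> at which positivity fails. If both
solutions are positive at the far ends at \<open>s\<close>, positivity persists near \<open>s\<close>. If \<open>C\<^sub>1(l1) = 0\<close>, then
\<open>C\<^sub>1'(l1) < 0\<close> and \<open>\<Delta> = C\<^sub>1' S\<^sub>2 \<ge> 0\<close> forces \<open>S\<^sub>2(l2) = 0\<close>. If \<open>S\<^sub>2(l2) = 0\<close>, then \<open>S\<^sub>2'(l2) < 0\<close>, the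
Wronskian gives \<open>C\<^sub>2(l2) < 0\<close>, and \<open>\<Delta> = C\<^sub>1 (C\<^sub>2 + S\<^sub>2' - 2) \<ge> 0\<close> forces \<open>C\<^sub>1(l1) = 0\<close>. So both vanish,
and slightly below \<open>s\<close> both terms of \<open>\<Delta>\<close> are negative, which contradicts \<open>\<Delta> > 0\<close>.\<close>

lemma positive_up_to_zero:
  assumes neg: "\<And>r. r < 0 \<Longrightarrow> re_char r > 0" and zero: "re_char 0 = 0"
  shows "e1.pos_sol 1 0 0 \<and> e2.pos_sol 0 1 0"
proof -
  note l = e1.l_pos e2.l_pos
  define good where "good r \<longleftrightarrow> e1.pos_sol 1 0 r \<and> e2.pos_sol 0 1 r" for r
  define Bd where "Bd = {r. r \<le> 0 \<and> \<not> good r}"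
  have "Bd = {}"
  proof (rule ccontr)
    assume ne: "Bd \<noteq> {}"
    \<comment> \<open>Positivity holds below \<open>- K\<^sup>2\<close>, so the set of failures is bounded below.\<close>
    define K where "K = 1 + 4 * e1.q_norm + 4 * e2.q_norm"
    have K: "K \<ge> 1" using e1.q_norm_nonneg e2.q_norm_nonneg by (simp add: K_def)
    have start: "good r" if "r < - (K\<^sup>2)" for r
    proof -
      define \<kappa> where "\<kappa> = sqrt (- r)"
      have r0: "- r > 0" using that zero_le_power2[of K] by linarith
      have "K < \<kappa>" unfolding \<kappa>_def using that K by (intro real_less_rsqrt) simp
      then have "\<kappa> \<ge> 1" "\<kappa> > 4 * e1.q_norm" "\<kappa> > 4 * e2.q_norm"
        using K e1.q_norm_nonneg e2.q_norm_nonneg by (auto simp: K_def)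
      moreover have "r = - (\<kappa>\<^sup>2)" using r0 by (simp add: \<kappa>_def)
      ultimately show ?thesis unfolding good_def using e1.pos_sol_start(1)[of \<kappa>] e2.pos_sol_start(2)[of \<kappa>] by simp
    qed
    have bb: "bdd_below Bd"
    proof (rule bdd_belowI)
      show "- (K\<^sup>2) \<le> r" if "r \<in> Bd" for r using start[of r] that by (force simp: Bd_def)
    qed
    define s where "s = Inf Bd"
    have s0: "s \<le> 0"
    proof -
      obtain r where "r \<in> Bd" using ne by blast
      then have "s \<le> r" unfolding s_def by (intro cInf_lower bb)
      then show ?thesis using \<open>r \<in> Bd\<close> by (simp add: Bd_def)
    qed
    have below: "good r" if "r < s" for r
    proof (rule ccontr)
      assume "\<not> good r"
      then have "r \<in> Bd" using that s0 by (simp add: Bd_def)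
      then have "s \<le> r" unfolding s_def by (intro cInf_lower bb)
      then show False using that by simp
    qed
    define r where "r n = s - inverse (real (Suc n))" for n
    have rs: "r n < s" for n by (simp add: r_def)
    have rlim: "r \<longlonglongrightarrow> s"
      unfolding r_def using tendsto_diff[OF tendsto_const LIMSEQ_inverse_real_of_nat, of s] by simp
    have g1: "e1.pos_sol 1 0 (r n)" and g2: "e2.pos_sol 0 1 (r n)" for n using below[OF rs] by (auto simp: good_def)
    note p1 = e1.pos_sol_limit[OF g1 rlim, simplified] and p2 = e2.pos_sol_limit[OF g2 rlim, simplified]
    have cs: "re_char s \<ge> 0" using neg[of s] zero s0 by (cases "s = 0") auto
    show False
    proof (cases "e1.re_sol 1 0 s l1 > 0 \<and> e2.re_sol 0 1 s l2 > 0")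
      case True
      have "e1.pos_sol 1 0 s" "e2.pos_sol 0 1 s"
        unfolding e1.pos_sol_def e2.pos_sol_def using True p1(1) p2(1) by (auto simp: le_less)
      have "\<exists>t\<in>Bd. t < s + inverse (real (Suc n))" for n
        unfolding s_def using cInf_lessD[OF ne, of "Inf Bd + inverse (real (Suc n))"] by simp
      then obtain t where t: "\<And>n. t n \<in> Bd" "\<And>n. t n < s + inverse (real (Suc n))" by metis
      have tlim: "t \<longlonglongrightarrow> s"
      proof (rule tendsto_sandwich[of "\<lambda>_. s" t sequentially "\<lambda>n. s + inverse (real (Suc n))"])
        show "\<forall>\<^sub>F n in sequentially. s \<le> t n" using t(1) bb unfolding s_def by (intro always_eventually allI cInf_lower) auto
        show "\<forall>\<^sub>F n in sequentially. t n \<le> s + inverse (real (Suc n))" using t(2) by (intro always_eventually allI less_imp_le)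
        show "(\<lambda>n. s + inverse (real (Suc n))) \<longlonglongrightarrow> s" using tendsto_add[OF tendsto_const LIMSEQ_inverse_real_of_nat, of s] by simp
      qed simp
      have "\<forall>\<^sub>F n in sequentially. e1.pos_sol 1 0 (t n)" "\<forall>\<^sub>F n in sequentially. e2.pos_sol 0 1 (t n)"
        using e1.pos_sol_eventually[OF \<open>e1.pos_sol 1 0 s\<close> _ tlim] e2.pos_sol_eventually[OF \<open>e2.pos_sol 0 1 s\<close> _ tlim] by auto
      then have "\<forall>\<^sub>F n in sequentially. good (t n)" unfolding good_def by (rule eventually_conj)
      then obtain n where "good (t n)" by (auto simp: eventually_sequentially)
      then show False using t(1)[of n] by (simp add: Bd_def)
    next
      case False
      have W: "e2.re_sol 1 0 s l2 * e2.re_dsol 0 1 s l2 - e2.re_dsol 1 0 s l2 * e2.re_sol 0 1 s l2 = 1"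
        using e2.re_wronskian[OF l_mem(2), of 1 0 s 0 1] by simp
      have S0: "e1.re_sol 1 0 s l1 = 0 \<and> e2.re_dsol 0 1 s l2 < 0 \<and> e2.re_sol 1 0 s l2 < 0" if z: "e2.re_sol 0 1 s l2 = 0"
      proof -
        have d: "e2.re_dsol 0 1 s l2 < 0" by (rule p2(3)[OF z])
        have "e2.re_sol 1 0 s l2 * e2.re_dsol 0 1 s l2 > 0" using W z by simp
        then have c: "e2.re_sol 1 0 s l2 < 0" using d by (simp add: zero_less_mult_iff)
        have "e1.re_sol 1 0 s l1 * (e2.re_sol 1 0 s l2 + e2.re_dsol 0 1 s l2 - 2) \<ge> 0" using cs z by (simp add: re_char_def)
        then have "e1.re_sol 1 0 s l1 \<le> 0" using c d by (simp add: zero_le_mult_iff)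
        then show ?thesis using p1(2) c d by simp
      qed
      have C0: "e1.re_dsol 1 0 s l1 < 0 \<and> e2.re_sol 0 1 s l2 = 0" if z: "e1.re_sol 1 0 s l1 = 0"
      proof -
        have d: "e1.re_dsol 1 0 s l1 < 0" by (rule p1(3)[OF z])
        have "e1.re_dsol 1 0 s l1 * e2.re_sol 0 1 s l2 \<ge> 0" using cs z by (simp add: re_char_def)
        then have "e2.re_sol 0 1 s l2 \<le> 0" using d by (simp add: zero_le_mult_iff)
        then show ?thesis using p2(2) d by simp
      qed
      have "e1.re_sol 1 0 s l1 = 0 \<or> e2.re_sol 0 1 s l2 = 0" using False p1(2) p2(2) by auto
      then have all: "e1.re_dsol 1 0 s l1 < 0" "e2.re_sol 1 0 s l2 + e2.re_dsol 0 1 s l2 - 2 < 0"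
        using S0 C0 by auto
      have L1: "(\<lambda>n. e1.re_dsol 1 0 (r n) l1) \<longlonglongrightarrow> e1.re_dsol 1 0 s l1"
        by (rule e1.re_sol_tendsto(2)[where X = "\<lambda>_. l1"]) (use rlim l in auto)
      have L2: "(\<lambda>n. e2.re_sol 1 0 (r n) l2 + e2.re_dsol 0 1 (r n) l2 - 2) \<longlonglongrightarrow> e2.re_sol 1 0 s l2 + e2.re_dsol 0 1 s l2 - 2"
        by (intro tendsto_intros e2.re_sol_tendsto[where X = "\<lambda>_. l2"]) (use rlim l in auto)
      have "\<forall>\<^sub>F n in sequentially. e1.re_dsol 1 0 (r n) l1 < 0 \<and> e2.re_sol 1 0 (r n) l2 + e2.re_dsol 0 1 (r n) l2 - 2 < 0"
        by (intro eventually_conj order_tendstoD(2)[OF L1] order_tendstoD(2)[OF L2] all)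
      then obtain n where n: "e1.re_dsol 1 0 (r n) l1 < 0" "e2.re_sol 1 0 (r n) l2 + e2.re_dsol 0 1 (r n) l2 - 2 < 0"
        by (auto simp: eventually_sequentially)
      have "e1.re_sol 1 0 (r n) l1 > 0" "e2.re_sol 0 1 (r n) l2 > 0"
        using g1[of n] g2[of n] l by (auto simp: e1.pos_sol_def e2.pos_sol_def)
      then have "re_char (r n) < 0" unfolding re_char_def using n by (intro add_neg_neg mult_pos_neg mult_neg_pos)
      moreover have "re_char (r n) > 0" using rs[of n] s0 by (intro neg) simp
      ultimately show False by simp
    qed
  qed
  then have "good 0" unfolding Bd_def by blast
  then show ?thesis by (simp add: good_def)
qed

text \<open>On the loop the positive eigenfunction is the solution with boundary values \<open>1\<close> at both
ends, here with initial data \<open>(1, d)\<close>; on the boundary edge it is \<open>C\<^sub>1\<close> up to a factor, which does not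
affect the logarithmic derivative. The boundary terms of the two Riccati integrals add up to
\<open>\<Delta>(0) / (C\<^sub>1 S\<^sub>2) = 0\<close>.\<close>

lemma potential_zero:
  assumes pos: "e1.pos_sol 1 0 0" "e2.pos_sol 0 1 0" and zero: "re_char 0 = 0"
    and mean: "integral {0..l1} q1 + integral {0..l2} q2 = 0"
  shows "(AE x in lebesgue_on {0..l1}. q1 x = 0) \<and> (AE x in lebesgue_on {0..l2}. q2 x = 0)"
proof -
  note l = e1.l_pos e2.l_pos
  have y1: "e1.re_sol 1 0 0 x > 0" if "x \<in> {0..l1}" for x
    using pos(1) that by (cases "x = 0") (auto simp: e1.pos_sol_def)
  have S: "e2.re_sol 0 1 0 x > 0" if "x \<in> {0<..l2}" for x
    using pos(2) that by (auto simp: e2.pos_sol_def)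
  define C D S1 D1 where "C = e2.re_sol 1 0 0 l2" "D = e2.re_dsol 1 0 0 l2" "S1 = e2.re_sol 0 1 0 l2" "D1 = e2.re_dsol 0 1 0 l2"
  have S1: "S1 > 0" using S[of l2] l by (simp add: C_D_S1_D1_def)
  define d where "d = (1 - C) / S1"
  have lin: "e2.re_sol 1 d 0 x = e2.re_sol 1 0 0 x + d * e2.re_sol 0 1 0 x"
     "e2.re_dsol 1 d 0 x = e2.re_dsol 1 0 0 x + d * e2.re_dsol 0 1 0 x" if "x \<in> {0..l2}" for x
    using e2.sol_linear[OF that, of 1 "of_real d" 0] by (simp_all add: e2.re_sol_def e2.re_dsol_def)
  have end1: "e2.re_sol 1 d 0 l2 = 1" using lin(1)[OF l_mem(2)] S1 by (simp add: C_D_S1_D1_def[symmetric] d_def)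
  have end2: "e2.re_dsol 1 d 0 l2 = D + d * D1" using lin(2)[OF l_mem(2)] by (simp add: C_D_S1_D1_def)
  have W: "e2.re_sol 1 d 0 x * e2.re_dsol 0 1 0 x - e2.re_dsol 1 d 0 x * e2.re_sol 0 1 0 x = 1" if "x \<in> {0..l2}" for x
    using e2.re_wronskian[OF that, of 1 d 0 0 1] by simp
  \<comment> \<open>The quotient of the two solutions is decreasing, so positivity at the far end spreads.\<close>
  have y2: "e2.re_sol 1 d 0 x > 0" if x: "x \<in> {0..l2}" for x
  proof (cases "x = 0 \<or> x = l2")
    case True then show ?thesis using end1 by auto
  next
    case False
    then have x': "0 < x" "x < l2" using x by auto
    define f where "f t = e2.re_sol 1 d 0 t / e2.re_sol 0 1 0 t" for t
    have "f x > f l2"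
    proof (rule DERIV_neg_imp_decreasing_open[OF x'(2), where f = f])
      have nz: "e2.re_sol 0 1 0 t \<noteq> 0" if "t \<in> {x..l2}" for t using S[of t] that x' by force
      show "continuous_on {x..l2} f" unfolding f_def
        by (intro continuous_on_divide continuous_on_subset[OF e2.re_sol_continuous(1)] ballI nz) (use x' in auto)
      fix t assume t: "x < t" "t < l2"
      have t': "0 < t" "t \<in> {0..l2}" using t x' by auto
      have St: "e2.re_sol 0 1 0 t > 0" using S[of t] t t' by simp
      have "(f has_real_derivative (e2.re_dsol 1 d 0 t * e2.re_sol 0 1 0 t - e2.re_sol 1 d 0 t * e2.re_dsol 0 1 0 t) / (e2.re_sol 0 1 0 t * e2.re_sol 0 1 0 t)) (at t)"
        unfolding f_def[abs_def]
        by (intro DERIV_divide e2.re_sol_has_derivative_interior t' t) (use St in simp)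
      moreover have "e2.re_dsol 1 d 0 t * e2.re_sol 0 1 0 t - e2.re_sol 1 d 0 t * e2.re_dsol 0 1 0 t = - 1" using W[OF t'(2)] by simp
      ultimately show "\<exists>y. (f has_real_derivative y) (at t) \<and> y < 0"
        using St by (intro exI[of _ "- 1 / (e2.re_sol 0 1 0 t * e2.re_sol 0 1 0 t)"]) simp
    qed
    moreover have "f l2 > 0" using end1 S1 by (simp add: f_def C_D_S1_D1_def)
    ultimately have "f x > 0" by simp
    then show ?thesis using S[of x] x' by (simp add: f_def zero_less_divide_iff)
  qed
  define w1 where "w1 x = e1.re_dsol 1 0 0 x / e1.re_sol 1 0 0 x" for x
  define w2 where "w2 x = e2.re_dsol 1 d 0 x / e2.re_sol 1 d 0 x" for x
  note R1 = e1.riccati_integral[OF y1, folded w1_def]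
  note R2 = e2.riccati_integral[OF y2, folded w2_def]
  have bd: "w1 l1 - w1 0 + (w2 l2 - w2 0) = 0"
  proof -
    define P P' where "P = e1.re_sol 1 0 0 l1" "P' = e1.re_dsol 1 0 0 l1"
    have P: "P > 0" using y1[OF l_mem(1)] by (simp add: P_P'_def)
    have c: "P * (C + D1 - 2) + P' * S1 = 0" using zero by (simp add: re_char_def P_P'_def C_D_S1_D1_def)
    have W0: "C * D1 - D * S1 = 1" using e2.re_wronskian[OF l_mem(2), of 1 0 0 0 1] by (simp add: C_D_S1_D1_def)
    have "w1 l1 = P' / P" "w1 0 = 0" "w2 l2 = D + d * D1" "w2 0 = d"
      using end1 end2 by (simp_all add: w1_def w2_def P_P'_def)
    moreover have dS: "d * S1 = 1 - C" using S1 by (simp add: d_def)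
    have "(P' / P + (D + d * D1 - d)) * (P * S1) = P' * S1 + P * (D * S1 + (d * S1) * (D1 - 1))"
      using P by (simp add: field_simps)
    then have "(P' / P + (D + d * D1 - d)) * (P * S1) = P' * S1 + P * (D * S1 + (1 - C) * (D1 - 1))"
      unfolding dS .
    then have "(P' / P + (D + d * D1 - d)) * (P * S1) = P' * S1 + P * (C + D1 - 2 + (1 - (C * D1 - D * S1)))"
      by (simp add: algebra_simps)
    then have "(P' / P + (D + d * D1 - d)) * (P * S1) = 0" unfolding W0 using c by (simp add: algebra_simps)
    ultimately show ?thesis using P S1 by simp
  qed
  have i: "integral {0..l1} (\<lambda>t. (w1 t)\<^sup>2) \<ge> 0" "integral {0..l2} (\<lambda>t. (w2 t)\<^sup>2) \<ge> 0"
    by (intro integral_nonneg integrable_continuous_real continuous_on_power R1(1) R2(1); simp)+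
  have "integral {0..l1} (\<lambda>t. (w1 t)\<^sup>2) + integral {0..l2} (\<lambda>t. (w2 t)\<^sup>2) = 0"
    using R1(3) R2(3) mean bd by linarith
  then have i0: "integral {0..l1} (\<lambda>t. (w1 t)\<^sup>2) = 0" "integral {0..l2} (\<lambda>t. (w2 t)\<^sup>2) = 0" using i by linarith+
  have z1: "w1 x = 0" if "x \<in> {0..l1}" for x
    using integral_eq_0_iff[of 0 l1 "\<lambda>t. (w1 t)\<^sup>2"] i0(1) that l(1) continuous_on_power[OF R1(1), of 2] by simp
  have z2: "w2 x = 0" if "x \<in> {0..l2}" for x
    using integral_eq_0_iff[of 0 l2 "\<lambda>t. (w2 t)\<^sup>2"] i0(2) that l(2) continuous_on_power[OF R2(1), of 2] by simp
  have "primitive_on l1 (\<lambda>_. 0) q1" by (rule primitive_on_cong[OF R1(2)]) (simp_all add: z1)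
  moreover have "primitive_on l2 (\<lambda>_. 0) q2" by (rule primitive_on_cong[OF R2(2)]) (simp_all add: z2)
  ultimately show ?thesis using null_primitive_imp_AE_zero l by simp
qed

end

theorem theorem1p1:
  fixes l1 l2 :: real and q1 q2 :: "real \<Rightarrow> real" and lam lam0 :: "nat \<Rightarrow> real"
  assumes "l1 > 0" and "l2 > 0"
    and "real_L2 l1 q1" and "real_L2 l2 q2"
    and "lasso_eigenvalues l1 l2 q1 q2 lam"
    and "lasso_eigenvalues l1 l2 (\<lambda>_. 0) (\<lambda>_. 0) lam0"
    and "\<forall>n. lam n = lam0 n"
  shows "(AE x in lebesgue_on {0..l1}. q1 x = 0) \<and> (AE x in lebesgue_on {0..l2}. q2 x = 0)"
proof -
  interpret lasso_problem l1 l2 q1 q2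
    using assms(1-4) by unfold_locales (auto intro: real_L2_absolutely_integrable)
  have "lam = lam0" using assms(7) by auto
  then have dims: "lasso.dim (lasso_eigenspace l1 l2 q1 q2 z) = lasso.dim (lasso_eigenspace l1 l2 (\<lambda>_. 0) (\<lambda>_. 0) z)" for z
    using assms(5,6) by (simp add: lasso_eigenvalues_def)
  have real: "z \<in> \<real>" if "lasso.dim (lasso_eigenspace l1 l2 (\<lambda>_. 0) (\<lambda>_. 0) z) \<ge> 1" for z
  proof -
    have "card {n. complex_of_real (lam0 n) = z} \<ge> 1" using that assms(6) by (simp add: lasso_eigenvalues_def)
    then have "{n. complex_of_real (lam0 n) = z} \<noteq> {}" by force
    then show ?thesis by auto
  qed
  obtain c where c: "\<And>\<rho>. char_fun (\<rho>\<^sup>2) = c * (loop_sin l2 \<rho> * sym_char l1 l2 \<rho>)"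
    by (rule isospectral_char_fun[OF dims]) (erule real, rule that)
  note mean = isospectral_mean_zero[OF c]
  have zero: "re_char 0 = 0"
    using c[of 0] char_fun_of_real[of 0] by (simp add: loop_sin_def)
  have neg: "re_char r > 0" if "r < 0" for r
  proof -
    define \<kappa> where "\<kappa> = sqrt (- r)"
    have k: "\<kappa> > 0" and r: "r = - (\<kappa>\<^sup>2)" using that by (simp_all add: \<kappa>_def)
    define a b where "a = \<kappa> * l1" and "b = \<kappa> * (l2 / 2)"
    have e: "\<i> * complex_of_real \<kappa> * of_real l1 = \<i> * of_real a" "\<i> * complex_of_real \<kappa> * of_real (l2 / 2) = \<i> * of_real b"
      by (simp_all add: a_def b_def)
    have "complex_of_real (re_char r) = char_fun ((\<i> * of_real \<kappa>)\<^sup>2)"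
      unfolding char_fun_of_real[symmetric] r by (simp add: power_mult_distrib)
    also have "\<dots> = of_real (2 * sinh b * (2 * cosh a * sinh b + sinh a * cosh b))"
      unfolding c mean(1) loop_sin_def sym_char_def e cos_i_cosh sin_i_sinh by (simp add: algebra_simps)
    finally have "re_char r = 2 * sinh b * (2 * cosh a * sinh b + sinh a * cosh b)" by (simp only: of_real_eq_iff)
    moreover have "sinh a > 0" "sinh b > 0" using k assms(1,2) by (simp_all add: a_def b_def)
    ultimately show ?thesis using cosh_real_pos[of a] cosh_real_pos[of b] by (simp add: add_pos_pos)
  qed
  have "e1.pos_sol 1 0 0 \<and> e2.pos_sol 0 1 0" by (rule positive_up_to_zero[OF neg zero])
  then show ?thesis using potential_zero zero mean(2) by blast
qed

end
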